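(* Let $\mathcal{G}=(X,Y,A,B,\lambda)$ be an imitation game, and let $p\in\mathcal{C}_{ns}(\mathcal{G})$ be a perfect non-signalling correlation. The following statements are equivalent: (1) $p\in\mathcal{C}_{qa}(\mathcal{G})$; (2) there exists a state $\tau$ on $\mathcal{A}(X,A)\otimes_{\min}\mathcal{A}(Y,B)$ such that $$p(a,b\mid x,y)=\tau(e_a^x\otimes f_b^y)\quad\text{for all } x\in X,\ y\in Y,\ a\in A,\ b\in B,$$ and the restrictions $\tau|_{\mathcal{A}(X,A)\otimes\mathbf{1}}$ and $\tau|_{\mathbf{1}\otimes\mathcal{A}(Y,B)}$ are both tracial.
   Context: A non-local game $\mathcal{G}=(X,Y,A,B,\lambda)$ consists of finite sets $X,Y$ (questions for Alice and Bob), finite sets $A,B$ (answers for Alice and Bob), and a scoring function $\lambda:X\times Y\times A\times B\to\{0,1\}$. The game is an imitation game if: (a) for any $x\in X$ and $a,a'\in A$ with $a\neq a'$, there exists $y\in Y$ such that $\sum_{b\in B}\lambda(x,y,a,b)\lambda(x,y,a',b)=0$; and (b) for any $y\in Y$ and $b,b'\in B$ with $b\neq b'$, there exists $x\in X$ such that $\sum_{a\in A}\lambda(x,y,a,b)\lambda(x,y,a,b')=0$. A non-signalling correlation is a function $p:X\times Y\times A\times B\to[0,1]$, written $p(a,b\mid x,y)$, such that $\sum_{b}p(a,b\mid x,y)=\sum_b p(a,b\mid x,y')$ for all $x\in X$, $y,y'\in Y$, $a\in A$; $\sum_a p(a,b\mid x,y)=\sum_a p(a,b\mid x',y)$ for all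 $x,x'\in X$, $y\in Y$, $b\in B$; and $\sum_{(a,b)\in A\times B}p(a,b\mid x,y)=1$ for all $x\in X$, $y\in Y$. The set of these is $\mathcal{C}_{ns}(X,Y,A,B)$. A correlation $p$ is perfect for $\mathcal{G}$ if $\lambda(x,y,a,b)=0$ implies $p(a,b\mid x,y)=0$; $\mathcal{C}_{ns}(\mathcal{G})$ is the set of perfect non-signalling correlations. $p\in\mathcal{C}_{ns}(X,Y,A,B)$ is a quantum correlation if there are finite-dimensional Hilbert spaces $\mathcal{H}_A,\mathcal{H}_B$, a unit vector $\psi\in\mathcal{H}_A\otimes\mathcal{H}_B$, and, for every $x\in X$ and $y\in Y$, projection-valued measures $\{P_a^x:a\in A\}\subset\mathcal{B}(\mathcal{H}_A)$ and $\{Q_b^y:b\in B\}\subset\mathcal{B}(\mathcal{H}_B)$ (families of orthogonal projections summing to the identity) with $p(a,b\mid x,y)=\langle\psi|P_a^x\otimes Q_b^y|\psi\rangle$. The set of these is $\mathcal{C}_q(X,Y,A,B)$; its closure is $\mathcal{C}_{qa}(X,Y,A,B)$, and $\mathcal{C}_{qa}(\mathcal{G})=\mathcal{C}_{ns}(\mathcal{G})\cap\mathcal{C}_{qa}(X,Y,A,B)$. $\mathcal{A}(X,A)$ is the universal (unital) C$^*$-algebra generated by projections $e_a^x$ ($x\in X$, $a\in A$) satisfying $\sum_{a\in A}e_a^x=1$ for all $x\in X$; $\mathcal{A}(Y,B)$ is the universal C$^*$-algebra generated by projections $f_b^y$ ($y\in Y$, $b\in B$) satisfying $\sum_{b\in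 B}f_b^y=1$ for all $y\in Y$. $\otimes_{\min}$ is the minimal (spatial) C$^*$-tensor product. A state is a positive linear functional with value $1$ at the unit; it is tracial if $\tau(ab)=\tau(ba)$ for all $a,b$ in its domain. *)

theory Defs
  imports "HOL-Analysis.Analysis"
begin

section \<open>The Hilbert spaces l2(I)\<close>

(* The complex Hilbert space of square-summable families indexed by the type 'i. *)
typedef 'i ell2 = "{f :: 'i \<Rightarrow> complex. (\<lambda>i. (cmod (f i))\<^sup>2) summable_on UNIV}"
  morphisms coord Abs_ell2
  by (rule exI[of _ "\<lambda>_. 0"]) simp

setup_lifting type_definition_ell2

lemma ell2_eqI: "(\<And>i. coord u i = coord v i) \<Longrightarrow> u = v"
  by (simp add: coord_inject[symmetric] fun_eq_iff)

lemma coord_summable: "(\<lambda>i. (cmod (coord u i))\<^sup>2) summable_on A"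
  using coord[of u] summable_on_subset_banach[of _ UNIV A] by blast

lemma sq_summable_add:
  fixes f g :: "'i \<Rightarrow> complex"
  assumes "(\<lambda>i. (cmod (f i))\<^sup>2) summable_on A" "(\<lambda>i. (cmod (g i))\<^sup>2) summable_on A"
  shows "(\<lambda>i. (cmod (f i + g i))\<^sup>2) summable_on A"
proof (rule summable_on_comparison_test)
  show "(\<lambda>i. 2 * (cmod (f i))\<^sup>2 + 2 * (cmod (g i))\<^sup>2) summable_on A"
    by (intro summable_on_add summable_on_cmult_right assms)
  show "(cmod (f i + g i))\<^sup>2 \<le> 2 * (cmod (f i))\<^sup>2 + 2 * (cmod (g i))\<^sup>2" for i
  proof -
    have "(cmod (f i + g i))\<^sup>2 \<le> (cmod (f i) + cmod (g i))\<^sup>2"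
      by (intro power_mono norm_triangle_ineq) auto
    also have "\<dots> \<le> 2 * (cmod (f i))\<^sup>2 + 2 * (cmod (g i))\<^sup>2"
      using sum_squares_bound[of "cmod (f i)" "cmod (g i)"] by (simp add: power2_sum)
    finally show ?thesis .
  qed
qed auto

lemma sq_summable_scale:
  fixes f :: "'i \<Rightarrow> complex"
  assumes "(\<lambda>i. (cmod (f i))\<^sup>2) summable_on A"
  shows "(\<lambda>i. (cmod (c * f i))\<^sup>2) summable_on A"
  using summable_on_cmult_right[OF assms, of "(cmod c)\<^sup>2"] by (simp add: norm_mult power_mult_distrib)

lift_definition scaleC :: "complex \<Rightarrow> 'i ell2 \<Rightarrow> 'i ell2" (infixr \<open>*\<^sub>C\<close> 75)
  is "\<lambda>c f i. c * f i"
  by (rule sq_summable_scale)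

(* Conjugate-linear in the first argument. *)
definition cinner :: "'i ell2 \<Rightarrow> 'i ell2 \<Rightarrow> complex"
  where "cinner u v = (\<Sum>\<^sub>\<infinity>i. cnj (coord u i) * coord v i)"

lemma cinner_summable: "(\<lambda>i. cnj (coord u i) * coord v i) summable_on A"
proof -
  have "(\<lambda>i. norm (cnj (coord u i) * coord v i)) summable_on A"
    by (rule abs_summable_product)
       (use coord_summable[of u A] coord_summable[of v A]
        in \<open>simp_all add: norm_mult power2_eq_square\<close>)
  thus ?thesis by (rule abs_summable_summable)
qed

instantiation ell2 :: (type) real_inner
begin

lift_definition zero_ell2 :: "'i ell2" is "\<lambda>_. 0" by simp
lift_definition plus_ell2 :: "'i ell2 \<Rightarrow> 'i ell2 \<Rightarrow> 'i ell2" is "\<lambda>f g i. f i + g i"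
  by (rule sq_summable_add)
lift_definition uminus_ell2 :: "'i ell2 \<Rightarrow> 'i ell2" is "\<lambda>f i. - f i" by simp
lift_definition minus_ell2 :: "'i ell2 \<Rightarrow> 'i ell2 \<Rightarrow> 'i ell2" is "\<lambda>f g i. f i - g i"
  using sq_summable_add[of _ UNIV "\<lambda>i. - _ i"] by fastforce
lift_definition scaleR_ell2 :: "real \<Rightarrow> 'i ell2 \<Rightarrow> 'i ell2" is "\<lambda>r f i. of_real r * f i"
  by (rule sq_summable_scale)

definition inner_ell2 :: "'i ell2 \<Rightarrow> 'i ell2 \<Rightarrow> real" where "inner_ell2 u v = Re (cinner u v)"
definition norm_ell2 :: "'i ell2 \<Rightarrow> real" where "norm_ell2 u = sqrt (inner u u)"
definition dist_ell2 :: "'i ell2 \<Rightarrow> 'i ell2 \<Rightarrow> real" where "dist_ell2 u v = norm (u - v)"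
definition sgn_ell2 :: "'i ell2 \<Rightarrow> 'i ell2" where "sgn_ell2 u = (inverse (norm u) *\<^sub>R u)"
definition uniformity_ell2 :: "('i ell2 \<times> 'i ell2) filter"
  where "uniformity_ell2 = (INF e\<in>{0 <..}. principal {(x, y). dist x y < e})"
definition open_ell2 :: "'i ell2 set \<Rightarrow> bool"
  where "open_ell2 S = (\<forall>x\<in>S. \<forall>\<^sub>F (x', y) in uniformity. x' = x \<longrightarrow> y \<in> S)"

instance
proof
  fix u v w :: "'i ell2" and r s :: real
  show "u + v + w = u + (v + w)" "u + v = v + u" "0 + u = u" "- u + u = 0" "u - v = u + - v"
    "r *\<^sub>R (u + v) = r *\<^sub>R u + r *\<^sub>R v" "(r + s) *\<^sub>R u = r *\<^sub>R u + s *\<^sub>R u"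
    "r *\<^sub>R s *\<^sub>R u = (r * s) *\<^sub>R u" "1 *\<^sub>R u = u"
    by (transfer; simp add: algebra_simps)+
  show "dist u v = norm (u - v)" "sgn u = inverse (norm u) *\<^sub>R u" "norm u = sqrt (inner u u)"
    by (simp_all add: dist_ell2_def sgn_ell2_def norm_ell2_def)
  show "uniformity = (INF e\<in>{0 <..}. principal {(x, y :: 'i ell2). dist x y < e})"
    by (rule uniformity_ell2_def)
  show "open S = (\<forall>x\<in>S. \<forall>\<^sub>F (x', y) in uniformity. x' = x \<longrightarrow> y \<in> S)" for S :: "'i ell2 set"
    by (rule open_ell2_def)
  have "cinner v u = cnj (cinner u v)"
    unfolding cinner_def by (subst infsum_cnj[symmetric]) (simp add: mult.commute)
  thus "inner u v = inner v u" by (simp add: inner_ell2_def)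
  have "cinner (u + v) w = cinner u w + cinner v w"
    unfolding cinner_def by (subst infsum_add[OF cinner_summable cinner_summable, symmetric])
      (simp add: plus_ell2.rep_eq algebra_simps)
  thus "inner (u + v) w = inner u w + inner v w" by (simp add: inner_ell2_def)
  have "cinner (r *\<^sub>R u) v = of_real r * cinner u v"
    unfolding cinner_def by (subst infsum_cmult_right[OF cinner_summable, symmetric])
      (simp add: scaleR_ell2.rep_eq algebra_simps)
  thus "inner (r *\<^sub>R u) v = r * inner u v" by (simp add: inner_ell2_def)
  have *: "inner u u = (\<Sum>\<^sub>\<infinity>i. (cmod (coord u i))\<^sup>2)"
  proof -
    have "cinner u u = (\<Sum>\<^sub>\<infinity>i. of_real ((cmod (coord u i))\<^sup>2))"
      unfolding cinner_def by (intro infsum_cong) (simp add: complex_norm_square mult.commute del: of_real_power)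
    also have "\<dots> = of_real (\<Sum>\<^sub>\<infinity>i. (cmod (coord u i))\<^sup>2)"
      by (rule infsumI, rule has_sum_of_real, rule has_sum_infsum, rule coord_summable)
    finally show ?thesis by (simp add: inner_ell2_def)
  qed
  show "0 \<le> inner u u" unfolding * by (rule infsum_nonneg) simp
  show "(inner u u = 0) = (u = 0)"
  proof
    assume "inner u u = 0"
    hence "(cmod (coord u i))\<^sup>2 = 0" for i
      unfolding * using nonneg_infsum_le_0D[of "\<lambda>i. (cmod (coord u i))\<^sup>2" UNIV i, OF _ coord_summable] by auto
    thus "u = 0" by (intro ell2_eqI) (simp add: zero_ell2.rep_eq)
  next
    assume "u = 0" thus "inner u u = 0" unfolding * by (simp add: zero_ell2.rep_eq)
  qed
qed

end

lemmas coord_simps [simp] =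
  zero_ell2.rep_eq plus_ell2.rep_eq uminus_ell2.rep_eq minus_ell2.rep_eq scaleR_ell2.rep_eq scaleC.rep_eq

lemma coord_sum [simp]: "coord (sum f F) i = (\<Sum>k\<in>F. coord (f k) i)"
  by (induction F rule: infinite_finite_induct) auto

lemma cinner_commute: "cinner v u = cnj (cinner u v)"
  unfolding cinner_def by (subst infsum_cnj[symmetric]) (simp add: mult.commute)

lemma cinner_add_left: "cinner (u + v) w = cinner u w + cinner v w"
  unfolding cinner_def by (subst infsum_add[OF cinner_summable cinner_summable, symmetric])
    (simp add: algebra_simps)

lemma cinner_add_right: "cinner w (u + v) = cinner w u + cinner w v"
  unfolding cinner_def by (subst infsum_add[OF cinner_summable cinner_summable, symmetric])
    (simp add: algebra_simps)

lemma cinner_scaleC_left: "cinner (c *\<^sub>C u) v = cnj c * cinner u v"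
  unfolding cinner_def by (subst infsum_cmult_right[OF cinner_summable, symmetric])
    (simp add: algebra_simps)

lemma cinner_scaleC_right: "cinner u (c *\<^sub>C v) = c * cinner u v"
  unfolding cinner_def by (subst infsum_cmult_right[OF cinner_summable, symmetric])
    (simp add: algebra_simps)

lemma scaleR_scaleC: "r *\<^sub>R u = of_real r *\<^sub>C (u :: 'i ell2)"
  by (rule ell2_eqI) simp

lemma norm_ell2_square: "(norm u)\<^sup>2 = (\<Sum>\<^sub>\<infinity>i. (cmod (coord u i))\<^sup>2)"
proof -
  have "cinner u u = (\<Sum>\<^sub>\<infinity>i. of_real ((cmod (coord u i))\<^sup>2))"
    unfolding cinner_def by (intro infsum_cong) (simp add: complex_norm_square mult.commute del: of_real_power)
  also have "\<dots> = of_real (\<Sum>\<^sub>\<infinity>i. (cmod (coord u i))\<^sup>2)"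
    by (rule infsumI, rule has_sum_of_real, rule has_sum_infsum, rule coord_summable)
  finally show ?thesis by (simp add: power2_norm_eq_inner inner_ell2_def)
qed

lemma cinner_self: "cinner u u = of_real ((norm u)\<^sup>2)"
proof -
  have "cinner u u = (\<Sum>\<^sub>\<infinity>i. of_real ((cmod (coord u i))\<^sup>2))"
    unfolding cinner_def by (intro infsum_cong) (simp add: complex_norm_square mult.commute del: of_real_power)
  also have "\<dots> = of_real (\<Sum>\<^sub>\<infinity>i. (cmod (coord u i))\<^sup>2)"
    by (rule infsumI, rule has_sum_of_real, rule has_sum_infsum, rule coord_summable)
  finally show ?thesis by (simp add: norm_ell2_square)
qed

lemma norm_scaleC [simp]: "norm (c *\<^sub>C u) = cmod c * norm u"
proof -
  have "(norm (c *\<^sub>C u))\<^sup>2 = (cmod c * norm u)\<^sup>2"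
    unfolding norm_ell2_square power_mult_distrib
    by (subst infsum_cmult_right[OF coord_summable, symmetric]) (simp add: norm_mult power_mult_distrib)
  thus ?thesis by (simp add: power2_eq_iff_nonneg)
qed

lemma cmod_cinner_le: "cmod (cinner u v) \<le> norm u * norm v"
proof (cases "cinner u v = 0")
  case False
  define c where "c = cnj (cinner u v) / cmod (cinner u v)"
  have c: "cmod c = 1" using False by (simp add: c_def norm_divide)
  have "c * cinner u v = cmod (cinner u v)"
    using False complex_norm_square[of "cinner u v"]
    by (simp add: c_def mult.commute power2_eq_square nonzero_divide_eq_eq)
  hence "cmod (cinner u v) = inner u (c *\<^sub>C v)"
    by (simp add: inner_ell2_def cinner_scaleC_right)
  also have "\<dots> \<le> norm u * norm (c *\<^sub>C v)" by (rule norm_cauchy_schwarz)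
  finally show ?thesis by (simp add: c)
qed auto

lemma ell2_memI:
  assumes "\<And>F. finite F \<Longrightarrow> (\<Sum>i\<in>F. (cmod (f i))\<^sup>2) \<le> B"
  shows "(\<lambda>i. (cmod (f i))\<^sup>2) summable_on UNIV"
  by (rule nonneg_bdd_above_summable_on) (auto intro!: bdd_aboveI[of _ B] assms)

lemma norm_ell2_le:
  assumes "\<And>F. finite F \<Longrightarrow> (\<Sum>i\<in>F. (cmod (coord u i))\<^sup>2) \<le> B\<^sup>2" and "0 \<le> B"
  shows "norm u \<le> B"
proof -
  have "(norm u)\<^sup>2 \<le> B\<^sup>2"
    unfolding norm_ell2_square by (rule infsum_le_finite_sums[OF coord_summable]) (use assms in auto)
  thus ?thesis using assms(2) by (rule power2_le_imp_le)
qed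

lemma sum_coord_le_norm: "finite F \<Longrightarrow> (\<Sum>i\<in>F. (cmod (coord u i))\<^sup>2) \<le> (norm u)\<^sup>2"
  unfolding norm_ell2_square by (rule finite_sum_le_infsum[OF coord_summable]) auto

lemma cmod_coord_le_norm: "cmod (coord u i) \<le> norm u"
  by (rule power2_le_imp_le) (use sum_coord_le_norm[of "{i}" u] in auto)

instance ell2 :: (type) banach
proof
  fix X :: "nat \<Rightarrow> 'a ell2"
  assume X: "Cauchy X"
  have "Cauchy (\<lambda>n. coord (X n) i)" for i
  proof (rule metric_CauchyI)
    fix e :: real assume "0 < e"
    then obtain M where M: "\<And>m n. m \<ge> M \<Longrightarrow> n \<ge> M \<Longrightarrow> dist (X m) (X n) < e"
      using metric_CauchyD[OF X] by blast
    have "dist (coord (X m) i) (coord (X n) i) < e" if "m \<ge> M" "n \<ge> M" for m n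
      using M[OF that] cmod_coord_le_norm[of "X m - X n" i] by (simp add: dist_norm)
    thus "\<exists>M. \<forall>m\<ge>M. \<forall>n\<ge>M. dist (coord (X m) i) (coord (X n) i) < e" by blast
  qed
  then obtain f where f: "\<And>i. (\<lambda>n. coord (X n) i) \<longlonglongrightarrow> f i"
    unfolding Cauchy_convergent_iff convergent_def by metis
  have bound: "(\<Sum>i\<in>F. (cmod (f i - coord (X n) i))\<^sup>2) \<le> e\<^sup>2"
    if F: "finite F" and M: "\<And>m n. m \<ge> M \<Longrightarrow> n \<ge> M \<Longrightarrow> dist (X m) (X n) < e" and n: "n \<ge> M" for F M n e
  proof (rule tendsto_upperbound)
    show "(\<lambda>m. \<Sum>i\<in>F. (cmod (coord (X m) i - coord (X n) i))\<^sup>2) \<longlonglongrightarrow> (\<Sum>i\<in>F. (cmod (f i - coord (X n) i))\<^sup>2)"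
      by (intro tendsto_intros f)
    show "\<forall>\<^sub>F m in sequentially. (\<Sum>i\<in>F. (cmod (coord (X m) i - coord (X n) i))\<^sup>2) \<le> e\<^sup>2"
      using eventually_ge_at_top[of M]
    proof eventually_elim
      case (elim m)
      have "(\<Sum>i\<in>F. (cmod (coord (X m) i - coord (X n) i))\<^sup>2) \<le> (norm (X m - X n))\<^sup>2"
        using sum_coord_le_norm[OF F, of "X m - X n"] by simp
      also have "\<dots> \<le> e\<^sup>2" using M[OF elim n] by (intro power_mono) (auto simp: dist_norm)
      finally show ?case .
    qed
  qed simp
  have mem: "(\<lambda>i. (cmod (f i))\<^sup>2) summable_on UNIV"
  proof -
    obtain M where M: "\<And>m n. m \<ge> M \<Longrightarrow> n \<ge> M \<Longrightarrow> dist (X m) (X n) < 1"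
      using metric_CauchyD[OF X, of 1] by auto
    have "(\<lambda>i. (cmod (f i - coord (X M) i))\<^sup>2) summable_on UNIV"
      using bound[OF _ M, of _ M] by (intro ell2_memI) auto
    from sq_summable_add[OF this coord_summable[of "X M"]] show ?thesis by simp
  qed
  define L where "L = Abs_ell2 f"
  have L: "coord L i = f i" for i using mem by (simp add: L_def Abs_ell2_inverse)
  have "X \<longlonglongrightarrow> L"
  proof (rule metric_LIMSEQ_I)
    fix e :: real assume "0 < e"
    then obtain M where M: "\<And>m n. m \<ge> M \<Longrightarrow> n \<ge> M \<Longrightarrow> dist (X m) (X n) < e / 2"
      using metric_CauchyD[OF X, of "e/2"] by auto
    have "norm (L - X n) \<le> e / 2" if "n \<ge> M" for n
      using bound[OF _ M that] \<open>0 < e\<close> by (intro norm_ell2_le) (auto simp: L)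
    thus "\<exists>no. \<forall>n\<ge>no. dist (X n) L < e"
      using \<open>0 < e\<close> by (intro exI[of _ M]) (fastforce simp: dist_norm norm_minus_commute)
  qed
  thus "convergent X" by (auto simp: convergent_def)
qed

section \<open>Bounded operators, adjoints and tensor products\<close>

type_synonym 'i op = "'i ell2 \<Rightarrow>\<^sub>L 'i ell2"

lift_definition ket :: "'i \<Rightarrow> 'i ell2" is "\<lambda>k i. if i = k then 1 else 0"
  by (rule finite_nonzero_values_imp_summable_on) (auto intro: finite_subset[of _ "{_}"])

lemma coord_ket: "coord (ket k) i = (if i = k then 1 else 0)"
  by (simp add: ket.rep_eq)

lemma ket_expansion: "((\<lambda>i. coord u i *\<^sub>C ket i) has_sum u) UNIV"
proof -
  have sq: "(norm (u - (\<Sum>i\<in>F. coord u i *\<^sub>C ket i)))\<^sup>2 = (norm u)\<^sup>2 - (\<Sum>i\<in>F. (cmod (coord u i))\<^sup>2)"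
    if F: "finite F" for F
  proof -
    have c: "coord (u - (\<Sum>i\<in>F. coord u i *\<^sub>C ket i)) j = (if j \<in> F then 0 else coord u j)" for j
      using F by (simp add: coord_ket if_distrib[of "\<lambda>x. _ * x"] sum.delta cong: if_cong)
    have "(\<Sum>\<^sub>\<infinity>j. (cmod (if j \<in> F then 0 else coord u j))\<^sup>2) = (\<Sum>\<^sub>\<infinity>j\<in>- F. (cmod (coord u j))\<^sup>2)"
      by (rule infsum_cong_neutral) auto
    moreover have "(norm u)\<^sup>2 = (\<Sum>\<^sub>\<infinity>j\<in>F \<union> - F. (cmod (coord u j))\<^sup>2)"
      by (simp add: norm_ell2_square)
    moreover have "\<dots> = (\<Sum>\<^sub>\<infinity>j\<in>F. (cmod (coord u j))\<^sup>2) + (\<Sum>\<^sub>\<infinity>j\<in>- F. (cmod (coord u j))\<^sup>2)"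
      by (rule infsum_Un_disjoint) (auto intro: coord_summable)
    moreover have "(norm (u - (\<Sum>i\<in>F. coord u i *\<^sub>C ket i)))\<^sup>2 =
        (\<Sum>\<^sub>\<infinity>j. (cmod (if j \<in> F then 0 else coord u j))\<^sup>2)"
      unfolding norm_ell2_square by (simp only: c)
    ultimately show ?thesis using F by simp
  qed
  have "((\<lambda>F. (norm u)\<^sup>2 - (\<Sum>i\<in>F. (cmod (coord u i))\<^sup>2)) \<longlongrightarrow> (norm u)\<^sup>2 - (norm u)\<^sup>2)
          (finite_subsets_at_top UNIV)"
    using has_sum_infsum[OF coord_summable[of u UNIV]]
    by (intro tendsto_intros) (simp add: has_sum_def norm_ell2_square)
  moreover have "\<forall>\<^sub>F F in finite_subsets_at_top UNIV. (norm u)\<^sup>2 - (\<Sum>i\<in>F. (cmod (coord u i))\<^sup>2) =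
      (norm (u - (\<Sum>i\<in>F. coord u i *\<^sub>C ket i)))\<^sup>2"
    by (rule eventually_finite_subsets_at_top_weakI) (rule sq[symmetric])
  ultimately have "((\<lambda>F. (norm (u - (\<Sum>i\<in>F. coord u i *\<^sub>C ket i)))\<^sup>2) \<longlongrightarrow> (norm u)\<^sup>2 - (norm u)\<^sup>2)
      (finite_subsets_at_top UNIV)"
    by (rule Lim_transform_eventually)
  hence "((\<lambda>F. sqrt ((norm (u - (\<Sum>i\<in>F. coord u i *\<^sub>C ket i)))\<^sup>2)) \<longlongrightarrow> sqrt ((norm u)\<^sup>2 - (norm u)\<^sup>2)) (finite_subsets_at_top UNIV)"
    by (rule tendsto_real_sqrt)
  hence "((\<lambda>F. u - (\<Sum>i\<in>F. coord u i *\<^sub>C ket i)) \<longlongrightarrow> 0) (finite_subsets_at_top UNIV)"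
    by (simp add: tendsto_norm_zero_iff)
  hence "((\<lambda>F. u - (u - (\<Sum>i\<in>F. coord u i *\<^sub>C ket i))) \<longlongrightarrow> u - 0) (finite_subsets_at_top UNIV)"
    by (intro tendsto_diff tendsto_const)
  thus ?thesis by (simp add: has_sum_def)
qed

lemma ell2_op_eqI:
  fixes S T :: "'i ell2 \<Rightarrow>\<^sub>L 'b::real_normed_vector"
  assumes "\<And>i c. blinfun_apply S (c *\<^sub>C ket i) = blinfun_apply T (c *\<^sub>C ket i)"
  shows "S = T"
proof (rule blinfun_eqI)
  fix u
  have "((\<lambda>i. S (coord u i *\<^sub>C ket i)) has_sum S u) UNIV"
       "((\<lambda>i. T (coord u i *\<^sub>C ket i)) has_sum T u) UNIV"
    by (rule has_sum_bounded_linear[OF blinfun.bounded_linear_right ket_expansion])+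
  thus "S u = T u" using assms by (simp add: has_sum_unique)
qed

lemma cinner_eqI: "(\<And>w. cinner u w = cinner v w) \<Longrightarrow> u = v"
proof -
  assume "\<And>w. cinner u w = cinner v w"
  moreover have "cinner w (ket i) = cnj (coord w i)" for w :: "'a ell2" and i
  proof -
    have "cinner w (ket i) = (\<Sum>\<^sub>\<infinity>j\<in>{i}. cnj (coord w j))"
      unfolding cinner_def by (rule infsum_cong_neutral) (auto simp: coord_ket)
    thus ?thesis by simp
  qed
  ultimately have "cnj (coord u i) = cnj (coord v i)" for i by metis
  thus "u = v" by (intro ell2_eqI) simp
qed

lemma cinner_ket_left: "cinner (ket i) w = coord w i"
proof -
  have "cinner (ket i) w = (\<Sum>\<^sub>\<infinity>j\<in>{i}. coord w j)"
    unfolding cinner_def by (rule infsum_cong_neutral) (auto simp: coord_ket)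
  thus ?thesis by simp
qed

(* blinfun is the type of bounded real-linear maps, so complex linearity is imposed separately;
   its norm and topology are the operator norm and the norm topology. *)
definition clinear_op :: "('i ell2 \<Rightarrow>\<^sub>L 'j ell2) \<Rightarrow> bool"
  where "clinear_op T \<longleftrightarrow> (\<forall>c u. T (c *\<^sub>C u) = c *\<^sub>C T u)"

definition scaleC_op :: "complex \<Rightarrow> 'i op \<Rightarrow> 'i op"
  where "scaleC_op c T = Blinfun (\<lambda>u. c *\<^sub>C T u)"

definition adj :: "'i op \<Rightarrow> 'i op"
  where "adj T = (THE S. \<forall>u v. cinner (blinfun_apply S u) v = cinner u (T v))"

lemma scaleC_add_right: "c *\<^sub>C (u + v) = c *\<^sub>C u + c *\<^sub>C (v :: 'i ell2)"
  by (rule ell2_eqI) (simp add: algebra_simps)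

lemma scaleC_scaleC: "c *\<^sub>C d *\<^sub>C u = (c * d) *\<^sub>C (u :: 'i ell2)"
  by (rule ell2_eqI) (simp add: algebra_simps)

lemma cinner_zero_left: "cinner 0 u = 0"
  by (simp add: cinner_def)

lemma bounded_linear_scaleC: "bounded_linear (\<lambda>u. c *\<^sub>C (u :: 'i ell2))"
  by (rule bounded_linear_intro[of _ "cmod c"])
     (auto simp: scaleC_add_right scaleR_scaleC scaleC_scaleC mult.commute)

lemma scaleC_op_apply [simp]: "scaleC_op c T u = c *\<^sub>C T u"
  unfolding scaleC_op_def
  by (subst bounded_linear_Blinfun_apply)
     (auto intro: bounded_linear_compose[OF bounded_linear_scaleC] blinfun.bounded_linear_right)

lemma bounded_linear_cinner_right: "bounded_linear (\<lambda>v. cinner u v)"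
  by (rule bounded_linear_intro[of _ "norm u"])
     (auto simp: cinner_add_right scaleR_scaleC cinner_scaleC_right scaleR_conv_of_real
                 intro: order_trans[OF cmod_cinner_le])

lemma adj_unique:
  fixes S T :: "'i op"
  assumes "\<And>u v. cinner (blinfun_apply S u) v = cinner u (T v)"
  shows "adj T = S"
  unfolding adj_def
proof (rule the_equality)
  fix S' assume "\<forall>u v. cinner (blinfun_apply S' u) v = cinner u (T v)"
  thus "S' = S" using assms by (intro blinfun_eqI cinner_eqI) auto
qed (use assms in auto)

lemma adj_exists:
  fixes T :: "'i op"
  assumes T: "clinear_op T"
  shows "\<exists>S. \<forall>u v. cinner (blinfun_apply S u) v = cinner u (T v)"
proof -
  define f where "f u i = cinner (T (ket i)) u" for u i
  have bound: "(\<Sum>i\<in>F. (cmod (f u i))\<^sup>2) \<le> (norm T * norm u)\<^sup>2" if F: "finite F" for F u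
  proof -
    define w where "w = (\<Sum>i\<in>F. f u i *\<^sub>C ket i)"
    define s where "s = (\<Sum>i\<in>F. (cmod (f u i))\<^sup>2)"
    have s: "s \<ge> 0" by (simp add: s_def sum_nonneg)
    have w: "coord w j = (if j \<in> F then f u j else 0)" for j
      using F by (simp add: w_def coord_ket if_distrib[of "\<lambda>x. _ * x"] sum.delta cong: if_cong)
    have nw: "(norm w)\<^sup>2 = s"
    proof -
      have "(norm w)\<^sup>2 = (\<Sum>\<^sub>\<infinity>j\<in>F. (cmod (f u j))\<^sup>2)"
        unfolding norm_ell2_square by (rule infsum_cong_neutral) (auto simp: w)
      thus ?thesis using F by (simp add: s_def)
    qed
    have csum: "cinner (sum g F) u = (\<Sum>i\<in>F. cinner (g i) u)" for g :: "'i \<Rightarrow> 'i ell2"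
      using F by (induction F) (simp_all add: cinner_add_left cinner_zero_left)
    have "cinner (T w) u = (\<Sum>i\<in>F. cnj (f u i) * f u i)"
      using T by (simp add: w_def blinfun.sum_right csum clinear_op_def cinner_scaleC_left f_def)
    also have "\<dots> = of_real s"
      unfolding s_def of_real_sum
      by (intro sum.cong refl) (simp only: complex_norm_square mult.commute)
    finally have "s = cmod (cinner (T w) u)" using s by simp
    also have "\<dots> \<le> norm (T w) * norm u" by (rule cmod_cinner_le)
    also have "\<dots> \<le> (norm T * norm w) * norm u"
      by (intro mult_right_mono norm_blinfun) auto
    finally have "norm w * norm w \<le> (norm T * norm u) * norm w"
      using nw by (simp add: power2_eq_square mult_ac)
    hence "norm w \<le> norm T * norm u"
      by (cases "norm w = 0") (auto simp: mult_le_cancel_right)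
    hence "(norm w)\<^sup>2 \<le> (norm T * norm u)\<^sup>2" by (intro power_mono) auto
    thus ?thesis using nw by (simp add: s_def)
  qed
  define S where "S u = Abs_ell2 (f u)" for u
  have cS: "coord (S u) i = f u i" for u i
    using ell2_memI[OF bound] by (simp add: S_def Abs_ell2_inverse)
  have lin: "bounded_linear S"
  proof (rule bounded_linear_intro[of _ "norm T"])
    show "norm (S u) \<le> norm u * norm T" for u
      by (rule norm_ell2_le) (use bound in \<open>auto simp: cS mult.commute\<close>)
  qed (auto intro!: ell2_eqI simp: cS f_def cinner_add_right scaleR_scaleC cinner_scaleC_right)
  have "cinner (S u) v = cinner u (T v)" for u v
  proof -
    have "((\<lambda>i. cinner u (T (coord v i *\<^sub>C ket i))) has_sum cinner u (T v)) UNIV"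
      by (rule has_sum_bounded_linear[OF _ ket_expansion])
         (rule bounded_linear_compose[OF bounded_linear_cinner_right blinfun.bounded_linear_right])
    moreover have "cinner u (T (coord v i *\<^sub>C ket i)) = cnj (coord (S u) i) * coord v i" for i
      using T by (simp add: clinear_op_def cinner_scaleC_right cS f_def cinner_commute[of u] mult.commute)
    ultimately show ?thesis by (simp add: cinner_def[of "S u"] infsumI)
  qed
  thus ?thesis by (intro exI[of _ "Blinfun S"]) (simp add: bounded_linear_Blinfun_apply[OF lin])
qed

lemma cinner_adj: "clinear_op T \<Longrightarrow> cinner (adj T u) v = cinner u (T v)"
  using adj_exists[of T] adj_unique[of _ T] by metis

lift_definition tensor_vec :: "'i ell2 \<Rightarrow> 'j ell2 \<Rightarrow> ('i \<times> 'j) ell2" (infixr \<open>\<otimes>\<^sub>v\<close> 70)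
  is "\<lambda>f g (i, j). f i * g j"
proof -
  fix f :: "'i \<Rightarrow> complex" and g :: "'j \<Rightarrow> complex"
  assume f: "(\<lambda>i. (cmod (f i))\<^sup>2) summable_on UNIV" and g: "(\<lambda>j. (cmod (g j))\<^sup>2) summable_on UNIV"
  have "(\<lambda>(i, j). (cmod (f i))\<^sup>2 * (cmod (g j))\<^sup>2) summable_on UNIV \<times> UNIV"
    by (rule summable_on_SigmaI[where g = "\<lambda>i. (cmod (f i))\<^sup>2 * (\<Sum>\<^sub>\<infinity>j. (cmod (g j))\<^sup>2)"])
       (auto intro!: has_sum_cmult_right has_sum_infsum g summable_on_cmult_left f)
  thus "(\<lambda>p. (cmod (case p of (i, j) \<Rightarrow> f i * g j))\<^sup>2) summable_on UNIV"
    by (simp add: case_prod_unfold norm_mult power_mult_distrib)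
qed

definition tensor_op :: "'i op \<Rightarrow> 'j op \<Rightarrow> ('i \<times> 'j) op" (infixr \<open>\<otimes>\<^sub>o\<close> 70)
  where "S \<otimes>\<^sub>o T = (THE R. \<forall>u v. blinfun_apply R (u \<otimes>\<^sub>v v) = S u \<otimes>\<^sub>v T v)"

(* The r-th component of a vector of the Hilbert space direct sum over r of copies of l2('i),
   identified with l2('r \<times> 'i). *)
lift_definition slice :: "'r \<Rightarrow> ('r \<times> 'i) ell2 \<Rightarrow> 'i ell2" is "\<lambda>r f i. f (r, i)"
proof -
  fix r :: 'r and f :: "'r \<times> 'i \<Rightarrow> complex"
  assume "(\<lambda>p. (cmod (f p))\<^sup>2) summable_on UNIV"
  hence "(\<lambda>p. (cmod (f p))\<^sup>2) summable_on Pair r ` UNIV"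
    by (rule summable_on_subset_banach) auto
  thus "(\<lambda>i. (cmod (f (r, i)))\<^sup>2) summable_on UNIV"
    by (subst (asm) summable_on_reindex) (auto simp: inj_on_def o_def)
qed

lemma slice_bounded_sum:
  assumes "finite R"
  shows "(\<Sum>r\<in>R. (norm (slice r u))\<^sup>2) \<le> (norm u)\<^sup>2"
proof -
  have eq: "(norm (slice r u))\<^sup>2 = (\<Sum>\<^sub>\<infinity>p\<in>Pair r ` UNIV. (cmod (coord u p))\<^sup>2)" for r
    by (subst infsum_reindex) (auto simp: inj_on_def o_def norm_ell2_square slice.rep_eq)
  have "(\<Sum>r\<in>R. (norm (slice r u))\<^sup>2) = (\<Sum>\<^sub>\<infinity>p\<in>(\<Union>r\<in>R. Pair r ` UNIV). (cmod (coord u p))\<^sup>2)"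
    unfolding eq by (rule sum_infsum[OF assms coord_summable]) auto
  also have "\<dots> \<le> (norm u)\<^sup>2"
    unfolding norm_ell2_square by (rule infsum_mono2) (auto intro: coord_summable)
  finally show ?thesis .
qed

lemma slice_eqI: "(\<And>r. slice r u = slice r v) \<Longrightarrow> u = v"
  by (rule ell2_eqI) (metis slice.rep_eq surj_pair)

lemma direct_sum_exists:
  fixes T :: "'r \<Rightarrow> 'i op"
  assumes B: "\<And>r. norm (T r) \<le> B"
  shows "\<exists>D. \<forall>u r. slice r (blinfun_apply D u) = T r (slice r u)"
proof -
  have B0: "0 \<le> B" using B[of undefined] norm_ge_zero order_trans by blast
  define f where "f u = (\<lambda>(r, i). coord (T r (slice r u)) i)" for u
  have bound: "(\<Sum>p\<in>F. (cmod (f u p))\<^sup>2) \<le> (B * norm u)\<^sup>2" if F: "finite F" for F u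
  proof -
    have "(\<Sum>p\<in>F. (cmod (f u p))\<^sup>2) \<le> (\<Sum>p\<in>fst ` F \<times> snd ` F. (cmod (f u p))\<^sup>2)"
      by (rule sum_mono2) (use F in \<open>auto simp: rev_image_eqI\<close>)
    also have "\<dots> = (\<Sum>r\<in>fst ` F. \<Sum>i\<in>snd ` F. (cmod (coord (T r (slice r u)) i))\<^sup>2)"
      by (simp add: sum.cartesian_product f_def case_prod_unfold)
    also have "\<dots> \<le> (\<Sum>r\<in>fst ` F. (norm (T r (slice r u)))\<^sup>2)"
      by (intro sum_mono sum_coord_le_norm) (use F in auto)
    also have "\<dots> \<le> (\<Sum>r\<in>fst ` F. B\<^sup>2 * (norm (slice r u))\<^sup>2)"
    proof (rule sum_mono)
      fix r
      have "norm (T r (slice r u)) \<le> B * norm (slice r u)"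
        by (rule order_trans[OF norm_blinfun]) (intro mult_right_mono B norm_ge_zero)
      thus "(norm (T r (slice r u)))\<^sup>2 \<le> B\<^sup>2 * (norm (slice r u))\<^sup>2"
        using power_mono[of _ "B * norm (slice r u)" 2] by (simp add: power_mult_distrib)
    qed
    also have "\<dots> \<le> B\<^sup>2 * (norm u)\<^sup>2"
      unfolding sum_distrib_left[symmetric] using F by (intro mult_left_mono slice_bounded_sum) auto
    finally show ?thesis by (simp add: power_mult_distrib)
  qed
  define D where "D u = Abs_ell2 (f u)" for u
  have cD: "coord (D u) p = f u p" for u p
    using ell2_memI[OF bound] by (simp add: D_def Abs_ell2_inverse)
  have sD: "slice r (D u) = T r (slice r u)" for r u
    by (rule ell2_eqI) (simp add: slice.rep_eq cD f_def)
  have sl: "slice r (u + v) = slice r u + slice r v" "slice r (c *\<^sub>R u) = c *\<^sub>R slice r u"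
    for r c and u v :: "('r \<times> 'i) ell2"
    by (auto intro!: ell2_eqI simp: slice.rep_eq)
  have lin: "bounded_linear D"
  proof (rule bounded_linear_intro[of _ B])
    show "norm (D u) \<le> norm u * B" for u
      by (rule norm_ell2_le) (use bound B0 in \<open>auto simp: cD mult.commute\<close>)
  qed (auto intro!: slice_eqI simp: sD sl blinfun.add_right blinfun.scaleR_right)
  thus ?thesis by (intro exI[of _ "Blinfun D"]) (simp add: bounded_linear_Blinfun_apply sD)
qed

lift_definition flip :: "('i \<times> 'j) ell2 \<Rightarrow> ('j \<times> 'i) ell2" is "\<lambda>f (j, i). f (i, j)"
proof -
  fix f :: "'i \<times> 'j \<Rightarrow> complex"
  assume "(\<lambda>p. (cmod (f p))\<^sup>2) summable_on UNIV"
  hence "(\<lambda>p. (cmod (f (prod.swap p)))\<^sup>2) summable_on UNIV"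
    by (subst summable_on_reindex_bij_betw[OF bij_swap]) 
  thus "(\<lambda>p. (cmod (case p of (j, i) \<Rightarrow> f (i, j)))\<^sup>2) summable_on UNIV"
    by (simp add: case_prod_unfold prod.swap_def)
qed

lemma norm_flip [simp]: "norm (flip u) = norm u"
proof -
  have "(norm (flip u))\<^sup>2 = (norm u)\<^sup>2"
    unfolding norm_ell2_square flip.rep_eq
    by (subst infsum_reindex_bij_betw[OF bij_swap, symmetric]) (simp add: case_prod_unfold)
  thus ?thesis by simp
qed

lemma bounded_linear_flip: "bounded_linear flip"
  by (rule bounded_linear_intro[of _ 1]) (auto intro!: ell2_eqI simp: flip.rep_eq split: prod.split)

lemma tensor_op_exists:
  fixes S :: "'i op" and T :: "'j op"
  assumes S: "clinear_op S" and T: "clinear_op T"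
  shows "\<exists>R. \<forall>u v. blinfun_apply R (u \<otimes>\<^sub>v v) = S u \<otimes>\<^sub>v T v"
proof -
  obtain D1 :: "('i \<times> 'j) op" where D1: "\<And>u r. slice r (D1 u) = T (slice r u)"
    using direct_sum_exists[of "\<lambda>_. T" "norm T"] by auto
  obtain D2 :: "('j \<times> 'i) op" where D2: "\<And>u r. slice r (D2 u) = S (slice r u)"
    using direct_sum_exists[of "\<lambda>_. S" "norm S"] by auto
  have sl: "slice i (u \<otimes>\<^sub>v v) = coord u i *\<^sub>C v" for i and u :: "'a ell2" and v :: "'b ell2"
    by (rule ell2_eqI) (simp add: slice.rep_eq tensor_vec.rep_eq)
  have fl: "flip (u \<otimes>\<^sub>v v) = v \<otimes>\<^sub>v u" for u :: "'a ell2" and v :: "'b ell2"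
    by (rule ell2_eqI) (simp add: flip.rep_eq tensor_vec.rep_eq split: prod.split)
  have 1: "D1 (u \<otimes>\<^sub>v v) = u \<otimes>\<^sub>v T v" for u v
    using T by (intro slice_eqI) (simp add: D1 sl clinear_op_def)
  have 2: "D2 (v \<otimes>\<^sub>v u) = v \<otimes>\<^sub>v S u" for u v
    using S by (intro slice_eqI) (simp add: D2 sl clinear_op_def)
  have lin: "bounded_linear (\<lambda>u. flip (D2 (flip (D1 u))))"
    by (intro bounded_linear_compose[OF bounded_linear_flip] blinfun.bounded_linear_right
              bounded_linear_compose[OF blinfun.bounded_linear_right])
  show ?thesis
    by (rule exI[of _ "Blinfun (\<lambda>u. flip (D2 (flip (D1 u))))"])
       (simp add: bounded_linear_Blinfun_apply[OF lin] 1 2 fl)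
qed

lemma tensor_op_unique:
  fixes S :: "'i op" and T :: "'j op"
  assumes "\<And>u v. blinfun_apply R (u \<otimes>\<^sub>v v) = S u \<otimes>\<^sub>v T v"
  shows "S \<otimes>\<^sub>o T = R"
  unfolding tensor_op_def
proof (rule the_equality)
  fix R' assume R': "\<forall>u v. blinfun_apply R' (u \<otimes>\<^sub>v v) = S u \<otimes>\<^sub>v T v"
  show "R' = R"
  proof (rule ell2_op_eqI)
    fix p :: "'i \<times> 'j" and c
    obtain i j where p: "p = (i, j)" by fastforce
    have "c *\<^sub>C ket p = (c *\<^sub>C ket i) \<otimes>\<^sub>v ket j"
      by (rule ell2_eqI) (auto simp: p tensor_vec.rep_eq coord_ket split: prod.split)
    thus "R' (c *\<^sub>C ket p) = R (c *\<^sub>C ket p)" using R' assms by simp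
  qed
qed (use assms in auto)

lemma tensor_op_apply:
  "clinear_op S \<Longrightarrow> clinear_op T \<Longrightarrow> (S \<otimes>\<^sub>o T) (u \<otimes>\<^sub>v v) = S u \<otimes>\<^sub>v T v"
  using tensor_op_exists[of S T] tensor_op_unique[of _ S T] by metis

section \<open>Concrete C*-algebras and the universal algebra of PVMs\<close>

(* For an index set J, l2(J) is the subspace of vectors supported in J, and B(l2(J)) is the corner
   of operators that map into l2(J) and vanish on its orthogonal complement. Its unit is the
   projection id_on J, not the identity blinfun. Finite-dimensional Hilbert spaces are the l2(J)
   with J finite; J = {} gives the zero space. *)
definition ell2_on :: "'i set \<Rightarrow> 'i ell2 set"
  where "ell2_on J = {u. \<forall>i. i \<notin> J \<longrightarrow> coord u i = 0}"

lift_definition restrict_ell2 :: "'i set \<Rightarrow> 'i ell2 \<Rightarrow> 'i ell2" is "\<lambda>J f i. if i \<in> J then f i else 0"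
  by (rule summable_on_comparison_test) auto

definition id_on :: "'i set \<Rightarrow> 'i op"
  where "id_on J = Blinfun (restrict_ell2 J)"

lemma id_on_apply [simp]: "id_on J u = restrict_ell2 J u"
proof -
  have "bounded_linear (restrict_ell2 J)"
  proof (rule bounded_linear_intro[of _ 1])
    show "norm (restrict_ell2 J u) \<le> norm u * 1" for u :: "'a ell2"
    proof (rule norm_ell2_le)
      fix F :: "'a set" assume F: "finite F"
      have "(\<Sum>i\<in>F. (cmod (coord (restrict_ell2 J u) i))\<^sup>2) \<le> (\<Sum>i\<in>F. (cmod (coord u i))\<^sup>2)"
        by (rule sum_mono) (simp add: restrict_ell2.rep_eq)
      also have "\<dots> \<le> (norm u)\<^sup>2" by (rule sum_coord_le_norm[OF F])
      finally show "(\<Sum>i\<in>F. (cmod (coord (restrict_ell2 J u) i))\<^sup>2) \<le> (norm u * 1)\<^sup>2" by simp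
    qed simp
  qed (auto intro!: ell2_eqI simp: restrict_ell2.rep_eq)
  thus ?thesis by (simp add: id_on_def bounded_linear_Blinfun_apply)
qed

definition bounded_ops :: "'i set \<Rightarrow> 'i op set"
  where "bounded_ops J = {T. clinear_op T \<and> (\<forall>u. T u \<in> ell2_on J) \<and> (\<forall>u. T (restrict_ell2 J u) = T u)}"

(* Concrete unital C*-algebras on l2(J): norm-closed complex *-subalgebras of B(l2(J)) containing
   the unit of B(l2(J)). *)
definition cstar_subalgebra :: "'i set \<Rightarrow> 'i op set \<Rightarrow> bool"
  where "cstar_subalgebra J M \<longleftrightarrow>
    M \<subseteq> bounded_ops J \<and> id_on J \<in> M \<and>
    (\<forall>S\<in>M. \<forall>T\<in>M. S + T \<in> M \<and> S o\<^sub>L T \<in> M) \<and>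
    (\<forall>T\<in>M. adj T \<in> M \<and> (\<forall>c. scaleC_op c T \<in> M)) \<and>
    closed M"

definition projections :: "'i set \<Rightarrow> 'i op set"
  where "projections J = {T \<in> bounded_ops J. T o\<^sub>L T = T \<and> adj T = T}"

definition pvm_family :: "'i set \<Rightarrow> 'x set \<Rightarrow> 'a set \<Rightarrow> ('x \<Rightarrow> 'a \<Rightarrow> 'i op) \<Rightarrow> bool"
  where "pvm_family J X A P \<longleftrightarrow>
    (\<forall>x\<in>X. (\<forall>a\<in>A. P x a \<in> projections J) \<and> (\<Sum>a\<in>A. P x a) = id_on J)"

(* The universal C*-algebra generated by projections e x a (x in X, a in A) with
   (SUM a:A. e x a) = 1 for all x in X, realised in its universal representation. A representation
   of the relations is a family P of PVMs on a Hilbert space. A unital C*-algebra generated by such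
   a (finite) family is separable, hence acts faithfully on some l2(J) with J a set of natural
   numbers, so univ_reps contains enough representations (finite-dimensional ones included).
   univ_gen X A x a is the direct sum of P x a over all (J, P) in univ_reps, an operator on the
   direct sum l2(univ_index) of the l2(J), and univ_alg is the C*-algebra generated by these
   direct sums: this is the completion of the free *-algebra on the generators in the supremum of
   the seminorms of all representations. See univ_alg_universal below. *)
type_synonym ('x, 'a) rep = "nat set \<times> ('x \<Rightarrow> 'a \<Rightarrow> nat op)"

definition univ_reps :: "'x set \<Rightarrow> 'a set \<Rightarrow> ('x, 'a) rep set"
  where "univ_reps X A = {(J, P). pvm_family J X A P}"

definition univ_index :: "'x set \<Rightarrow> 'a set \<Rightarrow> (('x, 'a) rep \<times> nat) set"
  where "univ_index X A = (SIGMA r:univ_reps X A. fst r)"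

definition univ_gen :: "'x set \<Rightarrow> 'a set \<Rightarrow> 'x \<Rightarrow> 'a \<Rightarrow> (('x, 'a) rep \<times> nat) op"
  where "univ_gen X A x a = (THE D. \<forall>u r. slice r (blinfun_apply D u) =
           (if r \<in> univ_reps X A then snd r x a (slice r u) else 0))"

definition univ_alg :: "'x set \<Rightarrow> 'a set \<Rightarrow> (('x, 'a) rep \<times> nat) op set"
  where "univ_alg X A = cstar_subalgebra (univ_index X A) hull {univ_gen X A x a | x a. x \<in> X \<and> a \<in> A}"

(* The minimal (spatial) tensor product: the norm closure of the algebraic tensor product in the
   operators on the tensor product of the two Hilbert spaces. The real span suffices, since M is
   closed under complex scalars. *)
definition spatial_tensor :: "'i op set \<Rightarrow> 'j op set \<Rightarrow> ('i \<times> 'j) op set"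
  where "spatial_tensor M N = closure (span {S \<otimes>\<^sub>o T | S T. S \<in> M \<and> T \<in> N})"

definition state_on :: "'i set \<Rightarrow> 'i op set \<Rightarrow> ('i op \<Rightarrow> complex) \<Rightarrow> bool"
  where "state_on J M \<tau> \<longleftrightarrow>
    (\<forall>S\<in>M. \<forall>T\<in>M. \<tau> (S + T) = \<tau> S + \<tau> T) \<and>
    (\<forall>c. \<forall>T\<in>M. \<tau> (scaleC_op c T) = c * \<tau> T) \<and>
    (\<forall>T\<in>M. \<tau> (adj T o\<^sub>L T) \<in> \<real>\<^sub>\<ge>\<^sub>0) \<and>
    \<tau> (id_on J) = 1"

definition tracial_on :: "'i op set \<Rightarrow> ('i op \<Rightarrow> complex) \<Rightarrow> bool"
  where "tracial_on M \<tau> \<longleftrightarrow> (\<forall>S\<in>M. \<forall>T\<in>M. \<tau> (S o\<^sub>L T) = \<tau> (T o\<^sub>L S))"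

lemma adj_clinear:
  assumes "clinear_op T" shows "clinear_op (adj T)"
  unfolding clinear_op_def
  by (auto intro!: cinner_eqI simp: cinner_adj[OF assms] cinner_scaleC_left)

lemma cinner_restrict: "cinner (restrict_ell2 J u) v = cinner u (restrict_ell2 J v)"
  unfolding cinner_def by (rule infsum_cong) (simp add: restrict_ell2.rep_eq)

lemma adj_add: "clinear_op S \<Longrightarrow> clinear_op T \<Longrightarrow> adj (S + T) = adj S + adj T"
  by (rule adj_unique) (simp add: blinfun.add_left cinner_add_left cinner_add_right cinner_adj)

lemma clinear_id_on [simp]: "clinear_op (id_on J)"
  by (auto simp: clinear_op_def restrict_ell2.rep_eq intro!: ell2_eqI)

lemma restrict_ell2_eq_iff: "restrict_ell2 J u = u \<longleftrightarrow> u \<in> ell2_on J"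
  by (auto simp: ell2_on_def restrict_ell2.rep_eq coord_inject[symmetric] fun_eq_iff)

lemma ell2_on_restrict [simp]: "restrict_ell2 J u \<in> ell2_on J"
  by (simp add: ell2_on_def restrict_ell2.rep_eq)

lemma restrict_restrict [simp]: "restrict_ell2 J (restrict_ell2 J u) = restrict_ell2 J u"
  by (simp add: restrict_ell2_eq_iff)

lemma continuous_on_coord: "continuous_on UNIV (\<lambda>u. coord u i)"
proof -
  have "bounded_linear (\<lambda>u. coord u i)"
    by (rule bounded_linear_intro[of _ 1]) (auto simp: scaleR_conv_of_real cmod_coord_le_norm)
  thus ?thesis by (rule linear_continuous_on)
qed

lemma closed_bounded_ops: "closed (bounded_ops J)"
proof -
  have "bounded_ops J = (\<Inter>c u. {T. blinfun_apply T (c *\<^sub>C u) = c *\<^sub>C T u}) \<inter> (\<Inter>u. {T. restrict_ell2 J (blinfun_apply T u) = T u})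
      \<inter> (\<Inter>u. {T. blinfun_apply T (restrict_ell2 J u) = T u})"
    by (auto simp: bounded_ops_def clinear_op_def restrict_ell2_eq_iff)
  moreover have "closed {T. blinfun_apply T (c *\<^sub>C u) = c *\<^sub>C T u}" for c and u :: "'a ell2"
    by (intro closed_Collect_eq continuous_intros
              bounded_linear.continuous_on[OF bounded_linear_scaleC])
  moreover have "closed {T. restrict_ell2 J (blinfun_apply T u) = T u}" for u :: "'a ell2"
    unfolding id_on_apply[symmetric] by (intro closed_Collect_eq continuous_intros)
  moreover have "closed {T. blinfun_apply T (restrict_ell2 J u) = T u}" for u :: "'a ell2"
    by (intro closed_Collect_eq continuous_intros)
  ultimately show ?thesis by (auto intro!: closed_Int closed_INT)
qed

lemma ell2_on_zero [simp]: "0 \<in> ell2_on J"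
  and ell2_on_add: "u \<in> ell2_on J \<Longrightarrow> v \<in> ell2_on J \<Longrightarrow> u + v \<in> ell2_on J"
  and ell2_on_scaleC: "u \<in> ell2_on J \<Longrightarrow> c *\<^sub>C u \<in> ell2_on J"
  by (auto simp: ell2_on_def)

lemma adj_bounded_ops:
  assumes "T \<in> bounded_ops J" shows "adj T \<in> bounded_ops J"
proof -
  have T: "clinear_op T" "\<And>u. restrict_ell2 J (T u) = T u" "\<And>u. T (restrict_ell2 J u) = T u"
    using assms by (auto simp: bounded_ops_def restrict_ell2_eq_iff)
  have "restrict_ell2 J (adj T u) = adj T u" "adj T (restrict_ell2 J u) = adj T u" for u
    by (rule cinner_eqI; simp add: cinner_restrict cinner_adj T)+
  thus ?thesis using adj_clinear[OF T(1)] by (simp add: bounded_ops_def restrict_ell2_eq_iff)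
qed

lemma cstar_subalgebra_bounded_ops: "cstar_subalgebra J (bounded_ops J)"
  unfolding cstar_subalgebra_def
proof (intro conjI ballI allI)
  show "id_on J \<in> bounded_ops J" by (simp add: bounded_ops_def)
  fix S T assume S: "S \<in> bounded_ops J" and T: "T \<in> bounded_ops J"
  show "S + T \<in> bounded_ops J"
    using S T by (simp add: bounded_ops_def clinear_op_def blinfun.add_left scaleC_add_right ell2_on_add)
  show "S o\<^sub>L T \<in> bounded_ops J"
    using S T by (simp add: bounded_ops_def clinear_op_def)
next
  fix T c assume T: "T \<in> bounded_ops J"
  show "adj T \<in> bounded_ops J" by (rule adj_bounded_ops[OF T])
  show "scaleC_op c T \<in> bounded_ops J"
    using T by (simp add: bounded_ops_def clinear_op_def scaleC_scaleC ell2_on_scaleC mult.commute)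
qed (auto simp: closed_bounded_ops)

lemma cstar_subalgebra_hull:
  assumes "G \<subseteq> bounded_ops J"
  shows "cstar_subalgebra J (cstar_subalgebra J hull G)"
proof -
  define \<F> where "\<F> = {M. cstar_subalgebra J M \<and> G \<subseteq> M}"
  have ne: "bounded_ops J \<in> \<F>" using assms cstar_subalgebra_bounded_ops by (auto simp: \<F>_def)
  have "cstar_subalgebra J (\<Inter>\<F>)"
    unfolding cstar_subalgebra_def
  proof (intro conjI)
    show "closed (\<Inter>\<F>)" by (rule closed_Inter) (auto simp: \<F>_def cstar_subalgebra_def)
    show "\<Inter>\<F> \<subseteq> bounded_ops J" using ne by blast
  qed (auto simp: \<F>_def cstar_subalgebra_def)
  thus ?thesis by (simp add: hull_def \<F>_def)
qed

lemma norm_projection_le: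
  assumes "T \<in> projections J" shows "norm T \<le> 1"
proof (rule norm_blinfun_bound)
  fix u
  have T: "clinear_op T" "T o\<^sub>L T = T" "adj T = T" using assms by (auto simp: projections_def bounded_ops_def)
  have "of_real ((norm (T u))\<^sup>2) = cinner (T u) (T u)" by (rule cinner_self[symmetric])
  also have "\<dots> = cinner u ((T o\<^sub>L T) u)" using cinner_adj[OF T(1), of u "T u"] T(3) by simp
  also have "\<dots> = cinner u (T u)" by (simp only: T(2))
  finally have "(norm (T u))\<^sup>2 = cmod (cinner u (T u))" by (metis norm_of_real abs_of_nonneg zero_le_power2)
  also have "\<dots> \<le> norm u * norm (T u)" by (rule cmod_cinner_le)
  finally show "norm (T u) \<le> 1 * norm u"
    by (cases "norm (T u) = 0") (auto simp: power2_eq_square)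
qed simp

lemma slice_univ_gen:
  assumes "x \<in> X" "a \<in> A"
  shows "slice r (univ_gen X A x a u) = (if r \<in> univ_reps X A then snd r x a (slice r u) else 0)"
proof -
  define T where "T r = (if r \<in> univ_reps X A then snd r x a else 0)" for r
  have "norm (T r) \<le> 1" for r
    using assms norm_projection_le[of "snd r x a" "fst r"]
    by (auto simp: T_def univ_reps_def pvm_family_def)
  then obtain D where D: "\<And>u r. slice r (blinfun_apply D u) = T r (slice r u)"
    using direct_sum_exists[of T 1] by auto
  have "univ_gen X A x a = D" unfolding univ_gen_def
  proof (rule the_equality)
    fix D' assume D': "\<forall>u r. slice r (blinfun_apply D' u) = (if r \<in> univ_reps X A then snd r x a (slice r u) else 0)"
    show "D' = D" by (intro blinfun_eqI slice_eqI) (simp add: D D' T_def)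
  qed (simp add: D T_def)
  thus ?thesis by (simp add: D T_def)
qed

lemma coord_via_slice: "coord u (r, i) = coord (slice r u) i"
  by (simp add: slice.rep_eq)

lemma slice_scaleC: "slice r (c *\<^sub>C u) = c *\<^sub>C slice r u"
  and slice_add: "slice r (u + v) = slice r u + slice r v"
  and slice_zero: "slice r 0 = 0"
  by (auto intro!: ell2_eqI simp: slice.rep_eq)

lemma univ_gen_bounded_ops:
  assumes "x \<in> X" "a \<in> A"
  shows "univ_gen X A x a \<in> bounded_ops (univ_index X A)"
proof -
  have P: "snd r x a \<in> bounded_ops (fst r)" if "r \<in> univ_reps X A" for r
    using that assms by (auto simp: univ_reps_def pvm_family_def projections_def)
  have "clinear_op (univ_gen X A x a)"
    unfolding clinear_op_def
    using P by (auto intro!: slice_eqI simp: slice_univ_gen[OF assms] slice_scaleC bounded_ops_def clinear_op_def ell2_eqI)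
  moreover have "univ_gen X A x a u \<in> ell2_on (univ_index X A)" for u
    using P by (auto simp: ell2_on_def coord_via_slice slice_univ_gen[OF assms] bounded_ops_def univ_index_def)
  moreover have "univ_gen X A x a (restrict_ell2 (univ_index X A) u) = univ_gen X A x a u" for u
  proof (rule slice_eqI)
    fix r
    have "slice r (restrict_ell2 (univ_index X A) u) = restrict_ell2 (fst r) (slice r u)" if "r \<in> univ_reps X A"
      using that by (intro ell2_eqI) (simp add: slice.rep_eq restrict_ell2.rep_eq univ_index_def)
    thus "slice r (univ_gen X A x a (restrict_ell2 (univ_index X A) u)) = slice r (univ_gen X A x a u)"
      using P[of r] by (simp add: slice_univ_gen[OF assms] bounded_ops_def)
  qed
  ultimately show ?thesis by (simp add: bounded_ops_def)
qed

lemma cstar_subalgebra_univ_alg: "cstar_subalgebra (univ_index X A) (univ_alg X A)"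
  unfolding univ_alg_def by (rule cstar_subalgebra_hull) (auto intro: univ_gen_bounded_ops)

definition unital_star_hom :: "'i set \<Rightarrow> 'i op set \<Rightarrow> 'j set \<Rightarrow> ('i op \<Rightarrow> 'j op) \<Rightarrow> bool"
  where "unital_star_hom I M J \<phi> \<longleftrightarrow>
    (\<forall>T\<in>M. \<phi> T \<in> bounded_ops J \<and> \<phi> (adj T) = adj (\<phi> T) \<and> (\<forall>c. \<phi> (scaleC_op c T) = scaleC_op c (\<phi> T))) \<and>
    (\<forall>S\<in>M. \<forall>T\<in>M. \<phi> (S + T) = \<phi> S + \<phi> T \<and> \<phi> (S o\<^sub>L T) = \<phi> S o\<^sub>L \<phi> T) \<and>
    \<phi> (id_on I) = id_on J"

lemma slice_tensor: "slice r (u \<otimes>\<^sub>v v) = coord u r *\<^sub>C v"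
  by (rule ell2_eqI) (simp add: slice.rep_eq tensor_vec.rep_eq)

lemma cinner_ket_tensor: "cinner (ket r \<otimes>\<^sub>v v) w = cinner v (slice r w)"
proof -
  have "cinner (ket r \<otimes>\<^sub>v v) w = (\<Sum>\<^sub>\<infinity>p\<in>Pair r ` UNIV. cnj (coord v (snd p)) * coord w p)"
    unfolding cinner_def
    by (rule infsum_cong_neutral) (auto simp: tensor_vec.rep_eq coord_ket split: prod.splits)
  also have "\<dots> = (\<Sum>\<^sub>\<infinity>i. cnj (coord v i) * coord w (r, i))"
    by (subst infsum_reindex) (auto simp: inj_on_def o_def)
  finally show ?thesis by (simp add: cinner_def slice.rep_eq)
qed

lemma bounded_linear_ket_tensor: "bounded_linear (\<lambda>v. ket r \<otimes>\<^sub>v v)"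
proof (rule bounded_linear_intro[of _ 1])
  fix v :: "'a ell2"
  have "cinner (ket r \<otimes>\<^sub>v v) (ket r \<otimes>\<^sub>v v) = cinner v v"
    by (simp add: cinner_ket_tensor slice_tensor coord_ket cinner_scaleC_right)
  hence "(norm (ket r \<otimes>\<^sub>v v))\<^sup>2 = (norm v)\<^sup>2" unfolding cinner_self of_real_eq_iff .
  thus "norm (ket r \<otimes>\<^sub>v v) \<le> norm v * 1" by simp
qed (auto intro!: ell2_eqI simp: tensor_vec.rep_eq algebra_simps split: prod.split)

lemma bounded_linear_slice: "bounded_linear (slice r)"
proof (rule bounded_linear_intro[of _ 1])
  show "norm (slice r u) \<le> norm u * 1" for u
    using slice_bounded_sum[of "{r}" u] by simp
qed (auto intro!: ell2_eqI simp: slice.rep_eq)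

theorem univ_alg_universal:
  fixes J :: "nat set" and P :: "'x \<Rightarrow> 'a \<Rightarrow> nat op"
  assumes P: "pvm_family J X A P"
  shows "\<exists>\<phi>. unital_star_hom (univ_index X A) (univ_alg X A) J \<phi> \<and>
             (\<forall>x\<in>X. \<forall>a\<in>A. \<phi> (univ_gen X A x a) = P x a)"
proof -
  define r where "r = (J, P)"
  have r: "r \<in> univ_reps X A" "fst r = J" "snd r = P" using P by (auto simp: r_def univ_reps_def)
  define I where "I = univ_index X A"
  define Q where "Q = restrict_ell2 ({r} \<times> (UNIV :: nat set))"
  define \<phi> :: "(('x, 'a) rep \<times> nat) op \<Rightarrow> nat op"
    where "\<phi> T = Blinfun (\<lambda>v. slice r (T (ket r \<otimes>\<^sub>v v)))" for T
  have \<phi>: "\<phi> T v = slice r (blinfun_apply T (ket r \<otimes>\<^sub>v v))" for T v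
    unfolding \<phi>_def
    by (subst bounded_linear_Blinfun_apply)
       (rule bounded_linear_compose[OF bounded_linear_slice]
             bounded_linear_compose[OF blinfun.bounded_linear_right bounded_linear_ket_tensor] refl)+
  have Q: "ket r \<otimes>\<^sub>v slice r u = Q u" for u :: "(('x, 'a) rep \<times> nat) ell2"
    by (rule ell2_eqI) (auto simp: Q_def restrict_ell2.rep_eq tensor_vec.rep_eq coord_ket slice.rep_eq split: prod.split)
  have sQ: "slice s (Q u) = (if s = r then slice r u else 0)" for s u
    by (rule ell2_eqI) (auto simp: Q_def restrict_ell2.rep_eq slice.rep_eq)
  define M where "M = {T \<in> bounded_ops I. \<forall>u. T (Q u) = Q (T u)}"
  note BO = cstar_subalgebra_bounded_ops[of I, unfolded cstar_subalgebra_def]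
  have "cstar_subalgebra I M"
    unfolding cstar_subalgebra_def
  proof (intro conjI ballI allI)
    have "M = bounded_ops I \<inter> (\<Inter>u. {T. blinfun_apply T (Q u) = Q (T u)})" by (auto simp: M_def)
    moreover have "closed {T. blinfun_apply T (Q u) = Q (T u)}" for u
      unfolding Q_def id_on_apply[symmetric] by (intro closed_Collect_eq continuous_intros)
    ultimately show "closed M" using closed_bounded_ops by (auto intro!: closed_INT closed_Int)
    show "id_on I \<in> M" using BO
      by (auto simp: M_def Q_def restrict_ell2.rep_eq intro!: ell2_eqI)
    fix S T assume S: "S \<in> M" and T: "T \<in> M"
    have "Q (u + v) = Q u + Q v" for u v
      unfolding Q_def id_on_apply[symmetric] by (rule blinfun.add_right)
    thus "S + T \<in> M" using BO S T by (simp add: M_def blinfun.add_left)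
    show "S o\<^sub>L T \<in> M" using BO S T by (simp add: M_def)
  next
    fix T c assume T: "T \<in> M"
    have Tc: "clinear_op T" using T by (simp add: M_def bounded_ops_def)
    have "adj T (Q u) = Q (adj T u)" for u
      by (rule cinner_eqI)
         (use T in \<open>simp add: cinner_adj[OF Tc] Q_def cinner_restrict M_def\<close>)
    thus "adj T \<in> M" using BO T by (simp add: M_def)
    have "Q (c *\<^sub>C u) = c *\<^sub>C Q u" for u
      by (rule ell2_eqI) (simp add: Q_def restrict_ell2.rep_eq)
    thus "scaleC_op c T \<in> M" using BO T by (simp add: M_def)
  qed (auto simp: M_def)
  moreover have "univ_gen X A x a \<in> M" if "x \<in> X" "a \<in> A" for x a
    using univ_gen_bounded_ops[OF that]
    by (auto simp: M_def I_def slice_univ_gen[OF that] sQ intro!: slice_eqI)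
  ultimately have "univ_alg X A \<subseteq> M"
    unfolding univ_alg_def I_def by (intro hull_minimal) auto
  hence comm: "T (Q u) = Q (T u)" and bo: "T \<in> bounded_ops I" if "T \<in> univ_alg X A" for T u
    using that by (auto simp: M_def)
  have res: "restrict_ell2 I (ket r \<otimes>\<^sub>v v) = ket r \<otimes>\<^sub>v restrict_ell2 J v" for v
    by (rule ell2_eqI)
       (use r in \<open>auto simp: restrict_ell2.rep_eq tensor_vec.rep_eq coord_ket I_def univ_index_def split: prod.split\<close>)
  have srt: "slice r (ket r \<otimes>\<^sub>v v) = v" for v :: "nat ell2"
    by (rule ell2_eqI) (simp add: slice_tensor coord_ket)
  have "unital_star_hom I (univ_alg X A) J \<phi>"
    unfolding unital_star_hom_def
  proof (intro conjI ballI allI)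
    fix T c assume T: "T \<in> univ_alg X A"
    note b = bo[OF T, unfolded bounded_ops_def, simplified]
    show "\<phi> T \<in> bounded_ops J"
      unfolding bounded_ops_def
    proof (intro CollectI conjI allI)
      have "ket r \<otimes>\<^sub>v (d *\<^sub>C u) = d *\<^sub>C (ket r \<otimes>\<^sub>v u)" for d and u :: "nat ell2"
        by (rule ell2_eqI) (simp add: tensor_vec.rep_eq split: prod.split)
      thus "clinear_op (\<phi> T)" using b by (simp add: clinear_op_def \<phi> slice_scaleC)
      show "\<phi> T u \<in> ell2_on J" for u
      proof -
        have "(r, i) \<notin> I" if "i \<notin> J" for i using r that by (simp add: I_def univ_index_def)
        moreover have "T w \<in> ell2_on I" for w using b by simp
        ultimately have "coord (T w) (r, i) = 0" if "i \<notin> J" for i w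
          using that unfolding ell2_on_def by blast
        thus ?thesis by (simp add: \<phi> ell2_on_def slice.rep_eq)
      qed
      show "\<phi> T (restrict_ell2 J u) = \<phi> T u" for u
        using b by (simp add: \<phi> res[symmetric])
    qed
    have "adj (\<phi> T) = \<phi> (adj T)"
    proof (rule adj_unique)
      fix u v
      have "cinner (\<phi> (adj T) u) v = cnj (cinner (ket r \<otimes>\<^sub>v v) (adj T (ket r \<otimes>\<^sub>v u)))"
        by (simp add: \<phi> cinner_ket_tensor cinner_commute[of _ v])
      also have "\<dots> = cinner (ket r \<otimes>\<^sub>v u) (T (ket r \<otimes>\<^sub>v v))"
        using b by (simp add: cinner_commute[symmetric] cinner_adj)
      finally show "cinner (\<phi> (adj T) u) v = cinner u (\<phi> T v)" by (simp add: \<phi> cinner_ket_tensor)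
    qed
    thus "\<phi> (adj T) = adj (\<phi> T)" by simp
    show "\<phi> (scaleC_op c T) = scaleC_op c (\<phi> T)"
      by (rule blinfun_eqI) (simp add: \<phi> slice_scaleC)
  next
    fix S T assume S: "S \<in> univ_alg X A" and T: "T \<in> univ_alg X A"
    show "\<phi> (S + T) = \<phi> S + \<phi> T" by (rule blinfun_eqI) (simp add: \<phi> blinfun.add_left slice_add)
    show "\<phi> (S o\<^sub>L T) = \<phi> S o\<^sub>L \<phi> T"
      by (rule blinfun_eqI) (simp add: \<phi> Q comm[OF S] sQ)
  next
    show "\<phi> (id_on I) = id_on J" by (rule blinfun_eqI) (simp add: \<phi> res srt)
  qed
  moreover have "\<phi> (univ_gen X A x a) = P x a" if "x \<in> X" "a \<in> A" for x a
    by (rule blinfun_eqI) (simp add: \<phi> slice_univ_gen[OF that] r srt)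
  ultimately show ?thesis unfolding I_def by blast
qed

section \<open>Games and correlations\<close>

(* A game (X, Y, A, B, lam); lam (x, y, a, b) is the score in {0, 1}. *)
definition nonlocal_game :: "'x set \<Rightarrow> 'y set \<Rightarrow> 'a set \<Rightarrow> 'b set \<Rightarrow> ('x \<times> 'y \<times> 'a \<times> 'b \<Rightarrow> nat) \<Rightarrow> bool"
  where "nonlocal_game X Y A B lam \<longleftrightarrow>
    finite X \<and> finite Y \<and> finite A \<and> finite B \<and> lam \<in> X \<times> Y \<times> A \<times> B \<rightarrow> {0, 1}"

definition imitation_game :: "'x set \<Rightarrow> 'y set \<Rightarrow> 'a set \<Rightarrow> 'b set \<Rightarrow> ('x \<times> 'y \<times> 'a \<times> 'b \<Rightarrow> nat) \<Rightarrow> bool"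
  where "imitation_game X Y A B lam \<longleftrightarrow> nonlocal_game X Y A B lam \<and>
    (\<forall>x\<in>X. \<forall>a\<in>A. \<forall>a'\<in>A. a \<noteq> a' \<longrightarrow>
      (\<exists>y\<in>Y. (\<Sum>b\<in>B. lam (x, y, a, b) * lam (x, y, a', b)) = 0)) \<and>
    (\<forall>y\<in>Y. \<forall>b\<in>B. \<forall>b'\<in>B. b \<noteq> b' \<longrightarrow>
      (\<exists>x\<in>X. (\<Sum>a\<in>A. lam (x, y, a, b) * lam (x, y, a, b')) = 0))"

(* p (x, y, a, b) stands for p(a, b | x, y). *)
definition C_ns :: "'x set \<Rightarrow> 'y set \<Rightarrow> 'a set \<Rightarrow> 'b set \<Rightarrow> ('x \<times> 'y \<times> 'a \<times> 'b \<Rightarrow> real) set"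
  where "C_ns X Y A B = {p \<in> X \<times> Y \<times> A \<times> B \<rightarrow>\<^sub>E {0..1}.
    (\<forall>x\<in>X. \<forall>y\<in>Y. \<forall>y'\<in>Y. \<forall>a\<in>A. (\<Sum>b\<in>B. p (x, y, a, b)) = (\<Sum>b\<in>B. p (x, y', a, b))) \<and>
    (\<forall>x\<in>X. \<forall>x'\<in>X. \<forall>y\<in>Y. \<forall>b\<in>B. (\<Sum>a\<in>A. p (x, y, a, b)) = (\<Sum>a\<in>A. p (x', y, a, b))) \<and>
    (\<forall>x\<in>X. \<forall>y\<in>Y. (\<Sum>(a, b)\<in>A \<times> B. p (x, y, a, b)) = 1)}"

definition C_q :: "'x set \<Rightarrow> 'y set \<Rightarrow> 'a set \<Rightarrow> 'b set \<Rightarrow> ('x \<times> 'y \<times> 'a \<times> 'b \<Rightarrow> real) set"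
  where "C_q X Y A B = {p \<in> C_ns X Y A B.
    \<exists>(J :: nat set) (K :: nat set) P Q \<psi>. finite J \<and> finite K \<and>
      pvm_family J X A P \<and> pvm_family K Y B Q \<and> \<psi> \<in> ell2_on (J \<times> K) \<and> norm \<psi> = 1 \<and>
      (\<forall>x\<in>X. \<forall>y\<in>Y. \<forall>a\<in>A. \<forall>b\<in>B.
        complex_of_real (p (x, y, a, b)) = cinner \<psi> ((P x a \<otimes>\<^sub>o Q y b) \<psi>))}"

(* The closure is taken in the topology of pointwise convergence. As all elements of C_ns agree
   outside X \<times> Y \<times> A \<times> B, this is the closure in the Euclidean space of functions on
   X \<times> Y \<times> A \<times> B. *)
definition C_qa :: "'x set \<Rightarrow> 'y set \<Rightarrow> 'a set \<Rightarrow> 'b set \<Rightarrow> ('x \<times> 'y \<times> 'a \<times> 'b \<Rightarrow> real) set"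
  where "C_qa X Y A B = closure (C_q X Y A B)"

definition C_ns_game :: "'x set \<Rightarrow> 'y set \<Rightarrow> 'a set \<Rightarrow> 'b set \<Rightarrow> ('x \<times> 'y \<times> 'a \<times> 'b \<Rightarrow> nat) \<Rightarrow> ('x \<times> 'y \<times> 'a \<times> 'b \<Rightarrow> real) set"
  where "C_ns_game X Y A B lam = {p \<in> C_ns X Y A B.
    \<forall>x\<in>X. \<forall>y\<in>Y. \<forall>a\<in>A. \<forall>b\<in>B. lam (x, y, a, b) = 0 \<longrightarrow> p (x, y, a, b) = 0}"

definition C_qa_game :: "'x set \<Rightarrow> 'y set \<Rightarrow> 'a set \<Rightarrow> 'b set \<Rightarrow> ('x \<times> 'y \<times> 'a \<times> 'b \<Rightarrow> nat) \<Rightarrow> ('x \<times> 'y \<times> 'a \<times> 'b \<Rightarrow> real) set"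
  where "C_qa_game X Y A B lam = C_ns_game X Y A B lam \<inter> C_qa X Y A B"

end

theory Submission
  imports Defs
begin

text \<open>The equivalence has two ingredients.

  For finite sets of questions and answers, the closure of the quantum correlations consists of the
  correlations \<open>p (a, b | x, y) = \<tau> (e x a \<otimes> f y b)\<close> of states \<open>\<tau>\<close> of the minimal tensor product.
  A quantum correlation is a vector state of the universal representation, because the
  representation that realises it is one of its blocks (\<open>C_q_vector_state\<close>); a limit of quantum
  correlations comes from a weak* cluster point of vector states (\<open>C_qa_imp_state\<close>). For the converse
  (\<open>state_imp_C_qa\<close>), a correlation outside of the closed convex set of limits of quantum
  correlations would violate a linear inequality that all quantum correlations satisfy. Such an
  inequality says that an operator \<open>T - s\<close>, with \<open>T\<close> a real combination of the operators
  \<open>e x a \<otimes> f y b\<close>, has nonnegative expectation in each vector with finite support: in such a vector,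
  the infinite-dimensional measurements can be replaced by finite-dimensional ones
  (\<open>compress_pvm\<close>). Hence \<open>T - s\<close> is a positive operator, thus a limit of squares in the C*-algebra, and
  every state satisfies the inequality as well.

  For a perfect correlation of an imitation game, every state \<open>\<tau>\<close> that realises it is tracial on both
  tensor factors (\<open>perfect_state_tracial\<close>). Given \<open>x\<close> and answers \<open>a \<noteq> a'\<close>, choose a question \<open>y\<close> for
  which no answer of Bob wins against both. Then for each \<open>b\<close> one of the projections
  \<open>e x a \<otimes> f y b\<close> and \<open>e x a' \<otimes> f y b\<close> has value 0 under \<open>\<tau>\<close>. For \<open>Z\<close> in Alice's algebra, insert
  \<open>1 = (\<Sum>b. f y b)\<close> into \<open>\<tau> (e x a Z e x a')\<close>: as \<open>f y b\<close> commutes with Alice's algebra, each summand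
  vanishes by the Cauchy-Schwarz inequality. Consequently
  \<open>\<tau> (e x a Z) = \<tau> (e x a Z e x a) = \<tau> (Z e x a)\<close>. The elements that commute under \<open>\<tau>\<close> with all
  others form a C*-algebra; it contains the generators, hence everything.\<close>

section \<open>Complex linear operators and their adjoints\<close>

lemma cinner_zero_right [simp]: "cinner u 0 = 0"
  by (simp add: cinner_def)

lemma cinner_minus_left: "cinner (- u) v = - cinner u v"
  using cinner_add_left[of u "- u" v] by (simp add: cinner_zero_left add_eq_0_iff)

lemma cinner_minus_right: "cinner u (- v) = - cinner u v"
  using cinner_add_right[of u v "- v"] by (simp add: add_eq_0_iff)

lemma cinner_diff_left: "cinner (u - v) w = cinner u w - cinner v w"
  using cinner_add_left[of u "- v" w] by (simp add: cinner_minus_left)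

lemma cinner_diff_right: "cinner w (u - v) = cinner w u - cinner w v"
  using cinner_add_right[of w u "- v"] by (simp add: cinner_minus_right)

lemma cinner_sum_left: "cinner (sum f F) v = (\<Sum>i\<in>F. cinner (f i) v)"
  by (induction F rule: infinite_finite_induct) (simp_all add: cinner_add_left cinner_zero_left)

lemma cinner_sum_right: "cinner v (sum f F) = (\<Sum>i\<in>F. cinner v (f i))"
  by (induction F rule: infinite_finite_induct) (simp_all add: cinner_add_right)

lemma cinner_scaleR_left: "cinner (r *\<^sub>R u) v = of_real r * cinner u v"
  by (simp add: scaleR_scaleC cinner_scaleC_left)

lemma cinner_scaleR_right: "cinner u (r *\<^sub>R v) = of_real r * cinner u v"
  by (simp add: scaleR_scaleC cinner_scaleC_right)

lemma bounded_linear_cinner_left: "bounded_linear (\<lambda>u. cinner u v)"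
proof -
  have "bounded_linear (\<lambda>u. cnj (cinner v u))"
    by (rule bounded_linear_compose[OF bounded_linear_cnj bounded_linear_cinner_right])
  moreover have "(\<lambda>u. cinner u v) = (\<lambda>u. cnj (cinner v u))" by (rule ext, rule cinner_commute)
  ultimately show ?thesis by simp
qed

lemma cinner_eqI_right: "(\<And>w. cinner w u = cinner w v) \<Longrightarrow> u = v"
  by (rule cinner_eqI) (metis cinner_commute)

lemma blinfun_eq_iff: "S = T \<longleftrightarrow> (\<forall>u. blinfun_apply S u = blinfun_apply T u)"
  by (auto intro: blinfun_eqI)

lemma blinfun_sum_left: "blinfun_apply (sum T F) u = (\<Sum>i\<in>F. blinfun_apply (T i) u)"
  by (induction F rule: infinite_finite_induct) (simp_all add: blinfun.add_left)

lemma scaleC_zero_right [simp]: "c *\<^sub>C 0 = 0"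
  by (rule ell2_eqI) simp

lemma blinfun_compose_assoc: "(S o\<^sub>L T) o\<^sub>L R = S o\<^sub>L (T o\<^sub>L R)"
  by (simp add: blinfun_eq_iff)

lemma scaleC_zero_left [simp]: "0 *\<^sub>C u = 0"
  by (rule ell2_eqI) simp



lemma scaleC_one [simp]: "1 *\<^sub>C u = u"
  by (rule ell2_eqI) simp

lemma scaleC_sum_right: "c *\<^sub>C sum f F = (\<Sum>i\<in>F. c *\<^sub>C f i)"
  by (induction F rule: infinite_finite_induct) (simp_all add: scaleC_add_right)

lemma scaleC_diff_right: "c *\<^sub>C (u - v) = c *\<^sub>C u - c *\<^sub>C v"
  by (rule ell2_eqI) (simp add: algebra_simps)

lemma clinear_opD: "clinear_op T \<Longrightarrow> T (c *\<^sub>C u) = c *\<^sub>C T u"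
  by (simp add: clinear_op_def)

lemma clinear_add: "clinear_op S \<Longrightarrow> clinear_op T \<Longrightarrow> clinear_op (S + T)"
  by (simp add: clinear_op_def blinfun.add_left scaleC_add_right)

lemma clinear_diff: "clinear_op S \<Longrightarrow> clinear_op T \<Longrightarrow> clinear_op (S - T)"
  by (simp add: clinear_op_def blinfun.diff_left scaleC_diff_right)

lemma clinear_compose: "clinear_op S \<Longrightarrow> clinear_op T \<Longrightarrow> clinear_op (S o\<^sub>L T)"
  by (simp add: clinear_op_def)

lemma clinear_zero [simp]: "clinear_op 0"
  by (simp add: clinear_op_def)

lemma clinear_scaleC_op: "clinear_op T \<Longrightarrow> clinear_op (scaleC_op c T)"
  by (simp add: clinear_op_def scaleC_scaleC mult.commute)

lemma clinear_scaleR: "clinear_op T \<Longrightarrow> clinear_op (r *\<^sub>R T)"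
  by (simp add: clinear_op_def blinfun.scaleR_left scaleR_scaleC scaleC_scaleC mult.commute)

lemma clinear_sum: "(\<And>i. i \<in> F \<Longrightarrow> clinear_op (T i)) \<Longrightarrow> clinear_op (sum T F)"
  by (induction F rule: infinite_finite_induct) (simp_all add: clinear_add)

lemma clinear_id_blinfun [simp]: "clinear_op id_blinfun"
  by (simp add: clinear_op_def)

lemma scaleR_eq_scaleC_op: "r *\<^sub>R T = scaleC_op (of_real r) T"
  by (rule blinfun_eqI) (simp add: blinfun.scaleR_left scaleR_scaleC)

lemma bounded_ops_clinear: "T \<in> bounded_ops J \<Longrightarrow> clinear_op T"
  by (simp add: bounded_ops_def)

lemma cinner_adj_right: "clinear_op T \<Longrightarrow> cinner u (adj T v) = cinner (T u) v"
  by (metis cinner_adj cinner_commute)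

lemma adj_adj: "clinear_op T \<Longrightarrow> adj (adj T) = T"
  by (rule adj_unique) (simp add: cinner_adj_right)

lemma adj_compose: "clinear_op S \<Longrightarrow> clinear_op T \<Longrightarrow> adj (S o\<^sub>L T) = adj T o\<^sub>L adj S"
  by (rule adj_unique) (simp add: cinner_adj)

lemma adj_scaleC: "clinear_op T \<Longrightarrow> adj (scaleC_op c T) = scaleC_op (cnj c) (adj T)"
  by (rule adj_unique) (simp add: cinner_adj cinner_scaleC_left cinner_scaleC_right)

lemma adj_diff: "clinear_op S \<Longrightarrow> clinear_op T \<Longrightarrow> adj (S - T) = adj S - adj T"
  by (rule adj_unique) (simp add: cinner_adj blinfun.diff_left cinner_diff_left cinner_diff_right)

lemma adj_id_on [simp]: "adj (id_on J) = id_on J"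
  by (rule adj_unique) (simp add: cinner_restrict)

lemma selfadjointD: "clinear_op T \<Longrightarrow> adj T = T \<Longrightarrow> cinner (T u) v = cinner u (T v)"
  by (metis cinner_adj)

lemma norm_adj_le:
  assumes "clinear_op T" shows "norm (adj T) \<le> norm T"
proof (rule norm_blinfun_bound)
  fix u
  have "of_real ((norm (adj T u))\<^sup>2) = cinner u (T (adj T u))"
    unfolding cinner_self[symmetric] by (rule cinner_adj[OF assms])
  hence "(norm (adj T u))\<^sup>2 = cmod (cinner u (T (adj T u)))"
    by (metis norm_of_real abs_of_nonneg zero_le_power2)
  also have "\<dots> \<le> norm u * norm (T (adj T u))" by (rule cmod_cinner_le)
  also have "\<dots> \<le> norm u * (norm T * norm (adj T u))"
    by (intro mult_left_mono norm_blinfun) auto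
  finally show "norm (adj T u) \<le> norm T * norm u"
    by (cases "norm (adj T u) = 0") (auto simp: power2_eq_square mult_ac)
qed simp

section \<open>Algebra of tensor product operators\<close>

lemma cinner_ket: "cinner (ket i) (ket k) = (if i = k then 1 else 0)"
  by (simp add: cinner_ket_left coord_ket)

lemma slice_ket: "slice r (ket (s, i)) = (if r = s then ket i else 0)"
  by (rule ell2_eqI) (auto simp: slice.rep_eq coord_ket)

lemma norm_ket: "norm (ket i) = 1"
proof -
  have "complex_of_real ((norm (ket i))\<^sup>2) = 1"
    unfolding cinner_self[symmetric] by (simp add: cinner_ket)
  hence "(norm (ket i))\<^sup>2 = 1\<^sup>2" by (simp flip: of_real_power)
  thus ?thesis by (subst (asm) power2_eq_iff_nonneg) auto
qed

lemma slice_sum: "slice r (sum f F) = (\<Sum>a\<in>F. slice r (f a))"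
  by (induction F rule: infinite_finite_induct) (simp_all add: slice_add slice_zero)

lemma coord_cinner_ket: "coord u i = cinner (ket i) u"
  by (simp add: cinner_ket_left)

lemma ket_tensor: "ket i \<otimes>\<^sub>v ket j = ket (i, j)"
  by (rule ell2_eqI) (auto simp: tensor_vec.rep_eq coord_ket split: prod.split)

lemma tensor_scaleC_left: "(c *\<^sub>C u) \<otimes>\<^sub>v v = c *\<^sub>C (u \<otimes>\<^sub>v v)"
  by (rule ell2_eqI) (auto simp: tensor_vec.rep_eq split: prod.split)

lemma tensor_scaleC_right: "u \<otimes>\<^sub>v (c *\<^sub>C v) = c *\<^sub>C (u \<otimes>\<^sub>v v)"
  by (rule ell2_eqI) (auto simp: tensor_vec.rep_eq split: prod.split)

lemma tensor_add_left: "(u + u') \<otimes>\<^sub>v v = u \<otimes>\<^sub>v v + u' \<otimes>\<^sub>v v"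
  by (rule ell2_eqI) (auto simp: tensor_vec.rep_eq algebra_simps split: prod.split)

lemma tensor_add_right: "u \<otimes>\<^sub>v (v + v') = u \<otimes>\<^sub>v v + u \<otimes>\<^sub>v v'"
  by (rule ell2_eqI) (auto simp: tensor_vec.rep_eq algebra_simps split: prod.split)

lemma cinner_tensor:
  fixes u u' :: "'i ell2" and v v' :: "'j ell2"
  shows "cinner (u \<otimes>\<^sub>v v) (u' \<otimes>\<^sub>v v') = cinner u u' * cinner v v'"
proof -
  have "((\<lambda>r. cinner (coord u r *\<^sub>C ket r \<otimes>\<^sub>v v) (u' \<otimes>\<^sub>v v')) has_sum cinner (u \<otimes>\<^sub>v v) (u' \<otimes>\<^sub>v v')) UNIV"
  proof (rule has_sum_bounded_linear[OF _ ket_expansion[of u]])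
    have "bounded_linear (\<lambda>u :: 'i ell2. u \<otimes>\<^sub>v v)"
    proof (rule bounded_linear_intro[of _ "norm v"])
      fix u :: "'i ell2"
      have s: "(\<lambda>(i, j). (cmod (coord u i))\<^sup>2 * (cmod (coord v j))\<^sup>2) summable_on UNIV \<times> UNIV"
        using coord_summable[of "u \<otimes>\<^sub>v v" UNIV]
        by (simp add: tensor_vec.rep_eq case_prod_unfold norm_mult power_mult_distrib)
      have "(norm (u \<otimes>\<^sub>v v))\<^sup>2 = (\<Sum>\<^sub>\<infinity>(i, j)\<in>UNIV \<times> UNIV. (cmod (coord u i))\<^sup>2 * (cmod (coord v j))\<^sup>2)"
        by (simp add: norm_ell2_square tensor_vec.rep_eq case_prod_unfold norm_mult power_mult_distrib)
      also have "\<dots> = (\<Sum>\<^sub>\<infinity>i. (\<Sum>\<^sub>\<infinity>j. (cmod (coord u i))\<^sup>2 * (cmod (coord v j))\<^sup>2))"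
        by (rule infsum_Sigma'_banach[symmetric]) (use s in auto)
      also have "\<dots> = (norm u)\<^sup>2 * (norm v)\<^sup>2"
        by (simp add: norm_ell2_square infsum_cmult_right coord_summable infsum_cmult_left)
      also have "\<dots> = (norm u * norm v)\<^sup>2" by (simp add: power_mult_distrib)
      finally show "norm (u \<otimes>\<^sub>v v) \<le> norm u * norm v" by (simp add: power2_eq_iff_nonneg)
    qed (auto simp: tensor_add_left scaleR_scaleC tensor_scaleC_left)
    thus "bounded_linear (\<lambda>u. cinner (u \<otimes>\<^sub>v v) (u' \<otimes>\<^sub>v v'))"
      by (rule bounded_linear_compose[OF bounded_linear_cinner_left])
  qed
  hence "((\<lambda>r. cnj (coord u r) * coord u' r * cinner v v') has_sum cinner (u \<otimes>\<^sub>v v) (u' \<otimes>\<^sub>v v')) UNIV"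
    by (simp add: tensor_scaleC_left cinner_scaleC_left cinner_ket_tensor slice_tensor
        cinner_scaleC_right mult.assoc)
  from infsumI[OF this] show ?thesis
    by (simp add: infsum_cmult_left cinner_summable cinner_def[of u])
qed

lemma tensor_op_ext:
  fixes R R' :: "('i \<times> 'j) ell2 \<Rightarrow>\<^sub>L 'b::real_normed_vector"
  assumes "\<And>u v. blinfun_apply R (u \<otimes>\<^sub>v v) = blinfun_apply R' (u \<otimes>\<^sub>v v)"
  shows "R = R'"
  by (rule ell2_op_eqI) (metis assms ket_tensor tensor_scaleC_left surj_pair)

lemma tensor_op_clinear:
  assumes "clinear_op S" "clinear_op T"
  shows "clinear_op (S \<otimes>\<^sub>o T)"
  unfolding clinear_op_def
proof (intro allI)
  fix c w
  have "(S \<otimes>\<^sub>o T) o\<^sub>L scaleC_op c id_blinfun = scaleC_op c (S \<otimes>\<^sub>o T)"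
    by (rule tensor_op_ext)
      (simp add: tensor_op_apply assms clinear_opD tensor_scaleC_left flip: tensor_scaleC_left)
  from arg_cong[OF this, of "\<lambda>R. blinfun_apply R w"]
  show "(S \<otimes>\<^sub>o T) (c *\<^sub>C w) = c *\<^sub>C (S \<otimes>\<^sub>o T) w" by simp
qed

lemma tensor_op_compose:
  assumes "clinear_op S" "clinear_op T" "clinear_op S'" "clinear_op T'"
  shows "(S \<otimes>\<^sub>o T) o\<^sub>L (S' \<otimes>\<^sub>o T') = (S o\<^sub>L S') \<otimes>\<^sub>o (T o\<^sub>L T')"
  by (rule tensor_op_unique[symmetric]) (simp add: tensor_op_apply assms)

lemma tensor_op_add_left:
  assumes "clinear_op S" "clinear_op S'" "clinear_op T"
  shows "(S + S') \<otimes>\<^sub>o T = S \<otimes>\<^sub>o T + S' \<otimes>\<^sub>o T"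
  by (rule tensor_op_unique) (simp add: tensor_op_apply assms blinfun.add_left tensor_add_left)

lemma tensor_op_add_right:
  assumes "clinear_op S" "clinear_op T" "clinear_op T'"
  shows "S \<otimes>\<^sub>o (T + T') = S \<otimes>\<^sub>o T + S \<otimes>\<^sub>o T'"
  by (rule tensor_op_unique) (simp add: tensor_op_apply assms blinfun.add_left tensor_add_right)

lemma tensor_op_scaleC_left:
  assumes "clinear_op S" "clinear_op T"
  shows "scaleC_op c S \<otimes>\<^sub>o T = scaleC_op c (S \<otimes>\<^sub>o T)"
  by (rule tensor_op_unique) (simp add: tensor_op_apply assms tensor_scaleC_left)

lemma tensor_op_scaleC_right:
  assumes "clinear_op S" "clinear_op T"
  shows "S \<otimes>\<^sub>o scaleC_op c T = scaleC_op c (S \<otimes>\<^sub>o T)"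
  by (rule tensor_op_unique) (simp add: tensor_op_apply assms tensor_scaleC_right)

lemma tensor_op_zero_left: "clinear_op T \<Longrightarrow> 0 \<otimes>\<^sub>o T = 0"
  by (rule tensor_op_unique) (auto intro!: ell2_eqI simp: tensor_vec.rep_eq split: prod.split)

lemma tensor_op_zero_right: "clinear_op S \<Longrightarrow> S \<otimes>\<^sub>o 0 = 0"
  by (rule tensor_op_unique) (auto intro!: ell2_eqI simp: tensor_vec.rep_eq split: prod.split)

lemma tensor_op_sum_left:
  assumes "\<And>i. i \<in> F \<Longrightarrow> clinear_op (S i)" "clinear_op T"
  shows "sum S F \<otimes>\<^sub>o T = (\<Sum>i\<in>F. S i \<otimes>\<^sub>o T)"
  using assms(1)
  by (induction F rule: infinite_finite_induct)
     (simp_all add: tensor_op_zero_left tensor_op_add_left clinear_sum assms(2))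

lemma tensor_op_sum_right:
  assumes "clinear_op S" "\<And>i. i \<in> F \<Longrightarrow> clinear_op (T i)"
  shows "S \<otimes>\<^sub>o sum T F = (\<Sum>i\<in>F. S \<otimes>\<^sub>o T i)"
  using assms(2)
  by (induction F rule: infinite_finite_induct)
     (simp_all add: tensor_op_zero_right tensor_op_add_right clinear_sum assms(1))

lemma tensor_op_adj:
  fixes S :: "'i op" and T :: "'j op"
  assumes "clinear_op S" "clinear_op T"
  shows "adj (S \<otimes>\<^sub>o T) = adj S \<otimes>\<^sub>o adj T"
proof (rule tensor_op_unique[symmetric], rule ell2_eqI)
  fix u v and p :: "'i \<times> 'j"
  obtain i j where p: "p = (i, j)" by fastforce
  show "coord (adj (S \<otimes>\<^sub>o T) (u \<otimes>\<^sub>v v)) p = coord (adj S u \<otimes>\<^sub>v adj T v) p"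
    by (simp add: coord_cinner_ket p cinner_adj_right tensor_op_clinear assms
        ket_tensor[symmetric] tensor_op_apply cinner_tensor)
qed

lemma tensor_op_id_on: "id_on J \<otimes>\<^sub>o id_on K = id_on (J \<times> K)"
  by (rule tensor_op_unique, rule ell2_eqI)
     (auto simp: restrict_ell2.rep_eq tensor_vec.rep_eq split: prod.split)

lemma bounded_ops_iff_id_on:
  "T \<in> bounded_ops J \<longleftrightarrow> clinear_op T \<and> id_on J o\<^sub>L T = T \<and> T o\<^sub>L id_on J = T"
  by (auto simp: bounded_ops_def restrict_ell2_eq_iff[symmetric] blinfun_eq_iff)

lemma tensor_op_bounded_ops:
  assumes "S \<in> bounded_ops J" "T \<in> bounded_ops K"
  shows "S \<otimes>\<^sub>o T \<in> bounded_ops (J \<times> K)"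
  using assms
  by (simp add: bounded_ops_iff_id_on tensor_op_clinear flip: tensor_op_id_on)
     (simp add: tensor_op_compose)

text \<open>Up to a flip of the factors, \<open>S \<otimes>\<^sub>o 1\<close> and \<open>1 \<otimes>\<^sub>o T\<close> are direct sums of copies of one operator,
  whose norm is seen slice by slice.\<close>

lemma norm_direct_sum_le:
  fixes D :: "('r \<times> 'i) ell2 \<Rightarrow>\<^sub>L ('r \<times> 'i) ell2"
  assumes B: "0 \<le> B" and D: "\<And>r. norm (slice r (blinfun_apply D u)) \<le> B * norm (slice r u)"
  shows "norm (D u) \<le> B * norm u"
proof (rule norm_ell2_le)
  fix F :: "('r \<times> 'i) set" assume F: "finite F"
  have "(\<Sum>p\<in>F. (cmod (coord (D u) p))\<^sup>2) \<le> (\<Sum>p\<in>fst ` F \<times> snd ` F. (cmod (coord (D u) p))\<^sup>2)"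
    by (rule sum_mono2) (use F in \<open>auto simp: rev_image_eqI\<close>)
  also have "\<dots> = (\<Sum>r\<in>fst ` F. \<Sum>i\<in>snd ` F. (cmod (coord (slice r (D u)) i))\<^sup>2)"
    by (simp add: sum.cartesian_product slice.rep_eq case_prod_unfold)
  also have "\<dots> \<le> (\<Sum>r\<in>fst ` F. (norm (slice r (D u)))\<^sup>2)"
    by (intro sum_mono sum_coord_le_norm) (use F in auto)
  also have "\<dots> \<le> (\<Sum>r\<in>fst ` F. B\<^sup>2 * (norm (slice r u))\<^sup>2)"
    by (rule sum_mono) (metis D power_mono norm_ge_zero power_mult_distrib)
  also have "\<dots> \<le> B\<^sup>2 * (norm u)\<^sup>2"
    unfolding sum_distrib_left[symmetric] using F by (intro mult_left_mono slice_bounded_sum) auto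
  finally show "(\<Sum>p\<in>F. (cmod (coord (D u) p))\<^sup>2) \<le> (B * norm u)\<^sup>2" by (simp add: power_mult_distrib)
qed (use B in simp)

lemma norm_tensor_op_le:
  fixes S :: "'i op" and T :: "'j op"
  assumes S: "clinear_op S" and T: "clinear_op T"
  shows "norm (S \<otimes>\<^sub>o T) \<le> norm S * norm T"
proof (rule norm_blinfun_bound)
  fix w
  obtain D1 :: "('i \<times> 'j) op" where D1: "\<And>u r. slice r (D1 u) = T (slice r u)"
    using direct_sum_exists[of "\<lambda>_. T" "norm T"] by auto
  obtain D2 :: "('j \<times> 'i) op" where D2: "\<And>u r. slice r (D2 u) = S (slice r u)"
    using direct_sum_exists[of "\<lambda>_. S" "norm S"] by auto
  have fl: "flip (u \<otimes>\<^sub>v v) = v \<otimes>\<^sub>v u" for u :: "'a ell2" and v :: "'b ell2"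
    by (rule ell2_eqI) (simp add: flip.rep_eq tensor_vec.rep_eq split: prod.split)
  have 1: "D1 (u \<otimes>\<^sub>v v) = u \<otimes>\<^sub>v T v" for u v
    using T by (intro slice_eqI) (simp add: D1 slice_tensor clinear_op_def)
  have 2: "D2 (v \<otimes>\<^sub>v u) = v \<otimes>\<^sub>v S u" for u v
    using S by (intro slice_eqI) (simp add: D2 slice_tensor clinear_op_def)
  have lin: "bounded_linear (\<lambda>u. flip (D2 (flip (D1 u))))"
    by (intro bounded_linear_compose[OF bounded_linear_flip] blinfun.bounded_linear_right
              bounded_linear_compose[OF blinfun.bounded_linear_right])
  have "S \<otimes>\<^sub>o T = Blinfun (\<lambda>u. flip (D2 (flip (D1 u))))"
    by (rule tensor_op_unique) (simp add: bounded_linear_Blinfun_apply[OF lin] 1 2 fl)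
  hence "norm ((S \<otimes>\<^sub>o T) w) = norm (D2 (flip (D1 w)))"
    by (simp add: bounded_linear_Blinfun_apply[OF lin])
  also have "\<dots> \<le> norm S * norm (flip (D1 w))"
    by (rule norm_direct_sum_le) (simp_all add: D2 norm_blinfun)
  also have "norm (flip (D1 w)) \<le> norm T * norm w"
    by (simp, rule norm_direct_sum_le) (simp_all add: D1 norm_blinfun)
  finally show "norm ((S \<otimes>\<^sub>o T) w) \<le> norm S * norm T * norm w"
    by (simp add: mult.assoc mult_left_mono)
qed simp

lemma norm_id_on_le: "norm (id_on J) \<le> 1"
  by (rule norm_projection_le[of _ J])
     (auto simp: projections_def bounded_ops_def blinfun_eq_iff)

section \<open>States on concrete C*-algebras\<close>

lemma subspace_bounded_ops: "subspace (bounded_ops J)"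
  using cstar_subalgebra_bounded_ops[of J]
  by (auto simp: subspace_def cstar_subalgebra_def scaleR_eq_scaleC_op bounded_ops_def)

locale cstar_algebra =
  fixes J :: "'i set" and M :: "'i op set"
  assumes cstar: "cstar_subalgebra J M"
begin

lemma bounded: "T \<in> M \<Longrightarrow> T \<in> bounded_ops J"
  and clinear: "T \<in> M \<Longrightarrow> clinear_op T"
  and unit_mem: "id_on J \<in> M"
  and add_mem: "S \<in> M \<Longrightarrow> T \<in> M \<Longrightarrow> S + T \<in> M"
  and compose_mem: "S \<in> M \<Longrightarrow> T \<in> M \<Longrightarrow> S o\<^sub>L T \<in> M"
  and adj_mem: "T \<in> M \<Longrightarrow> adj T \<in> M"
  and scaleC_mem: "T \<in> M \<Longrightarrow> scaleC_op c T \<in> M"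
  and closed_alg: "closed M"
  using cstar by (auto simp: cstar_subalgebra_def bounded_ops_def)

lemma scaleR_mem: "T \<in> M \<Longrightarrow> r *\<^sub>R T \<in> M"
  by (simp add: scaleR_eq_scaleC_op scaleC_mem)

lemma diff_mem: "S \<in> M \<Longrightarrow> T \<in> M \<Longrightarrow> S - T \<in> M"
  using add_mem[of S "(-1) *\<^sub>R T"] scaleR_mem[of T "-1"] by simp

lemma zero_mem: "0 \<in> M"
  using diff_mem[OF unit_mem unit_mem] by simp

lemma sum_mem: "(\<And>i. i \<in> F \<Longrightarrow> T i \<in> M) \<Longrightarrow> sum T F \<in> M"
  by (induction F rule: infinite_finite_induct) (simp_all add: zero_mem add_mem)

lemma unit_compose [simp]: "T \<in> M \<Longrightarrow> id_on J o\<^sub>L T = T" "T \<in> M \<Longrightarrow> T o\<^sub>L id_on J = T"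
  using bounded[of T] by (simp_all add: bounded_ops_iff_id_on)

text \<open>The equation \<open>y\<^sup>2 = 1 - x\<close> becomes \<open>z = (x + z\<^sup>2) / 2\<close> for \<open>y = 1 - z\<close>, and the right-hand
  side is a contraction of the self-adjoint ball of radius \<open>(1 + \<parallel>x\<parallel>) / 2\<close>; so the square root
  comes from Banach's fixed point theorem, applied inside the closed algebra \<open>M\<close>.\<close>

lemma sqrt_exists:
  assumes x: "x \<in> M" "adj x = x" and less: "norm x < 1"
  shows "\<exists>y\<in>M. adj y = y \<and> y o\<^sub>L y = id_on J - x"
proof -
  \<comment> \<open>any \<open>r < 1\<close> with \<open>\<parallel>x\<parallel> + r\<^sup>2 \<le> 2 r\<close> makes the ball of radius \<open>r\<close> invariant with Lipschitz constant \<open>r\<close>\<close>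
  define r where "r = (1 + norm x) / 2"
  have r: "0 \<le> r" "r < 1" "norm x + r * r \<le> 2 * r"
  proof -
    have "(1 + norm x) * (1 + norm x) \<le> 2 * 2" using less by (intro mult_mono) auto
    thus "norm x + r * r \<le> 2 * r" by (simp add: r_def field_simps)
  qed (use less in \<open>auto simp: r_def\<close>)
  define B where "B = M \<inter> {z. \<forall>u v. cinner (blinfun_apply z u) v = cinner u (z v)} \<inter> cball 0 r"
  define f where "f z = (1/2) *\<^sub>R (x + (z o\<^sub>L z))" for z :: "'i op"
  have "closed {z :: 'i op. \<forall>u v. cinner (blinfun_apply z u) v = cinner u (z v)}"
  proof -
    have eq: "{z :: 'i op. \<forall>u v. cinner (blinfun_apply z u) v = cinner u (z v)} =
        (\<Inter>u v. {z. cinner (blinfun_apply z u) v = cinner u (z v)})" by auto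
    have "closed {z. cinner (blinfun_apply z u) v = cinner u (z v)}" for u v :: "'i ell2"
      by (intro closed_Collect_eq bounded_linear.continuous_on[OF bounded_linear_cinner_left]
          bounded_linear.continuous_on[OF bounded_linear_cinner_right] continuous_intros)
    thus ?thesis unfolding eq by (intro closed_INT ballI) assumption
  qed
  hence "complete B"
    unfolding complete_eq_closed B_def by (intro closed_Int closed_alg closed_cball)
  moreover have "0 \<in> B" using r by (simp add: B_def zero_mem cinner_zero_left)
  moreover have "f ` B \<subseteq> B"
  proof
    fix w assume "w \<in> f ` B"
    then obtain z where z: "z \<in> M" "\<And>u v. cinner (z u) v = cinner u (z v)" "norm z \<le> r" and w: "w = f z"
      by (auto simp: B_def)
    have "cinner (w u) v = cinner u (w v)" for u v
      using selfadjointD[OF clinear[OF x(1)] x(2)]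
      by (simp add: w f_def blinfun.scaleR_left blinfun.add_left cinner_scaleR_left
          cinner_scaleR_right cinner_add_left cinner_add_right z)
    moreover have "norm (x + (z o\<^sub>L z)) \<le> norm x + r * r"
      by (rule order_trans[OF norm_triangle_ineq])
        (intro add_left_mono order_trans[OF norm_blinfun_compose] mult_mono z r norm_ge_zero)
    hence "norm w \<le> r" using r by (simp add: w f_def)
    ultimately show "w \<in> B"
      using z x by (simp add: B_def w f_def scaleR_mem add_mem compose_mem)
  qed
  moreover have "dist (f z) (f w) \<le> r * dist z w" if "z \<in> B" "w \<in> B" for z w
  proof -
    have "f z - f w = (1/2) *\<^sub>R ((z o\<^sub>L (z - w)) + ((z - w) o\<^sub>L w))"
      by (rule blinfun_eqI) (simp add: f_def blinfun.scaleR_left blinfun.add_left blinfun.diff_left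
          blinfun.diff_right scaleR_right_diff_distrib[symmetric])
    moreover have "norm ((z o\<^sub>L (z - w)) + ((z - w) o\<^sub>L w)) \<le> r * norm (z - w) + norm (z - w) * r"
      using that by (intro order_trans[OF norm_triangle_ineq] add_mono
          order_trans[OF norm_blinfun_compose] mult_mono r) (auto simp: B_def)
    ultimately show ?thesis by (simp add: dist_norm mult.commute)
  qed
  ultimately have "\<exists>!z\<in>B. f z = z" by (intro Banach_fix[of B r f] r) auto
  then obtain z where z: "z \<in> B" "f z = z" by blast
  define y where "y = id_on J - z"
  have zM: "z \<in> M" using z by (simp add: B_def)
  have "adj z = z" by (rule adj_unique) (use z in \<open>simp add: B_def\<close>)
  hence "adj y = y" by (simp add: y_def adj_diff clinear zM)
  moreover have "y o\<^sub>L y = id_on J - x"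
  proof -
    have "x + (z o\<^sub>L z) = z + z"
      using arg_cong[OF z(2), of "\<lambda>w. 2 *\<^sub>R w"] by (simp add: f_def scaleR_2)
    moreover have "y o\<^sub>L y = id_on J - (z + z - (z o\<^sub>L z))"
    proof (rule blinfun_eqI)
      fix u
      have "restrict_ell2 J (z u) = z u" "z (restrict_ell2 J u) = z u"
        using unit_compose[OF zM] by (auto simp: blinfun_eq_iff)
      moreover have "id_on J (restrict_ell2 J u - z u) = restrict_ell2 J u - z u"
        by (simp only: blinfun.diff_right) (simp add: calculation)
      ultimately show "(y o\<^sub>L y) u = (id_on J - (z + z - (z o\<^sub>L z))) u"
        by (simp add: y_def blinfun.diff_left blinfun.diff_right blinfun.add_left)
    qed
    ultimately show ?thesis by (metis add_diff_cancel_right')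
  qed
  moreover have "y \<in> M" by (simp add: y_def diff_mem unit_mem zM)
  ultimately show ?thesis by blast
qed

end

locale cstar_state = cstar_algebra J M for J :: "'i set" and M :: "'i op set" +
  fixes \<tau> :: "'i op \<Rightarrow> complex"
  assumes state: "state_on J M \<tau>"
begin

lemma state_add: "S \<in> M \<Longrightarrow> T \<in> M \<Longrightarrow> \<tau> (S + T) = \<tau> S + \<tau> T"
  and state_scaleC: "T \<in> M \<Longrightarrow> \<tau> (scaleC_op c T) = c * \<tau> T"
  and state_square: "T \<in> M \<Longrightarrow> \<tau> (adj T o\<^sub>L T) \<in> \<real>\<^sub>\<ge>\<^sub>0"
  and state_unit: "\<tau> (id_on J) = 1"
  using state by (auto simp: state_on_def)

lemma state_scaleR: "T \<in> M \<Longrightarrow> \<tau> (r *\<^sub>R T) = of_real r * \<tau> T"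
  by (simp add: scaleR_eq_scaleC_op state_scaleC)

lemma state_zero: "\<tau> 0 = 0"
  using state_scaleR[OF zero_mem, of 0] by simp

lemma state_diff: "S \<in> M \<Longrightarrow> T \<in> M \<Longrightarrow> \<tau> (S - T) = \<tau> S - \<tau> T"
  using state_add[of S "(-1) *\<^sub>R T"] scaleR_mem[of T "-1"] state_scaleR[of T "-1"] by simp

lemma state_sum: "(\<And>i. i \<in> F \<Longrightarrow> T i \<in> M) \<Longrightarrow> \<tau> (sum T F) = (\<Sum>i\<in>F. \<tau> (T i))"
  by (induction F rule: infinite_finite_induct) (simp_all add: state_zero state_add sum_mem)

text \<open>The axioms of a state only speak of elements of the form \<open>T\<^sup>* T\<close>. A self-adjoint \<open>T\<close> with
  \<open>\<langle>u, T u\<rangle> \<ge> \<delta> \<parallel>u\<parallel>\<^sup>2\<close> is of this form up to a positive factor \<open>t\<close>, because \<open>\<parallel>1 - t T\<parallel> < 1\<close> for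
  small \<open>t\<close>.\<close>

lemma state_strictly_positive:
  assumes T: "T \<in> M" "adj T = T" and \<delta>: "\<delta> > 0"
    and pos: "\<And>u. u \<in> ell2_on J \<Longrightarrow> \<delta> * (norm u)\<^sup>2 \<le> Re (cinner u (T u))"
  shows "\<tau> T \<in> \<real>\<^sub>\<ge>\<^sub>0"
proof -
  define N where "N = norm T + \<delta>"
  have N: "N > 0" "norm T \<le> N" "\<delta> \<le> N" using \<delta> by (auto simp: N_def add_nonneg_pos)
  \<comment> \<open>this value minimises the bound \<open>1 - 2 t \<delta> + t\<^sup>2 N\<^sup>2\<close> for \<open>\<parallel>1 - t T\<parallel>\<^sup>2\<close>\<close>
  define t where "t = \<delta> / N\<^sup>2"
  have t: "t > 0" using N \<delta> by (simp add: t_def)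
  define x where "x = id_on J - t *\<^sub>R T"
  define c where "c = 1 - (\<delta> / N)\<^sup>2"
  have c: "0 \<le> c" "c < 1"
    using N \<delta> by (auto simp: c_def power_le_one)
  have bound: "(norm (x u))\<^sup>2 \<le> c * (norm u)\<^sup>2" if u: "u \<in> ell2_on J" for u
  proof -
    have "x u = u - t *\<^sub>R T u"
      using u by (simp add: x_def blinfun.diff_left blinfun.scaleR_left restrict_ell2_eq_iff[symmetric])
    hence "(norm (x u))\<^sup>2 = (norm (u - t *\<^sub>R T u))\<^sup>2" by simp
    also have "\<dots> = (norm u)\<^sup>2 - 2 * t * Re (cinner u (T u)) + t\<^sup>2 * (norm (T u))\<^sup>2"
      using dot_norm_neg[of u "t *\<^sub>R T u"]
      by (simp add: inner_ell2_def cinner_scaleR_right power_mult_distrib field_simps)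
    also have "\<dots> \<le> (norm u)\<^sup>2 - 2 * t * (\<delta> * (norm u)\<^sup>2) + t\<^sup>2 * (N * norm u)\<^sup>2"
      using pos[OF u] t N norm_blinfun[of T u]
      by (intro add_mono diff_mono mult_left_mono power_mono)
        (auto intro: order_trans[OF _ mult_right_mono])
    also have "\<dots> = c * (norm u)\<^sup>2"
      using N by (simp add: c_def t_def field_simps power2_eq_square)
    finally show ?thesis .
  qed
  have "norm x \<le> sqrt c"
  proof (rule norm_blinfun_bound)
    fix u
    have xu: "x u = x (restrict_ell2 J u)"
      using unit_compose(2)[OF T(1)] by (auto simp: x_def blinfun.diff_left blinfun.scaleR_left blinfun_eq_iff)
    have "(norm (x u))\<^sup>2 \<le> c * (norm (restrict_ell2 J u))\<^sup>2" unfolding xu by (rule bound) simp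
    also have "\<dots> \<le> c * (norm u)\<^sup>2"
      using norm_blinfun[of "id_on J" u] mult_right_mono[OF norm_id_on_le[of J] norm_ge_zero[of u]]
      by (intro mult_left_mono power_mono c) auto
    also have "\<dots> = (sqrt c * norm u)\<^sup>2" using c by (simp add: power_mult_distrib)
    finally show "norm (x u) \<le> sqrt c * norm u" by (rule power2_le_imp_le) (use c in simp)
  qed (use c in simp)
  hence "norm x < 1" using c by (smt (verit) real_sqrt_lt_1_iff)
  moreover have "x \<in> M" by (simp add: x_def diff_mem unit_mem scaleR_mem T)
  moreover have "adj x = x"
    by (simp add: x_def adj_diff clinear_scaleR clinear T scaleR_eq_scaleC_op clinear_scaleC_op adj_scaleC)
  ultimately obtain y where y: "y \<in> M" "adj y = y" "y o\<^sub>L y = id_on J - x"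
    using sqrt_exists by blast
  have "\<tau> (t *\<^sub>R T) \<in> \<real>\<^sub>\<ge>\<^sub>0" using state_square[OF y(1)] by (simp add: y x_def)
  hence "complex_of_real (inverse t) * (of_real t * \<tau> T) \<in> \<real>\<^sub>\<ge>\<^sub>0"
    using t by (intro nonneg_Reals_mult_I[of "of_real (inverse t)"]) (simp_all add: state_scaleR T)
  moreover have "complex_of_real (inverse t) * (of_real t * \<tau> T) = \<tau> T"
    using t by (simp add: mult.assoc[symmetric] flip: of_real_mult)
  ultimately show ?thesis by metis
qed

lemma state_positive:
  assumes T: "T \<in> M" "adj T = T"
    and pos: "\<And>u. u \<in> ell2_on J \<Longrightarrow> 0 \<le> Re (cinner u (T u))"
  shows "\<tau> T \<in> \<real>\<^sub>\<ge>\<^sub>0"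
proof -
  have *: "\<tau> T + of_real \<delta> \<in> \<real>\<^sub>\<ge>\<^sub>0" if \<delta>: "\<delta> > 0" for \<delta>
  proof -
    have "\<tau> (T + \<delta> *\<^sub>R id_on J) \<in> \<real>\<^sub>\<ge>\<^sub>0"
    proof (rule state_strictly_positive[OF _ _ \<delta>])
      show "adj (T + \<delta> *\<^sub>R id_on J) = T + \<delta> *\<^sub>R id_on J"
        by (simp add: adj_add clinear T clinear_scaleC_op scaleR_eq_scaleC_op adj_scaleC)
      fix u assume u: "u \<in> ell2_on J"
      show "\<delta> * (norm u)\<^sup>2 \<le> Re (cinner u ((T + \<delta> *\<^sub>R id_on J) u))"
        using pos[OF u] u
        by (simp add: blinfun.add_left blinfun.scaleR_left restrict_ell2_eq_iff[symmetric] cinner_add_right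
            cinner_scaleR_right cinner_self)
    qed (simp add: T add_mem scaleR_mem unit_mem)
    thus ?thesis by (simp add: state_add T scaleR_mem unit_mem state_scaleR state_unit)
  qed
  have "Im (\<tau> T) = 0" using *[of 1] by (simp add: complex_nonneg_Reals_iff)
  moreover have "0 \<le> Re (\<tau> T) + \<delta>" if "\<delta> > 0" for \<delta>
    using *[OF that] by (simp add: complex_nonneg_Reals_iff)
  hence "0 \<le> Re (\<tau> T)" by (rule field_le_epsilon)
  ultimately show ?thesis by (simp add: complex_nonneg_Reals_iff)
qed

text \<open>The sesquilinear form \<open>(S, T) \<mapsto> \<tau> (S\<^sup>* T)\<close> is positive; this gives hermiticity, the
  degenerate case of the Cauchy-Schwarz inequality, and contractivity.\<close>

lemma state_hermitian:
  assumes "T \<in> M" shows "\<tau> (adj T) = cnj (\<tau> T)"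
proof -
  have e: "\<tau> (adj T o\<^sub>L T) + c * \<tau> (adj T) + cnj c * \<tau> T + cnj c * c \<in> \<real>\<^sub>\<ge>\<^sub>0" for c
  proof -
    have "adj (T + scaleC_op c (id_on J)) o\<^sub>L (T + scaleC_op c (id_on J)) =
        (adj T o\<^sub>L T) + scaleC_op c (adj T) + scaleC_op (cnj c) T + scaleC_op (cnj c * c) (id_on J)"
    proof (rule blinfun_eqI)
      fix u
      have "restrict_ell2 J (T u) = T u" "adj T (restrict_ell2 J u) = adj T u"
        using unit_compose[OF assms] unit_compose[OF adj_mem[OF assms]] by (auto simp: blinfun_eq_iff)
      moreover have "restrict_ell2 J (c *\<^sub>C restrict_ell2 J u) = c *\<^sub>C restrict_ell2 J u"
        by (simp add: restrict_ell2_eq_iff ell2_on_scaleC)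
      moreover have "restrict_ell2 J (T u + c *\<^sub>C restrict_ell2 J u) = T u + c *\<^sub>C restrict_ell2 J u"
        by (simp only: id_on_apply[symmetric] blinfun.add_right) (simp add: calculation)
      ultimately show "(adj (T + scaleC_op c (id_on J)) o\<^sub>L (T + scaleC_op c (id_on J))) u =
         ((adj T o\<^sub>L T) + scaleC_op c (adj T) + scaleC_op (cnj c) T + scaleC_op (cnj c * c) (id_on J)) u"
        by (simp add: adj_add clinear assms clinear_scaleC_op adj_scaleC blinfun.add_left blinfun.add_right
            clinear_opD[OF clinear[OF adj_mem[OF assms]]] scaleC_scaleC scaleC_add_right add_ac)
    qed
    moreover have "T + scaleC_op c (id_on J) \<in> M" by (simp add: assms add_mem scaleC_mem unit_mem)
    ultimately show ?thesis
      using state_square[of "T + scaleC_op c (id_on J)"] assms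
      by (simp add: state_add state_scaleC add_mem scaleC_mem adj_mem compose_mem unit_mem state_unit)
  qed
  have "Im (\<tau> (adj T o\<^sub>L T)) = 0" using state_square[OF assms] by (simp add: complex_nonneg_Reals_iff)
  thus ?thesis
    using e[of 1] e[of \<i>] by (simp add: complex_nonneg_Reals_iff complex_eq_iff)
qed

lemma state_cauchy_schwarz_zero:
  assumes S: "S \<in> M" and T: "T \<in> M" and null: "\<tau> (adj S o\<^sub>L S) = 0"
  shows "\<tau> (adj S o\<^sub>L T) = 0"
proof -
  define a where "a = \<tau> (adj S o\<^sub>L T)"
  define m where "m = Re (\<tau> (adj T o\<^sub>L T))"
  have m: "\<tau> (adj T o\<^sub>L T) = of_real m"
    using state_square[OF T] by (simp add: m_def complex_nonneg_Reals_iff complex_eq_iff)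
  have herm: "\<tau> (adj T o\<^sub>L S) = cnj a"
    using state_hermitian[OF compose_mem[OF adj_mem[OF S] T]]
    by (simp add: a_def adj_compose adj_adj clinear adj_mem S T)
  have e: "of_real m + c * cnj a + cnj c * a \<in> \<real>\<^sub>\<ge>\<^sub>0" for c
  proof -
    have "adj (T + scaleC_op c S) o\<^sub>L (T + scaleC_op c S) =
        (adj T o\<^sub>L T) + scaleC_op c (adj T o\<^sub>L S) + scaleC_op (cnj c) (adj S o\<^sub>L T) + scaleC_op (cnj c * c) (adj S o\<^sub>L S)"
      by (rule blinfun_eqI) (simp add: adj_add clinear S T clinear_scaleC_op adj_scaleC blinfun.add_left
            blinfun.add_right clinear_opD[OF clinear[OF adj_mem[OF T]]]
            clinear_opD[OF clinear[OF adj_mem[OF S]]] scaleC_scaleC scaleC_add_right add_ac)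
    moreover have "T + scaleC_op c S \<in> M" by (simp add: S T add_mem scaleC_mem)
    ultimately show ?thesis
      using state_square[of "T + scaleC_op c S"] S T
      by (simp add: state_add state_scaleC add_mem scaleC_mem adj_mem compose_mem null m herm a_def[symmetric])
  qed
  have "0 \<le> m - 2 * r * (cmod a)\<^sup>2" for r
  proof -
    have "complex_of_real m + (- of_real r * a) * cnj a + cnj (- of_real r * a) * a = of_real (m - 2 * r * (cmod a)\<^sup>2)"
      unfolding of_real_diff of_real_mult complex_norm_square by (simp add: algebra_simps)
    thus ?thesis using e[of "- of_real r * a"] by (metis nonneg_Reals_of_real_iff)
  qed
  \<comment> \<open>a real affine function that is bounded below has slope 0\<close>
  from this[of "(m + 1) / (2 * (cmod a)\<^sup>2)"] have "a = 0"
    by (cases "a = 0") (simp_all add: field_simps)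
  thus ?thesis by (simp add: a_def)
qed

text \<open>The variance of \<open>T\<close> gives \<open>\<bar>\<tau> T\<bar>\<^sup>2 \<le> \<tau> (T\<^sup>* T)\<close>, and \<open>\<parallel>T\<parallel>\<^sup>2 - T\<^sup>* T\<close> is positive.\<close>

lemma state_contractive:
  assumes T: "T \<in> M" shows "cmod (\<tau> T) \<le> norm T"
proof -
  define a where "a = \<tau> T"
  define R where "R = T - scaleC_op a (id_on J)"
  define Q where "Q = (norm T)\<^sup>2 *\<^sub>R id_on J - (adj T o\<^sub>L T)"
  have QM: "Q \<in> M" by (simp add: Q_def diff_mem scaleR_mem unit_mem compose_mem adj_mem T)
  have "\<tau> Q \<in> \<real>\<^sub>\<ge>\<^sub>0"
  proof (rule state_positive[OF QM])
    show "adj Q = Q"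
      by (simp add: Q_def adj_diff clinear_scaleC_op clinear_compose adj_mem clinear T
          scaleR_eq_scaleC_op adj_scaleC adj_compose adj_adj)
    fix u assume u: "u \<in> ell2_on J"
    have "(norm (T u))\<^sup>2 \<le> (norm T)\<^sup>2 * (norm u)\<^sup>2"
      using power_mono[OF norm_blinfun[of T u], of 2] by (simp add: power_mult_distrib)
    moreover have "cinner u (Q u) = of_real ((norm T)\<^sup>2 * (norm u)\<^sup>2 - (norm (T u))\<^sup>2)"
      using u by (simp add: Q_def blinfun.diff_left blinfun.scaleR_left restrict_ell2_eq_iff[symmetric]
          cinner_diff_right cinner_scaleR_right cinner_adj_right clinear T cinner_self)
    ultimately show "0 \<le> Re (cinner u (Q u))" by simp
  qed
  hence 1: "Re (\<tau> (adj T o\<^sub>L T)) \<le> (norm T)\<^sup>2"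
    by (simp add: Q_def state_diff state_scaleR T scaleR_mem unit_mem compose_mem adj_mem state_unit
        complex_nonneg_Reals_iff flip: of_real_power)
  have RM: "R \<in> M" by (simp add: R_def diff_mem T scaleC_mem unit_mem)
  have "adj R o\<^sub>L R = (adj T o\<^sub>L R) - scaleC_op (cnj a) R"
    using unit_compose(1)[OF RM]
    by (simp add: blinfun_eq_iff R_def adj_diff T clinear clinear_scaleC_op adj_scaleC blinfun.diff_left)
  hence "\<tau> (adj R o\<^sub>L R) = \<tau> (adj T o\<^sub>L R) - cnj a * \<tau> R"
    by (simp add: state_diff state_scaleC compose_mem adj_mem T RM scaleC_mem)
  moreover have "\<tau> R = 0"
    by (simp add: R_def state_diff T scaleC_mem unit_mem state_scaleC state_unit a_def)
  moreover have "adj T o\<^sub>L R = (adj T o\<^sub>L T) - scaleC_op a (adj T)"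
    using unit_compose(2)[OF adj_mem[OF T]]
    by (simp add: blinfun_eq_iff R_def blinfun.diff_left blinfun.diff_right
        clinear_opD[OF clinear[OF adj_mem[OF T]]])
  ultimately have "\<tau> (adj R o\<^sub>L R) = \<tau> (adj T o\<^sub>L T) - a * cnj a"
    by (simp add: state_diff state_scaleC compose_mem adj_mem T scaleC_mem state_hermitian a_def)
  moreover have "\<tau> (adj R o\<^sub>L R) \<in> \<real>\<^sub>\<ge>\<^sub>0" by (rule state_square[OF RM])
  ultimately have "(cmod a)\<^sup>2 \<le> Re (\<tau> (adj T o\<^sub>L T))"
    by (simp add: complex_nonneg_Reals_iff flip: complex_norm_square of_real_power)
  hence "(cmod a)\<^sup>2 \<le> (norm T)\<^sup>2" using 1 by linarith
  thus ?thesis unfolding a_def by (rule power2_le_imp_le) simp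
qed

end

text \<open>The span of the elementary tensors is a *-algebra; since multiplication, scalar multiplication
  and the adjoint are continuous on the bounded operators, so is its closure.\<close>

lemma cstar_subalgebra_spatial_tensor:
  assumes M: "cstar_subalgebra J M" and N: "cstar_subalgebra K N"
  shows "cstar_subalgebra (J \<times> K) (spatial_tensor M N)"
proof -
  interpret M: cstar_algebra J M by unfold_locales (rule M)
  interpret N: cstar_algebra K N by unfold_locales (rule N)
  define G where "G = {S \<otimes>\<^sub>o T | S T. S \<in> M \<and> T \<in> N}"
  define V where "V = span G"
  have st: "spatial_tensor M N = closure V" by (simp add: spatial_tensor_def V_def G_def)
  have GV: "G \<subseteq> V" unfolding V_def by (rule span_superset)
  have sub: "subspace V" unfolding V_def by simp
  have Gb: "G \<subseteq> bounded_ops (J \<times> K)"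
    by (auto simp: G_def M.bounded N.bounded intro: tensor_op_bounded_ops)
  hence Vb: "V \<subseteq> bounded_ops (J \<times> K)"
    unfolding V_def by (rule span_minimal) (rule subspace_bounded_ops)
  hence cb: "closure V \<subseteq> bounded_ops (J \<times> K)" by (rule closure_minimal) (rule closed_bounded_ops)
  have lin: "clinear_op R" if "R \<in> closure V" for R using cb that by (auto simp: bounded_ops_def)
  have GG: "R o\<^sub>L R' \<in> V" if R: "R \<in> G" and R': "R' \<in> G" for R R'
  proof -
    obtain S T S' T' where "R = S \<otimes>\<^sub>o T" "R' = S' \<otimes>\<^sub>o T'" "S \<in> M" "T \<in> N" "S' \<in> M" "T' \<in> N"
      using R R' by (auto simp: G_def)
    hence "R o\<^sub>L R' \<in> G"
      unfolding G_def using M.compose_mem N.compose_mem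
      by (simp add: tensor_op_compose M.clinear N.clinear) blast
    thus ?thesis using GV by blast
  qed
  have GVc: "R o\<^sub>L R' \<in> V" if R: "R \<in> G" and R': "R' \<in> V" for R R'
    using R'[unfolded V_def]
  proof (rule span_induct)
    show "subspace {R'. R o\<^sub>L R' \<in> V}"
      using sub by (auto simp: subspace_def bounded_bilinear.add_right[OF bounded_bilinear_blinfun_compose]
          bounded_bilinear.scaleR_right[OF bounded_bilinear_blinfun_compose])
  qed (use R GG in auto)
  have VV: "R o\<^sub>L R' \<in> V" if R: "R \<in> V" and R': "R' \<in> V" for R R'
    using R[unfolded V_def]
  proof (rule span_induct)
    show "subspace {R. R o\<^sub>L R' \<in> V}"
      using sub by (auto simp: subspace_def bounded_bilinear.add_left[OF bounded_bilinear_blinfun_compose]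
          bounded_bilinear.scaleR_left[OF bounded_bilinear_blinfun_compose])
  qed (use R' GVc in auto)
  have Vadj: "adj R \<in> V" if R: "R \<in> V" for R
  proof -
    have "V \<subseteq> {R. clinear_op R \<and> adj R \<in> V}"
      unfolding V_def
    proof (rule span_minimal)
      show "subspace {R. clinear_op R \<and> adj R \<in> span G}"
      proof (rule subspaceI)
        have "adj 0 = (0 :: ('a \<times> 'b) op)" by (rule adj_unique) (simp add: cinner_zero_left)
        thus "0 \<in> {R. clinear_op R \<and> adj R \<in> span G}" by (simp add: span_zero)
      next
        fix c R assume "R \<in> {R. clinear_op R \<and> adj R \<in> span G}"
        moreover from this have "adj (c *\<^sub>R R) = c *\<^sub>R adj R"
          by (simp add: scaleR_eq_scaleC_op adj_scaleC)
        ultimately show "c *\<^sub>R R \<in> {R. clinear_op R \<and> adj R \<in> span G}"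
          by (simp add: clinear_scaleR span_scale)
      qed (auto simp: clinear_add adj_add span_add)
      show "G \<subseteq> {R. clinear_op R \<and> adj R \<in> span G}"
      proof
        fix R assume "R \<in> G"
        then obtain S T where "R = S \<otimes>\<^sub>o T" "S \<in> M" "T \<in> N" by (auto simp: G_def)
        hence "clinear_op R" "adj R \<in> G" unfolding G_def
          by (auto simp: tensor_op_adj M.clinear N.clinear tensor_op_clinear intro: M.adj_mem N.adj_mem)
        thus "R \<in> {R. clinear_op R \<and> adj R \<in> span G}" by (simp add: span_base)
      qed
    qed
    thus ?thesis using R by auto
  qed
  have Vsc: "scaleC_op c R \<in> V" if R: "R \<in> V" for R c
    using R[unfolded V_def]
  proof (rule span_induct)
    show "subspace {R. scaleC_op c R \<in> V}"
    proof (rule subspaceI)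
      have "scaleC_op c 0 = (0 :: ('a \<times> 'b) op)" by (rule blinfun_eqI) simp
      thus "0 \<in> {R. scaleC_op c R \<in> V}" using sub by (simp add: subspace_0)
    next
      fix R R' assume "R \<in> {R. scaleC_op c R \<in> V}" "R' \<in> {R. scaleC_op c R \<in> V}"
      moreover have "scaleC_op c (R + R') = scaleC_op c R + scaleC_op c R'"
        by (rule blinfun_eqI) (simp add: blinfun.add_left scaleC_add_right)
      ultimately show "R + R' \<in> {R. scaleC_op c R \<in> V}" using sub by (simp add: subspace_add)
    next
      fix r R assume "R \<in> {R. scaleC_op c R \<in> V}"
      moreover have "scaleC_op c (r *\<^sub>R R) = r *\<^sub>R scaleC_op c R"
        by (rule blinfun_eqI) (simp add: blinfun.scaleR_left scaleR_scaleC scaleC_scaleC mult.commute)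
      ultimately show "r *\<^sub>R R \<in> {R. scaleC_op c R \<in> V}" using sub by (simp add: subspace_scale)
    qed
    fix R assume "R \<in> G"
    then obtain S T where "R = S \<otimes>\<^sub>o T" "S \<in> M" "T \<in> N" by (auto simp: G_def)
    hence "scaleC_op c R \<in> G" unfolding G_def using M.scaleC_mem
      by (auto simp: tensor_op_scaleC_left[symmetric] M.clinear N.clinear)
    thus "scaleC_op c R \<in> V" using GV by blast
  qed
  show ?thesis
    unfolding cstar_subalgebra_def st
  proof (intro conjI ballI allI)
    show "closure V \<subseteq> bounded_ops (J \<times> K)" by (rule cb)
    have "id_on (J \<times> K) \<in> G"
      unfolding G_def tensor_op_id_on[symmetric] using M.unit_mem N.unit_mem by blast
    thus "id_on (J \<times> K) \<in> closure V" using GV closure_subset by blast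
    fix R R' assume R: "R \<in> closure V" and R': "R' \<in> closure V"
    obtain f f' where f: "\<And>n. f n \<in> V" "f \<longlonglongrightarrow> R" and f': "\<And>n. f' n \<in> V" "f' \<longlonglongrightarrow> R'"
      using R R' unfolding closure_sequential by blast
    show "R + R' \<in> closure V"
      unfolding closure_sequential
      by (intro exI[of _ "\<lambda>n. f n + f' n"] conjI allI subspace_add[OF sub] f f' tendsto_add)
    have "(\<lambda>n. f n o\<^sub>L f' n) \<longlonglongrightarrow> (R o\<^sub>L R')"
      by (rule bounded_bilinear.tendsto[OF bounded_bilinear_blinfun_compose f(2) f'(2)])
    thus "R o\<^sub>L R' \<in> closure V"
      unfolding closure_sequential
      by (intro exI[of _ "\<lambda>n. f n o\<^sub>L f' n"] conjI allI VV f f')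
  next
    fix R assume R: "R \<in> closure V"
    then obtain f where f: "\<And>n. f n \<in> V" "f \<longlonglongrightarrow> R" unfolding closure_sequential by blast
    have fl: "clinear_op (f n)" for n using Vb f(1)[of n] by (auto simp: bounded_ops_def)
    have "(\<lambda>n. adj (f n)) \<longlonglongrightarrow> adj R"
    proof (rule Lim_null_comparison[THEN LIM_zero_cancel])
      show "\<forall>\<^sub>F n in sequentially. norm (adj (f n) - adj R) \<le> norm (f n - R)"
        by (simp add: adj_diff[symmetric] fl lin[OF R] norm_adj_le clinear_diff)
      show "(\<lambda>n. norm (f n - R)) \<longlonglongrightarrow> 0" using f(2) by (simp add: LIM_zero tendsto_norm_zero)
    qed
    thus "adj R \<in> closure V"
      unfolding closure_sequential by (intro exI[of _ "\<lambda>n. adj (f n)"] conjI allI Vadj f)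
    fix c
    have "(\<lambda>n. scaleC_op c (f n)) \<longlonglongrightarrow> scaleC_op c R"
    proof (rule Lim_null_comparison[THEN LIM_zero_cancel])
      have "norm (scaleC_op c (f n) - scaleC_op c R) \<le> cmod c * norm (f n - R)" for n
      proof (rule norm_blinfun_bound)
        fix u show "norm ((scaleC_op c (f n) - scaleC_op c R) u) \<le> cmod c * norm (f n - R) * norm u"
          using norm_blinfun[of "f n - R" u]
          by (simp add: blinfun.diff_left scaleC_diff_right[symmetric] mult.assoc mult_left_mono)
      qed simp
      thus "\<forall>\<^sub>F n in sequentially. norm (scaleC_op c (f n) - scaleC_op c R) \<le> cmod c * norm (f n - R)"
        by simp
      show "(\<lambda>n. cmod c * norm (f n - R)) \<longlonglongrightarrow> 0"
        using f(2) by (intro tendsto_mult_right_zero) (simp add: LIM_zero tendsto_norm_zero)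
    qed
    thus "scaleC_op c R \<in> closure V"
      unfolding closure_sequential by (intro exI[of _ "\<lambda>n. scaleC_op c (f n)"] conjI allI Vsc f)
  qed simp
qed

section \<open>Projection-valued measures\<close>

lemma projectionsD:
  assumes "T \<in> projections J"
  shows "T \<in> bounded_ops J" "clinear_op T" "T o\<^sub>L T = T" "adj T = T" "T (T u) = T u"
    "cinner (T u) v = cinner u (T v)"
  using assms selfadjointD[of T]
  by (auto simp: projections_def bounded_ops_def blinfun_eq_iff)

lemma pvm_projection: "pvm_family J X A P \<Longrightarrow> x \<in> X \<Longrightarrow> a \<in> A \<Longrightarrow> P x a \<in> projections J"
  and pvm_sum: "pvm_family J X A P \<Longrightarrow> x \<in> X \<Longrightarrow> (\<Sum>a\<in>A. P x a) = id_on J"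
  by (auto simp: pvm_family_def)

text \<open>For \<open>v\<close> in the range of \<open>P x a'\<close>, the squared norms of the vectors \<open>P x a v\<close> add up to
  \<open>\<parallel>v\<parallel>\<^sup>2\<close>, which is already the contribution of \<open>a'\<close>.\<close>

lemma pvm_orthogonal:
  assumes P: "pvm_family J X A P" and x: "x \<in> X" and "finite A" and a: "a \<in> A" "a' \<in> A" "a \<noteq> a'"
  shows "P x a o\<^sub>L P x a' = 0"
proof (rule blinfun_eqI)
  fix u
  define v where "v = P x a' u"
  note pr = projectionsD[OF pvm_projection[OF P x]]
  have v: "P x a' v = v" "restrict_ell2 J v = v"
    using pr(5)[OF a(2)] pr(1)[OF a(2)] by (auto simp: v_def bounded_ops_def restrict_ell2_eq_iff)
  have "complex_of_real ((norm v)\<^sup>2) = cinner v ((\<Sum>a\<in>A. P x a) v)"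
    by (simp add: pvm_sum[OF P x] v cinner_self)
  also have "\<dots> = (\<Sum>a\<in>A. cinner v (P x a (P x a v)))"
    by (simp add: blinfun_sum_left cinner_sum_right pr(5))
  also have "\<dots> = (\<Sum>a\<in>A. of_real ((norm (P x a v))\<^sup>2))"
    unfolding cinner_self[symmetric] by (intro sum.cong refl) (simp only: pr(6))
  also have "\<dots> = of_real (\<Sum>a\<in>A. (norm (P x a v))\<^sup>2)" by simp
  finally have "(norm v)\<^sup>2 = (\<Sum>a\<in>A. (norm (P x a v))\<^sup>2)" unfolding of_real_eq_iff .
  also have "\<dots> = (norm v)\<^sup>2 + (\<Sum>a\<in>A - {a'}. (norm (P x a v))\<^sup>2)"
    using sum.remove[OF assms(3) a(2), of "\<lambda>a. (norm (P x a v))\<^sup>2"] by (simp add: v)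
  finally have "(\<Sum>a\<in>A - {a'}. (norm (P x a v))\<^sup>2) = 0" by simp
  hence "(norm (P x a v))\<^sup>2 = 0" using assms(3) a by (subst (asm) sum_nonneg_eq_0_iff) auto
  thus "(P x a o\<^sub>L P x a') u = blinfun_apply 0 u" by (simp add: v_def)
qed

text \<open>Direct sums of representations occur twice: the universal representation is one, and so is the
  representation that realises a convex combination of two quantum correlations.\<close>

lemma block_diagonal_projection:
  fixes D :: "('r \<times> 'i) op"
  assumes T: "\<And>r. T r \<in> projections (J r)" and D: "\<And>u r. slice r (blinfun_apply D u) = T r (slice r u)"
  shows "D \<in> projections (Sigma UNIV J)"
proof -
  note pr = projectionsD[OF T]
  have lin: "clinear_op D"
    unfolding clinear_op_def by (intro allI slice_eqI) (simp add: D slice_scaleC clinear_opD pr)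
  have sr: "slice r (restrict_ell2 (Sigma UNIV J) u) = restrict_ell2 (J r) (slice r u)" for r and u :: "('r \<times> 'i) ell2"
    by (rule ell2_eqI) (simp add: slice.rep_eq restrict_ell2.rep_eq)
  have "restrict_ell2 (J r) (T r u) = T r u" "T r (restrict_ell2 (J r) u) = T r u" for r u
    using pr(1)[of r] by (simp_all add: bounded_ops_def restrict_ell2_eq_iff)
  hence "restrict_ell2 (Sigma UNIV J) (D u) = D u" "D (restrict_ell2 (Sigma UNIV J) u) = D u" for u
    by (simp_all add: D sr slice_eqI)
  hence "D \<in> bounded_ops (Sigma UNIV J)" by (simp add: bounded_ops_def lin restrict_ell2_eq_iff)
  moreover have "D o\<^sub>L D = D" by (intro blinfun_eqI slice_eqI) (simp add: D pr)
  moreover have "adj D = D"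
  proof (intro blinfun_eqI slice_eqI cinner_eqI_right)
    fix u r w
    have "cinner w (slice r (adj D u)) = cinner (D (ket r \<otimes>\<^sub>v w)) u"
      by (simp add: cinner_ket_tensor[symmetric] cinner_adj_right lin)
    also have "D (ket r \<otimes>\<^sub>v w) = ket r \<otimes>\<^sub>v T r w"
      by (rule slice_eqI) (simp add: D slice_tensor coord_ket clinear_opD pr)
    also have "cinner \<dots> u = cinner w (slice r (D u))" by (simp add: D cinner_ket_tensor pr)
    finally show "cinner w (slice r (adj D u)) = cinner w (slice r (D u))" .
  qed
  ultimately show ?thesis by (simp add: projections_def)
qed

lemma block_diagonal_pvm:
  assumes P: "\<And>r. pvm_family (J r) X A (P r)"
    and D: "\<And>x a u r. x \<in> X \<Longrightarrow> a \<in> A \<Longrightarrow> slice r (blinfun_apply (D x a) u) = P r x a (slice r u)"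
  shows "pvm_family (Sigma UNIV J) X A D"
  unfolding pvm_family_def
proof (intro ballI conjI)
  fix x assume x: "x \<in> X"
  show "D x a \<in> projections (Sigma UNIV J)" if a: "a \<in> A" for a
    by (rule block_diagonal_projection[of "\<lambda>r. P r x a"])
      (auto simp: D[OF x a] intro: pvm_projection[OF P x a])
  have "slice r ((\<Sum>a\<in>A. D x a) u) = slice r (id_on (Sigma UNIV J) u)" for r u
  proof -
    have "slice r ((\<Sum>a\<in>A. D x a) u) = (\<Sum>a\<in>A. P r x a) (slice r u)"
      by (simp add: blinfun_sum_left slice_sum D[OF x])
    also have "\<dots> = slice r (id_on (Sigma UNIV J) u)"
      unfolding pvm_sum[OF P x] by (rule ell2_eqI) (simp add: slice.rep_eq restrict_ell2.rep_eq)
    finally show ?thesis .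
  qed
  thus "(\<Sum>a\<in>A. D x a) = id_on (Sigma UNIV J)" by (intro blinfun_eqI slice_eqI)
qed

lemma univ_gen_pvm: "pvm_family (univ_index X A) X A (univ_gen X A)"
proof -
  define J where "J r = (if r \<in> univ_reps X A then fst r else {})" for r
  have "pvm_family (Sigma UNIV J) X A (univ_gen X A)"
  proof (rule block_diagonal_pvm)
    fix r
    have "id_on {} = (0 :: nat op)" by (intro blinfun_eqI ell2_eqI) (simp add: restrict_ell2.rep_eq)
    moreover have "(0 :: nat op) \<in> projections {}"
      by (auto simp: projections_def bounded_ops_def cinner_zero_left intro: adj_unique)
    ultimately show "pvm_family (J r) X A (if r \<in> univ_reps X A then snd r else (\<lambda>_ _. 0))"
      by (auto simp: J_def univ_reps_def pvm_family_def)
  qed (auto simp: slice_univ_gen)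
  moreover have "Sigma UNIV J = univ_index X A" by (auto simp: J_def univ_index_def split: if_splits)
  ultimately show ?thesis by simp
qed

lemma univ_gen_mem: "x \<in> X \<Longrightarrow> a \<in> A \<Longrightarrow> univ_gen X A x a \<in> univ_alg X A"
  unfolding univ_alg_def by (rule hull_inc) blast

section \<open>Perfect correlations of imitation games have tracial marginals\<close>

text \<open>The elements that commute with all of \<open>M\<close> under a bounded hermitian functional form a
  C*-algebra, so the trace property only has to be checked for generators. The functional is
  abstract, because it will be the restriction of a state to either tensor factor.\<close>

lemma trace_on_hull:
  assumes M: "M = cstar_subalgebra J hull G" and "G \<subseteq> bounded_ops J"
    and add: "\<And>S T. S \<in> M \<Longrightarrow> T \<in> M \<Longrightarrow> \<sigma> (S + T) = \<sigma> S + \<sigma> T"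
    and scale: "\<And>c T. T \<in> M \<Longrightarrow> \<sigma> (scaleC_op c T) = c * \<sigma> T"
    and herm: "\<And>T. T \<in> M \<Longrightarrow> \<sigma> (adj T) = cnj (\<sigma> T)"
    and contr: "\<And>T. T \<in> M \<Longrightarrow> cmod (\<sigma> T) \<le> norm T"
    and gen: "\<And>g Z. g \<in> G \<Longrightarrow> Z \<in> M \<Longrightarrow> \<sigma> (g o\<^sub>L Z) = \<sigma> (Z o\<^sub>L g)"
    and S: "S \<in> M" and T: "T \<in> M"
  shows "\<sigma> (S o\<^sub>L T) = \<sigma> (T o\<^sub>L S)"
proof -
  have cM: "cstar_subalgebra J M" unfolding M by (rule cstar_subalgebra_hull[OF assms(2)])
  interpret M: cstar_algebra J M by unfold_locales (rule cM)
  have diff: "\<sigma> (S - T) = \<sigma> S - \<sigma> T" if "S \<in> M" "T \<in> M" for S T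
    using add[OF M.diff_mem[OF that] that(2)] by simp
  have lim: "(\<lambda>n. \<sigma> (f n)) \<longlonglongrightarrow> \<sigma> R" if "\<And>n. f n \<in> M" "R \<in> M" "f \<longlonglongrightarrow> R" for f R
  proof (rule Lim_null_comparison[THEN LIM_zero_cancel])
    show "\<forall>\<^sub>F n in sequentially. norm (\<sigma> (f n) - \<sigma> R) \<le> norm (f n - R)"
      using that by (simp add: diff[symmetric] contr M.diff_mem)
    show "(\<lambda>n. norm (f n - R)) \<longlonglongrightarrow> 0" using that(3) by (simp add: LIM_zero tendsto_norm_zero)
  qed
  define C where "C = {S \<in> M. \<forall>Z\<in>M. \<sigma> (S o\<^sub>L Z) = \<sigma> (Z o\<^sub>L S)}"
  note comp_add = bounded_bilinear.add_left[OF bounded_bilinear_blinfun_compose]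
      bounded_bilinear.add_right[OF bounded_bilinear_blinfun_compose]
  have "cstar_subalgebra J C"
    unfolding cstar_subalgebra_def
  proof (intro conjI ballI allI)
    show "C \<subseteq> bounded_ops J" using M.bounded by (auto simp: C_def)
    show "id_on J \<in> C" by (simp add: C_def M.unit_mem)
    fix S S' assume S: "S \<in> C" and S': "S' \<in> C"
    show "S + S' \<in> C" using S S' by (simp add: C_def M.add_mem comp_add add M.compose_mem)
    have "\<sigma> ((S o\<^sub>L S') o\<^sub>L Z) = \<sigma> (Z o\<^sub>L (S o\<^sub>L S'))" if Z: "Z \<in> M" for Z
    proof -
      have "\<sigma> ((S o\<^sub>L S') o\<^sub>L Z) = \<sigma> (S o\<^sub>L (S' o\<^sub>L Z))" by (simp add: blinfun_compose_assoc)
      also have "\<dots> = \<sigma> (S' o\<^sub>L (Z o\<^sub>L S))"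
        using S S' Z by (simp add: C_def M.compose_mem blinfun_compose_assoc)
      also have "\<dots> = \<sigma> (Z o\<^sub>L (S o\<^sub>L S'))"
        using S S' Z by (simp add: C_def M.compose_mem blinfun_compose_assoc)
      finally show ?thesis .
    qed
    thus "S o\<^sub>L S' \<in> C" using S S' by (simp add: C_def M.compose_mem)
  next
    fix S c assume S: "S \<in> C"
    have "\<sigma> (adj S o\<^sub>L Z) = \<sigma> (Z o\<^sub>L adj S)" if Z: "Z \<in> M" for Z
    proof -
      have "adj S o\<^sub>L Z = adj (adj Z o\<^sub>L S)" "Z o\<^sub>L adj S = adj (S o\<^sub>L adj Z)"
        using S Z by (simp_all add: C_def adj_compose adj_adj M.clinear M.adj_mem)
      moreover have "\<sigma> (adj Z o\<^sub>L S) = \<sigma> (S o\<^sub>L adj Z)" using S Z by (simp add: C_def M.adj_mem)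
      ultimately show ?thesis using S Z by (simp add: C_def herm M.compose_mem M.adj_mem)
    qed
    thus "adj S \<in> C" using S by (simp add: C_def M.adj_mem)
    have "\<sigma> (scaleC_op c S o\<^sub>L Z) = \<sigma> (Z o\<^sub>L scaleC_op c S)" if Z: "Z \<in> M" for Z
    proof -
      have "scaleC_op c S o\<^sub>L Z = scaleC_op c (S o\<^sub>L Z)" "Z o\<^sub>L scaleC_op c S = scaleC_op c (Z o\<^sub>L S)"
        using clinear_opD[OF M.clinear[OF Z]] by (simp_all add: blinfun_eq_iff)
      thus ?thesis using S Z by (simp add: C_def scale M.compose_mem)
    qed
    thus "scaleC_op c S \<in> C" using S by (simp add: C_def M.scaleC_mem)
  next
    show "closed C"
      unfolding closed_sequential_limits
    proof (intro allI impI)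
      fix f R assume *: "(\<forall>n. f n \<in> C) \<and> f \<longlonglongrightarrow> R"
      hence f: "\<And>n. f n \<in> M" "f \<longlonglongrightarrow> R" by (auto simp: C_def)
      have R: "R \<in> M" using M.closed_alg f unfolding closed_sequential_limits by blast
      have "\<sigma> (R o\<^sub>L Z) = \<sigma> (Z o\<^sub>L R)" if Z: "Z \<in> M" for Z
      proof (rule LIMSEQ_unique)
        show "(\<lambda>n. \<sigma> (f n o\<^sub>L Z)) \<longlonglongrightarrow> \<sigma> (R o\<^sub>L Z)"
          by (intro lim M.compose_mem f R Z bounded_bilinear.tendsto[OF bounded_bilinear_blinfun_compose] tendsto_const)
        have "(\<lambda>n. \<sigma> (Z o\<^sub>L f n)) \<longlonglongrightarrow> \<sigma> (Z o\<^sub>L R)"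
          by (intro lim M.compose_mem f R Z bounded_bilinear.tendsto[OF bounded_bilinear_blinfun_compose] tendsto_const)
        thus "(\<lambda>n. \<sigma> (f n o\<^sub>L Z)) \<longlonglongrightarrow> \<sigma> (Z o\<^sub>L R)" using * Z by (simp add: C_def)
      qed
      thus "R \<in> C" using R by (simp add: C_def)
    qed
  qed
  moreover have "G \<subseteq> C" unfolding C_def M using gen[unfolded M] by (auto intro: hull_inc)
  ultimately have "M \<subseteq> C" unfolding M by (intro hull_minimal) auto
  thus ?thesis using S T by (auto simp: C_def)
qed

context cstar_state
begin

text \<open>With \<open>1 = (\<Sum>b. g b)\<close>, where the \<open>g b\<close> commute with everything else, \<open>E Z E'\<close> is the sum of the
  products \<open>(g b E)\<^sup>* (Z g b E')\<close>. Since \<open>(g b E)\<^sup>* (g b E) = E g b\<close>, one of \<open>g b E\<close> and \<open>g b E'\<close> is a null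
  vector for \<open>\<tau>\<close>; the Cauchy-Schwarz inequality applies to the product or to its adjoint.\<close>

lemma off_diagonal_zero:
  assumes E: "E \<in> M" "E \<in> projections J" and E': "E' \<in> M" "E' \<in> projections J" and Z: "Z \<in> M"
    and g: "\<And>b. b \<in> B \<Longrightarrow> g b \<in> M" "\<And>b. b \<in> B \<Longrightarrow> g b \<in> projections J"
    and sum: "(\<Sum>b\<in>B. g b) = id_on J"
    and comm: "\<And>b. b \<in> B \<Longrightarrow> g b o\<^sub>L E = E o\<^sub>L g b" "\<And>b. b \<in> B \<Longrightarrow> g b o\<^sub>L E' = E' o\<^sub>L g b"
      "\<And>b. b \<in> B \<Longrightarrow> g b o\<^sub>L Z = Z o\<^sub>L g b"
    and zero: "\<And>b. b \<in> B \<Longrightarrow> \<tau> (E o\<^sub>L g b) = 0 \<or> \<tau> (E' o\<^sub>L g b) = 0"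
  shows "\<tau> (E o\<^sub>L (Z o\<^sub>L E')) = 0"
proof -
  have term0: "\<tau> (E o\<^sub>L (Z o\<^sub>L (g b o\<^sub>L E'))) = 0" if b: "b \<in> B" for b
  proof -
    note [simp] = E(1) E'(1) Z g(1)[OF b] compose_mem adj_mem clinear adj_compose adj_adj
      projectionsD(4)[OF E(2)] projectionsD(4)[OF E'(2)] projectionsD(4)[OF g(2)[OF b]]
    note idem = projectionsD(5)[OF E(2)] projectionsD(5)[OF E'(2)] projectionsD(5)[OF g(2)[OF b]]
    have c: "g b (E u) = E (g b u)" "g b (E' u) = E' (g b u)" "g b (Z u) = Z (g b u)" for u
      using comm[OF b] by (simp_all add: blinfun_eq_iff)
    have cz: "g b (adj Z u) = adj Z (g b u)" for u
      using arg_cong[OF comm(3)[OF b], of adj] by (simp add: blinfun_eq_iff)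
    consider "\<tau> (E o\<^sub>L g b) = 0" | "\<tau> (E' o\<^sub>L g b) = 0" using zero[OF b] by blast
    thus ?thesis
    proof cases
      case 1
      have "adj (g b o\<^sub>L E) o\<^sub>L (g b o\<^sub>L E) = E o\<^sub>L g b" by (simp add: blinfun_eq_iff c idem)
      hence "\<tau> (adj (g b o\<^sub>L E) o\<^sub>L (Z o\<^sub>L (g b o\<^sub>L E'))) = 0"
        using 1 by - (rule state_cauchy_schwarz_zero, auto simp del: adj_compose)
      moreover have "adj (g b o\<^sub>L E) o\<^sub>L (Z o\<^sub>L (g b o\<^sub>L E')) = E o\<^sub>L (Z o\<^sub>L (g b o\<^sub>L E'))"
        by (simp add: blinfun_eq_iff c idem)
      ultimately show ?thesis by (simp del: adj_compose)
    next
      case 2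
      have "adj (g b o\<^sub>L E') o\<^sub>L (g b o\<^sub>L E') = E' o\<^sub>L g b" by (simp add: blinfun_eq_iff c idem)
      hence "\<tau> (adj (g b o\<^sub>L E') o\<^sub>L (adj Z o\<^sub>L E)) = 0"
        using 2 by - (rule state_cauchy_schwarz_zero, auto simp del: adj_compose)
      moreover have "adj (g b o\<^sub>L E') o\<^sub>L (adj Z o\<^sub>L E) = adj (E o\<^sub>L (Z o\<^sub>L (g b o\<^sub>L E')))"
        by (simp add: blinfun_eq_iff)
      ultimately have "cnj (\<tau> (E o\<^sub>L (Z o\<^sub>L (g b o\<^sub>L E')))) = 0"
        by (simp add: state_hermitian[symmetric] del: adj_compose)
      thus ?thesis by simp
    qed
  qed
  have "E o\<^sub>L (Z o\<^sub>L E') = E o\<^sub>L (Z o\<^sub>L ((\<Sum>b\<in>B. g b) o\<^sub>L E'))" using E' by (simp add: sum)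
  also have "\<dots> = (\<Sum>b\<in>B. E o\<^sub>L (Z o\<^sub>L (g b o\<^sub>L E')))"
    by (simp add: blinfun_eq_iff blinfun_sum_left blinfun.sum_right)
  finally show ?thesis
    by (simp add: state_sum compose_mem E E' Z g term0)
qed

text \<open>Alice's and Bob's parts are the two instances of this lemma: \<open>\<pi>\<close> is the embedding of one tensor
  factor and \<open>g\<close> are the measurements of the other player. The vanishing of the off-diagonal terms
  turns \<open>\<tau> (e Z)\<close> and \<open>\<tau> (Z e)\<close> into \<open>\<tau> (e Z e)\<close>.\<close>

lemma tracial_on_commuting_image:
  fixes \<pi> :: "(('x, 'a) rep \<times> nat) op \<Rightarrow> 'i op"
  assumes hom: "unital_star_hom (univ_index X A) (univ_alg X A) J \<pi>"
    and mem: "\<And>S. S \<in> univ_alg X A \<Longrightarrow> \<pi> S \<in> M"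
    and contr: "\<And>S. S \<in> univ_alg X A \<Longrightarrow> norm (\<pi> S) \<le> norm S"
    and fin: "finite A" "finite B"
    and g: "pvm_family J Y B g" "\<And>y b. y \<in> Y \<Longrightarrow> b \<in> B \<Longrightarrow> g y b \<in> M"
    and comm: "\<And>y b S. y \<in> Y \<Longrightarrow> b \<in> B \<Longrightarrow> S \<in> univ_alg X A \<Longrightarrow> g y b o\<^sub>L \<pi> S = \<pi> S o\<^sub>L g y b"
    and sep: "\<And>x a a'. x \<in> X \<Longrightarrow> a \<in> A \<Longrightarrow> a' \<in> A \<Longrightarrow> a \<noteq> a' \<Longrightarrow> \<exists>y\<in>Y. \<forall>b\<in>B.
      \<tau> (\<pi> (univ_gen X A x a) o\<^sub>L g y b) = 0 \<or> \<tau> (\<pi> (univ_gen X A x a') o\<^sub>L g y b) = 0"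
  shows "tracial_on (\<pi> ` univ_alg X A) \<tau>"
proof -
  let ?N = "univ_alg X A" and ?I = "univ_index X A"
  interpret N: cstar_algebra ?I ?N by unfold_locales (rule cstar_subalgebra_univ_alg)
  have \<pi>_add: "\<pi> (S + T) = \<pi> S + \<pi> T" and \<pi>_compose: "\<pi> (S o\<^sub>L T) = \<pi> S o\<^sub>L \<pi> T"
    if "S \<in> ?N" "T \<in> ?N" for S T using hom that by (auto simp: unital_star_hom_def)
  have \<pi>_adj: "\<pi> (adj T) = adj (\<pi> T)" and \<pi>_scale: "\<pi> (scaleC_op c T) = scaleC_op c (\<pi> T)"
    if "T \<in> ?N" for T c using hom that by (auto simp: unital_star_hom_def)
  have \<pi>_unit: "\<pi> (id_on ?I) = id_on J" using hom by (simp add: unital_star_hom_def)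
  have \<pi>_zero: "\<pi> 0 = 0" using \<pi>_add[OF N.zero_mem N.zero_mem] by simp
  have \<pi>_sum: "\<pi> (sum f F) = (\<Sum>i\<in>F. \<pi> (f i))" if "\<And>i. i \<in> F \<Longrightarrow> f i \<in> ?N" for f :: "'a \<Rightarrow> _" and F
    using that by (induction F rule: infinite_finite_induct) (simp_all add: \<pi>_zero \<pi>_add N.sum_mem)
  define e where "e x a = \<pi> (univ_gen X A x a)" for x a
  have eM: "e x a \<in> M" and epr: "e x a \<in> projections J" if "x \<in> X" "a \<in> A" for x a
  proof -
    note u = univ_gen_mem[OF that] and pr = projectionsD[OF pvm_projection[OF univ_gen_pvm that]]
    show "e x a \<in> M" by (simp add: e_def mem u)
    thus "e x a \<in> projections J"
      using \<pi>_compose[OF u u] \<pi>_adj[OF u] pr bounded by (simp add: projections_def e_def)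
  qed
  have esum: "(\<Sum>a\<in>A. e x a) = id_on J" if "x \<in> X" for x
    unfolding e_def \<pi>_unit[symmetric] pvm_sum[OF univ_gen_pvm that, symmetric]
    by (rule \<pi>_sum[symmetric]) (rule univ_gen_mem[OF that])
  have ecomm: "g y b o\<^sub>L e x a = e x a o\<^sub>L g y b" if "x \<in> X" "a \<in> A" "y \<in> Y" "b \<in> B" for x a y b
    unfolding e_def by (rule comm[OF that(3,4) univ_gen_mem[OF that(1,2)]])
  have off: "\<tau> (e x a o\<^sub>L (\<pi> Z o\<^sub>L e x a')) = 0"
    if x: "x \<in> X" and a: "a \<in> A" "a' \<in> A" "a \<noteq> a'" and Z: "Z \<in> ?N" for x a a' Z
  proof -
    obtain y where y: "y \<in> Y" and z: "\<And>b. b \<in> B \<Longrightarrow> \<tau> (e x a o\<^sub>L g y b) = 0 \<or> \<tau> (e x a' o\<^sub>L g y b) = 0"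
      using sep[OF x a] unfolding e_def by blast
    show ?thesis
      by (rule off_diagonal_zero[where g = "g y" and B = B])
        (use z in \<open>auto simp: eM epr x a mem Z g y pvm_projection[OF g(1)] pvm_sum[OF g(1)] comm ecomm\<close>)
  qed
  have gen: "\<tau> (\<pi> (E o\<^sub>L Z)) = \<tau> (\<pi> (Z o\<^sub>L E))"
    if E: "E \<in> {univ_gen X A x a | x a. x \<in> X \<and> a \<in> A}" and Z: "Z \<in> ?N" for E Z
  proof -
    obtain x a where xa: "x \<in> X" "a \<in> A" "E = univ_gen X A x a" using E by blast
    have EN: "E \<in> ?N" by (simp add: xa univ_gen_mem)
    have \<pi>Z: "\<pi> Z \<in> M" by (rule mem[OF Z])
    have "e x a o\<^sub>L \<pi> Z = e x a o\<^sub>L (\<pi> Z o\<^sub>L (\<Sum>a'\<in>A. e x a'))"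
      using \<pi>Z by (simp add: esum xa)
    also have "\<dots> = (\<Sum>a'\<in>A. e x a o\<^sub>L (\<pi> Z o\<^sub>L e x a'))"
      by (simp add: blinfun_eq_iff blinfun_sum_left blinfun.sum_right)
    finally have "\<tau> (e x a o\<^sub>L \<pi> Z) = (\<Sum>a'\<in>A. \<tau> (e x a o\<^sub>L (\<pi> Z o\<^sub>L e x a')))"
      by (simp add: state_sum compose_mem eM xa \<pi>Z)
    also have "\<dots> = \<tau> (e x a o\<^sub>L (\<pi> Z o\<^sub>L e x a))"
      using off[OF xa(1,2) _ _ Z] by (subst sum.remove[OF fin(1) xa(2)]) (auto intro!: sum.neutral)
    also have "\<dots> = (\<Sum>a'\<in>A. \<tau> (e x a' o\<^sub>L (\<pi> Z o\<^sub>L e x a)))"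
      using off[OF xa(1) _ xa(2) _ Z] by (subst sum.remove[OF fin(1) xa(2)]) (auto intro!: sum.neutral)
    also have "\<dots> = \<tau> (\<Sum>a'\<in>A. e x a' o\<^sub>L (\<pi> Z o\<^sub>L e x a))"
      by (simp add: state_sum compose_mem eM xa \<pi>Z)
    also have "(\<Sum>a'\<in>A. e x a' o\<^sub>L (\<pi> Z o\<^sub>L e x a)) = (\<Sum>a'\<in>A. e x a') o\<^sub>L (\<pi> Z o\<^sub>L e x a)"
      by (simp add: blinfun_eq_iff blinfun_sum_left)
    also have "\<dots> = \<pi> Z o\<^sub>L e x a" by (simp add: esum xa compose_mem eM \<pi>Z)
    finally show ?thesis by (simp add: \<pi>_compose EN Z) (simp add: xa e_def)
  qed
  have "\<tau> (\<pi> (S o\<^sub>L T)) = \<tau> (\<pi> (T o\<^sub>L S))" if "S \<in> ?N" "T \<in> ?N" for S T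
  proof (rule trace_on_hull[OF univ_alg_def, where \<sigma> = "\<lambda>S. \<tau> (\<pi> S)"])
    show "{univ_gen X A x a | x a. x \<in> X \<and> a \<in> A} \<subseteq> bounded_ops ?I"
      by (auto intro: univ_gen_bounded_ops)
    show "cmod (\<tau> (\<pi> T)) \<le> norm T" if "T \<in> ?N" for T
      using state_contractive[OF mem[OF that]] contr[OF that] by simp
  qed (use that gen in \<open>auto simp: \<pi>_add \<pi>_scale \<pi>_adj mem state_add state_scaleC state_hermitian\<close>)
  thus ?thesis by (auto simp: tracial_on_def \<pi>_compose)
qed

end

lemma tensor_mem_spatial: "S \<in> M \<Longrightarrow> T \<in> N \<Longrightarrow> S \<otimes>\<^sub>o T \<in> spatial_tensor M N"
  unfolding spatial_tensor_def by (rule subsetD[OF closure_subset], rule span_base) blast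

lemma pvm_tensor_id:
  assumes "pvm_family J X A P"
  shows "pvm_family (J \<times> K) X A (\<lambda>x a. P x a \<otimes>\<^sub>o id_on K)"
proof -
  have id: "id_on K o\<^sub>L id_on K = id_on K" by (simp add: blinfun_eq_iff)
  have "id_on K \<in> bounded_ops K" by (simp add: bounded_ops_iff_id_on id)
  thus ?thesis
    using projectionsD[OF pvm_projection[OF assms]] pvm_sum[OF assms]
    unfolding pvm_family_def
    by (auto simp: projections_def tensor_op_bounded_ops tensor_op_compose tensor_op_adj id
        tensor_op_sum_left[symmetric] tensor_op_id_on)
qed

lemma pvm_id_tensor:
  assumes "pvm_family K Y B Q"
  shows "pvm_family (J \<times> K) Y B (\<lambda>y b. id_on J \<otimes>\<^sub>o Q y b)"
proof -
  have id: "id_on J o\<^sub>L id_on J = id_on J" by (simp add: blinfun_eq_iff)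
  have "id_on J \<in> bounded_ops J" by (simp add: bounded_ops_iff_id_on id)
  thus ?thesis
    using projectionsD[OF pvm_projection[OF assms]] pvm_sum[OF assms]
    unfolding pvm_family_def
    by (auto simp: projections_def tensor_op_bounded_ops tensor_op_compose tensor_op_adj id
        tensor_op_sum_right[symmetric] tensor_op_id_on)
qed

text \<open>The defining conditions of an imitation game say that two different answers of one player can
  be told apart by a question to the other player: no answer to it is accepted with both.\<close>

theorem perfect_state_tracial:
  fixes X :: "'x set" and Y :: "'y set" and A :: "'a set" and B :: "'b set"
  assumes game: "imitation_game X Y A B lam" and p: "p \<in> C_ns_game X Y A B lam"
    and state: "state_on (univ_index X A \<times> univ_index Y B) (spatial_tensor (univ_alg X A) (univ_alg Y B)) \<tau>"
    and p\<tau>: "\<And>x y a b. x \<in> X \<Longrightarrow> y \<in> Y \<Longrightarrow> a \<in> A \<Longrightarrow> b \<in> B \<Longrightarrow>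
        complex_of_real (p (x, y, a, b)) = \<tau> (univ_gen X A x a \<otimes>\<^sub>o univ_gen Y B y b)"
  shows "tracial_on {S \<otimes>\<^sub>o id_on (univ_index Y B) | S. S \<in> univ_alg X A} \<tau>"
    and "tracial_on {id_on (univ_index X A) \<otimes>\<^sub>o T | T. T \<in> univ_alg Y B} \<tau>"
proof -
  let ?M = "univ_alg X A" and ?N = "univ_alg Y B" and ?I = "univ_index X A" and ?J = "univ_index Y B"
  have fin: "finite A" "finite B" using game by (auto simp: imitation_game_def nonlocal_game_def)
  interpret M: cstar_algebra ?I ?M by unfold_locales (rule cstar_subalgebra_univ_alg)
  interpret N: cstar_algebra ?J ?N by unfold_locales (rule cstar_subalgebra_univ_alg)
  interpret cstar_state "?I \<times> ?J" "spatial_tensor ?M ?N" \<tau>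
    by unfold_locales (intro cstar_subalgebra_spatial_tensor cstar_subalgebra_univ_alg state)+
  note [simp] = M.clinear N.clinear univ_gen_mem tensor_op_compose M.unit_mem N.unit_mem M.compose_mem
    N.compose_mem
  have zero: "\<tau> (univ_gen X A x a \<otimes>\<^sub>o univ_gen Y B y b) = 0"
    if "lam (x, y, a, b) = 0" "x \<in> X" "y \<in> Y" "a \<in> A" "b \<in> B" for x y a b
    using that p by (simp add: p\<tau>[symmetric] C_ns_game_def)
  have contr: "norm (S \<otimes>\<^sub>o T) \<le> norm S * norm T" if "S \<in> ?M" "T \<in> ?N" for S T
    using that by (intro norm_tensor_op_le) auto
  show "tracial_on {S \<otimes>\<^sub>o id_on ?J | S. S \<in> ?M} \<tau>"
    unfolding setcompr_eq_image Collect_mem_eq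
  proof (rule tracial_on_commuting_image[where g = "\<lambda>y b. id_on ?I \<otimes>\<^sub>o univ_gen Y B y b" and Y = Y and B = B])
    show "unital_star_hom ?I ?M (?I \<times> ?J) (\<lambda>S. S \<otimes>\<^sub>o id_on ?J)"
      using N.unit_compose(1)[OF N.unit_mem]
      by (auto simp: unital_star_hom_def tensor_op_bounded_ops M.bounded N.bounded tensor_op_adj
          tensor_op_scaleC_left tensor_op_add_left tensor_op_id_on)
    show "norm (S \<otimes>\<^sub>o id_on ?J) \<le> norm S" if "S \<in> ?M" for S
      using contr[OF that N.unit_mem] mult_left_mono[OF norm_id_on_le[of ?J] norm_ge_zero[of S]] by simp
    fix x a a' assume x: "x \<in> X" and a: "a \<in> A" "a' \<in> A" "a \<noteq> a'"
    then obtain y where y: "y \<in> Y" "(\<Sum>b\<in>B. lam (x, y, a, b) * lam (x, y, a', b)) = 0"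
      using game unfolding imitation_game_def by blast
    hence "lam (x, y, a, b) = 0 \<or> lam (x, y, a', b) = 0" if "b \<in> B" for b using that fin by simp
    thus "\<exists>y\<in>Y. \<forall>b\<in>B. \<tau> ((univ_gen X A x a \<otimes>\<^sub>o id_on ?J) o\<^sub>L (id_on ?I \<otimes>\<^sub>o univ_gen Y B y b)) = 0 \<or>
        \<tau> ((univ_gen X A x a' \<otimes>\<^sub>o id_on ?J) o\<^sub>L (id_on ?I \<otimes>\<^sub>o univ_gen Y B y b)) = 0"
      using x a y(1) by (intro bexI[of _ y] ballI) (simp, blast intro: zero, simp)
  qed (use fin in \<open>auto intro!: tensor_mem_spatial pvm_id_tensor univ_gen_pvm\<close>)
  show "tracial_on {id_on ?I \<otimes>\<^sub>o T | T. T \<in> ?N} \<tau>"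
    unfolding setcompr_eq_image Collect_mem_eq
  proof (rule tracial_on_commuting_image[where g = "\<lambda>x a. univ_gen X A x a \<otimes>\<^sub>o id_on ?J" and Y = X and B = A])
    show "unital_star_hom ?J ?N (?I \<times> ?J) (\<lambda>T. id_on ?I \<otimes>\<^sub>o T)"
      using M.unit_compose(1)[OF M.unit_mem]
      by (auto simp: unital_star_hom_def tensor_op_bounded_ops M.bounded N.bounded tensor_op_adj
          tensor_op_scaleC_right tensor_op_add_right tensor_op_id_on)
    show "norm (id_on ?I \<otimes>\<^sub>o T) \<le> norm T" if "T \<in> ?N" for T
      using contr[OF M.unit_mem that] mult_right_mono[OF norm_id_on_le[of ?I] norm_ge_zero[of T]] by simp
    fix y b b' assume y: "y \<in> Y" and b: "b \<in> B" "b' \<in> B" "b \<noteq> b'"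
    obtain x where x: "x \<in> X" "(\<Sum>a\<in>A. lam (x, y, a, b) * lam (x, y, a, b')) = 0"
      using game[unfolded imitation_game_def, THEN conjunct2, THEN conjunct2, rule_format, OF y b] by blast
    hence "lam (x, y, a, b) = 0 \<or> lam (x, y, a, b') = 0" if "a \<in> A" for a using that fin by simp
    thus "\<exists>x\<in>X. \<forall>a\<in>A. \<tau> ((id_on ?I \<otimes>\<^sub>o univ_gen Y B y b) o\<^sub>L (univ_gen X A x a \<otimes>\<^sub>o id_on ?J)) = 0 \<or>
        \<tau> ((id_on ?I \<otimes>\<^sub>o univ_gen Y B y b') o\<^sub>L (univ_gen X A x a \<otimes>\<^sub>o id_on ?J)) = 0"
      using y b x(1) by (intro bexI[of _ x] ballI) (simp, blast intro: zero, simp)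
  qed (use fin in \<open>auto intro!: tensor_mem_spatial pvm_tensor_id univ_gen_pvm\<close>)
qed

section \<open>Compression of projection-valued measures to finite dimension\<close>

definition orthonormal_system :: "nat \<Rightarrow> (nat \<Rightarrow> 'i ell2) \<Rightarrow> bool"
  where "orthonormal_system n b \<longleftrightarrow> (\<forall>i<n. \<forall>j<n. cinner (b i) (b j) = (if i = j then 1 else 0))"

text \<open>For an orthonormal system, \<open>synthesis\<close> is an isometry of \<open>\<complex>\<^sup>n\<close> onto its span and
  \<open>analysis\<close> is the adjoint of this isometry.\<close>

definition synthesis :: "nat \<Rightarrow> (nat \<Rightarrow> 'i ell2) \<Rightarrow> nat ell2 \<Rightarrow>\<^sub>L 'i ell2"
  where "synthesis n b = Blinfun (\<lambda>u. \<Sum>j<n. coord u j *\<^sub>C b j)"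

definition analysis :: "nat \<Rightarrow> (nat \<Rightarrow> 'i ell2) \<Rightarrow> 'i ell2 \<Rightarrow>\<^sub>L nat ell2"
  where "analysis n b = Blinfun (\<lambda>v. \<Sum>j<n. cinner (b j) v *\<^sub>C ket j)"

lemma bounded_linear_functional_scaleC:
  assumes "bounded_linear f" shows "bounded_linear (\<lambda>u. f u *\<^sub>C (v :: 'i ell2))"
proof -
  have "bounded_linear (\<lambda>c. c *\<^sub>C v)"
    by (rule bounded_linear_intro[of _ "norm v"]) (auto intro!: ell2_eqI simp: algebra_simps scaleR_conv_of_real)
  thus ?thesis by (rule bounded_linear_compose[OF _ assms])
qed

lemma bounded_linear_coord: "bounded_linear (\<lambda>u. coord u i)"
  unfolding coord_cinner_ket by (rule bounded_linear_cinner_right)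

lemma synthesis_apply: "synthesis n b u = (\<Sum>j<n. coord u j *\<^sub>C b j)"
  unfolding synthesis_def
  by (subst bounded_linear_Blinfun_apply)
     (intro bounded_linear_sum bounded_linear_functional_scaleC bounded_linear_coord refl)+

lemma analysis_apply: "analysis n b v = (\<Sum>j<n. cinner (b j) v *\<^sub>C ket j)"
  unfolding analysis_def
  by (subst bounded_linear_Blinfun_apply)
     (intro bounded_linear_sum bounded_linear_functional_scaleC bounded_linear_cinner_right refl)+

lemma cinner_analysis: "cinner (analysis n b v) u = cinner v (synthesis n b u)"
  by (simp add: analysis_apply synthesis_apply cinner_sum_left cinner_sum_right cinner_scaleC_left
      cinner_scaleC_right cinner_ket_left cinner_commute[of v, symmetric] mult.commute)

lemma cinner_analysis_right: "cinner u (analysis n b v) = cinner (synthesis n b u) v"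
  by (metis cinner_analysis cinner_commute)

lemma clinear_synthesis: "clinear_op (synthesis n b)"
  by (simp add: clinear_op_def synthesis_apply scaleC_sum_right scaleC_scaleC)

lemma clinear_analysis: "clinear_op (analysis n b)"
  by (simp add: clinear_op_def analysis_apply cinner_scaleC_right scaleC_sum_right scaleC_scaleC)

lemma analysis_in_ell2_on: "analysis n b v \<in> ell2_on {..<n}"
  by (simp add: ell2_on_def analysis_apply coord_ket)

lemma analysis_synthesis:
  assumes "orthonormal_system n b"
  shows "analysis n b (synthesis n b u) = restrict_ell2 {..<n} u"
proof (rule ell2_eqI)
  fix i
  have "coord (analysis n b (synthesis n b u)) i = (\<Sum>j<n. cinner (b j) (synthesis n b u) * (if i = j then 1 else 0))"
    by (simp add: analysis_apply coord_ket)
  also have "\<dots> = (if i < n then cinner (b i) (synthesis n b u) else 0)"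
    by (simp add: if_distrib[of "\<lambda>x. _ * x"] sum.delta' cong: if_cong)
  also have "\<dots> = (if i < n then coord u i else 0)"
    using assms by (auto simp: orthonormal_system_def synthesis_apply cinner_sum_right cinner_scaleC_right
        if_distrib[of "\<lambda>x. _ * x"] sum.delta' cong: if_cong)
  finally show "coord (analysis n b (synthesis n b u)) i = coord (restrict_ell2 {..<n} u) i"
    by (simp add: restrict_ell2.rep_eq)
qed

text \<open>This expresses that the vectors lie in the complex span of \<open>V\<close>, in the form in which it is
  used: operator identities on the span can be tested on \<open>V\<close>.\<close>

definition tested_on :: "'i ell2 set \<Rightarrow> nat \<Rightarrow> (nat \<Rightarrow> 'i ell2) \<Rightarrow> bool"
  where "tested_on V n b \<longleftrightarrow>
    (\<forall>L :: 'i op. clinear_op L \<longrightarrow> (\<forall>v\<in>V. L v = 0) \<longrightarrow> (\<forall>j<n. L (b j) = 0))"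

lemma gram_schmidt:
  fixes V :: "'i ell2 set"
  assumes "finite V"
  shows "\<exists>n b. orthonormal_system n b \<and> (\<forall>v\<in>V. synthesis n b (analysis n b v) = v) \<and> tested_on V n b"
  using assms
proof induction
  case empty
  show ?case by (intro exI[of _ 0]) (simp add: orthonormal_system_def tested_on_def)
next
  have sa: "synthesis n b (analysis n b v) = (\<Sum>j<n. cinner (b j) v *\<^sub>C b j)"
    for n and b :: "nat \<Rightarrow> 'i ell2" and v
    by (simp add: synthesis_apply analysis_apply coord_ket if_distrib[of "\<lambda>x. _ * x"] sum.delta' cong: if_cong)
  case (insert v V)
  then obtain n b where on: "orthonormal_system n b"
    and fixV: "\<And>v. v \<in> V \<Longrightarrow> (\<Sum>j<n. cinner (b j) v *\<^sub>C b j) = v"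
    and test: "tested_on V n b"
    unfolding sa by blast
  define s where "s = (\<Sum>j<n. cinner (b j) v *\<^sub>C b j)"
  define r where "r = v - s"
  show ?case
  proof (cases "r = 0")
    case True
    hence "s = v" by (simp add: r_def)
    thus ?thesis
      unfolding sa using on fixV test
      by (intro exI[of _ n] exI[of _ b]) (auto simp: s_def tested_on_def)
  next
    case False
    define b' where "b' = b(n := (1 / norm r) *\<^sub>R r)"
    have bn: "b' n = (1 / norm r) *\<^sub>R r" "\<And>j. j < n \<Longrightarrow> b' j = b j" by (auto simp: b'_def)
    have orth: "cinner (b j) r = 0" if "j < n" for j
      using on that by (simp add: r_def s_def cinner_diff_right cinner_sum_right cinner_scaleC_right
          orthonormal_system_def if_distrib[of "\<lambda>x. _ * x"] sum.delta cong: if_cong)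
    hence orth': "cinner r (b j) = 0" if "j < n" for j
      using that cinner_commute[of r "b j"] by simp
    have rspan: "cinner r (\<Sum>j<n. f j *\<^sub>C b j) = 0" for f
      by (simp add: cinner_sum_right cinner_scaleC_right orth')
    have rv: "cinner r v = of_real ((norm r)\<^sup>2)"
    proof -
      have "cinner r v = cinner r r + cinner r s"
        by (simp add: r_def cinner_diff_right)
      thus ?thesis by (simp add: s_def rspan cinner_self)
    qed
    have "orthonormal_system (Suc n) b'"
      using on False orth orth' unfolding orthonormal_system_def
      by (auto simp: less_Suc_eq bn cinner_scaleR_left cinner_scaleR_right cinner_self power2_eq_square)
    moreover have "(\<Sum>j<Suc n. cinner (b' j) w *\<^sub>C b' j) = w" if w: "w \<in> insert v V" for w
    proof (cases "w = v")
      case True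
      have "(\<Sum>j<Suc n. cinner (b' j) v *\<^sub>C b' j) = s + cinner (b' n) v *\<^sub>C b' n"
        by (simp add: s_def bn)
      also have "cinner (b' n) v *\<^sub>C b' n = r"
        using False
        by (simp add: bn cinner_scaleC_left rv scaleR_scaleC scaleC_scaleC power2_eq_square)
      finally show ?thesis by (simp add: True r_def)
    next
      case False
      hence w: "w \<in> V" using w by simp
      have "cinner r w = 0" using rspan[of "\<lambda>j. cinner (b j) w"] fixV[OF w] by simp
      thus ?thesis using fixV[OF w] by (simp add: bn cinner_scaleR_left)
    qed
    moreover have "L (b' j) = 0"
      if L: "clinear_op L" "\<forall>w\<in>insert v V. L w = 0" and j: "j < Suc n" for L :: "'i op" and j
    proof -
      have *: "L (b j) = 0" if "j < n" for j using test L that by (simp add: tested_on_def)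
      moreover have "L r = 0"
        using L * by (simp add: r_def s_def blinfun.diff_right blinfun.sum_right clinear_opD)
      ultimately show ?thesis using j by (auto simp: less_Suc_eq bn blinfun.scaleR_right)
    qed
    hence "tested_on (insert v V) (Suc n) b'" by (simp add: tested_on_def)
    ultimately show ?thesis unfolding sa by blast
  qed
qed

lemma projection_of_orthonormal_system:
  assumes "orthonormal_system n b"
  defines "\<Theta> \<equiv> synthesis n b o\<^sub>L analysis n b"
  shows "clinear_op \<Theta>" "\<Theta> o\<^sub>L \<Theta> = \<Theta>" "adj \<Theta> = \<Theta>"
proof -
  have "synthesis n b (restrict_ell2 {..<n} u) = synthesis n b u" for u
    by (simp add: synthesis_apply restrict_ell2.rep_eq)
  thus "\<Theta> o\<^sub>L \<Theta> = \<Theta>" by (simp add: \<Theta>_def blinfun_eq_iff analysis_synthesis[OF assms(1)])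
  show "clinear_op \<Theta>" unfolding \<Theta>_def by (intro clinear_compose clinear_synthesis clinear_analysis)
  show "adj \<Theta> = \<Theta>"
    by (rule adj_unique) (simp add: \<Theta>_def cinner_analysis[symmetric] cinner_analysis_right[symmetric])
qed

lemma projection_vanishing:
  assumes "clinear_op L" "\<And>j. j < n \<Longrightarrow> blinfun_apply L (b j) = 0"
  shows "L o\<^sub>L (synthesis n b o\<^sub>L analysis n b) = 0"
  using assms by (simp add: blinfun_eq_iff synthesis_apply blinfun.sum_right clinear_opD)

lemma span_projection:
  fixes V :: "'i ell2 set"
  assumes "finite V"
  shows "\<exists>\<Theta>. clinear_op \<Theta> \<and> \<Theta> o\<^sub>L \<Theta> = \<Theta> \<and> adj \<Theta> = \<Theta> \<and> (\<forall>v\<in>V. \<Theta> v = v) \<and>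
    (\<forall>L :: 'i op. clinear_op L \<longrightarrow> (\<forall>v\<in>V. L v = 0) \<longrightarrow> L o\<^sub>L \<Theta> = 0)"
proof -
  obtain n b where b: "orthonormal_system n b" "\<And>v. v \<in> V \<Longrightarrow> synthesis n b (analysis n b v) = v"
    "tested_on V n b"
    using gram_schmidt[OF assms] by blast
  have "L o\<^sub>L (synthesis n b o\<^sub>L analysis n b) = 0" if "clinear_op L" "\<forall>v\<in>V. L v = 0" for L :: "'i op"
    by (rule projection_vanishing) (use b(3) that in \<open>auto simp: tested_on_def\<close>)
  thus ?thesis
    by (intro exI[of _ "synthesis n b o\<^sub>L analysis n b"])
      (use b(2) projection_of_orthonormal_system[OF b(1)] in auto)
qed

text \<open>The compression of a projection to a subspace is a projection only if they commute.
  For each \<open>x\<close>, the span \<open>K x\<close> of the vectors \<open>P x a (ket i)\<close> is invariant under \<open>P x\<close>; so \<open>P x\<close>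
  restricts to \<open>K x\<close>. On the span of all the \<open>K x\<close> and \<open>ket i\<close>, the complement of \<open>K x\<close> is added
  to one of the projections, which does not change their values on the vectors \<open>ket i\<close>.\<close>

lemma compress_pvm:
  fixes P :: "'x \<Rightarrow> 'a \<Rightarrow> 'i op"
  assumes P: "pvm_family J X A P" and X: "finite X" and A: "finite A"
    and F: "finite F" "F \<subseteq> J" "F \<noteq> {}"
  shows "\<exists>n (P' :: 'x \<Rightarrow> 'a \<Rightarrow> nat op) w. pvm_family {..<n} X A P' \<and> (\<forall>i\<in>F. w i \<in> ell2_on {..<n}) \<and>
    (\<forall>i\<in>F. \<forall>k\<in>F. cinner (w i) (w k) = cinner (ket i) (ket k)) \<and>
    (\<forall>x\<in>X. \<forall>a\<in>A. \<forall>i\<in>F. \<forall>k\<in>F. cinner (w i) (P' x a (w k)) = cinner (ket i) (P x a (ket k)))"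
proof -
  define V where "V x = (\<lambda>(a, i). P x a (ket i)) ` (A \<times> F)" for x
  have finV: "finite (V x)" for x using A F by (simp add: V_def)
  have "\<forall>x. \<exists>\<Theta> :: 'i op. clinear_op \<Theta> \<and> \<Theta> o\<^sub>L \<Theta> = \<Theta> \<and> adj \<Theta> = \<Theta> \<and> (\<forall>v\<in>V x. \<Theta> v = v) \<and>
    (\<forall>L :: 'i op. clinear_op L \<longrightarrow> (\<forall>v\<in>V x. L v = 0) \<longrightarrow> L o\<^sub>L \<Theta> = 0)"
    by (intro allI span_projection finV)
  from choice[OF this] obtain R :: "'x \<Rightarrow> 'i op" where "\<forall>x. clinear_op (R x) \<and> R x o\<^sub>L R x = R x \<and> adj (R x) = R x \<and>
    (\<forall>v\<in>V x. R x v = v) \<and> (\<forall>L :: 'i op. clinear_op L \<longrightarrow> (\<forall>v\<in>V x. L v = 0) \<longrightarrow> L o\<^sub>L R x = 0)"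
    by (rule exE)
  hence R: "\<And>x. clinear_op (R x)" "\<And>x. R x o\<^sub>L R x = R x" "\<And>x. adj (R x) = R x"
    "\<And>x v. v \<in> V x \<Longrightarrow> R x v = v"
    "\<And>x (L :: 'i op). clinear_op L \<Longrightarrow> (\<And>v. v \<in> V x \<Longrightarrow> L v = 0) \<Longrightarrow> L o\<^sub>L R x = 0"
    by simp_all
  have finW: "finite (ket ` F \<union> (\<Union>x\<in>X. V x))" using F X finV by simp
  obtain n b where b: "orthonormal_system n b"
      "\<And>v. v \<in> ket ` F \<union> (\<Union>x\<in>X. V x) \<Longrightarrow> synthesis n b (analysis n b v) = v"
    using gram_schmidt[OF finW] by blast
  define \<Theta> where "\<Theta> = synthesis n b o\<^sub>L analysis n b"
  have \<Theta>: "clinear_op \<Theta>" "\<Theta> o\<^sub>L \<Theta> = \<Theta>" "adj \<Theta> = \<Theta>"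
    unfolding \<Theta>_def using projection_of_orthonormal_system[OF b(1)] by auto
  have \<Theta>V: "\<Theta> v = v" if "v \<in> ket ` F \<union> (\<Union>x\<in>X. V x)" for v using b(2)[OF that] by (simp add: \<Theta>_def)
  note pr = projectionsD[OF pvm_projection[OF P]]
  \<comment> \<open>\<open>a0\<close> receives the complement of \<open>K x\<close>; if there is a question, then \<open>A\<close> is nonempty,
    because the projections add up to a nonzero operator\<close>
  define a0 where "a0 = (SOME a. a \<in> A)"
  have a0: "a0 \<in> A" if x: "x \<in> X" for x
  proof -
    obtain i where i: "i \<in> F" "i \<in> J" using F by auto
    have "A \<noteq> {}"
    proof
      assume "A = {}"
      hence "id_on J = 0" using pvm_sum[OF P x] by simp
      hence "coord (id_on J (ket i)) i = 0" by simp
      thus False using i by (simp add: restrict_ell2.rep_eq coord_ket)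
    qed
    thus ?thesis unfolding a0_def by (simp add: some_in_eq)
  qed
  define S where "S x a = (P x a o\<^sub>L R x) + (if a = a0 then \<Theta> - R x else 0)" for x a
  define P' where "P' x a = analysis n b o\<^sub>L (S x a o\<^sub>L synthesis n b)" for x a
  define w where "w i = analysis n b (ket i)" for i
  \<comment> \<open>invariance gives \<open>P R = R P R\<close>, and the right-hand side is self-adjoint\<close>
  have comm: "P x a o\<^sub>L R x = R x o\<^sub>L P x a" if x: "x \<in> X" and a: "a \<in> A" for x a
  proof -
    have "((R x o\<^sub>L P x a) - P x a) o\<^sub>L R x = 0"
    proof (rule R(5))
      fix v assume v: "v \<in> V x"
      then obtain a' i where v': "v = P x a' (ket i)" "a' \<in> A" by (auto simp: V_def)
      have "P x a v = (if a = a' then v else 0)"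
        using pr(5)[OF x a] pvm_orthogonal[OF P x A a v'(2)] by (auto simp: v' blinfun_eq_iff)
      thus "((R x o\<^sub>L P x a) - P x a) v = 0" using R(4)[OF v] by (simp add: blinfun.diff_left)
    qed (simp add: clinear_diff clinear_compose R pr x a)
    hence e: "P x a o\<^sub>L R x = R x o\<^sub>L (P x a o\<^sub>L R x)"
      by (simp add: blinfun_eq_iff blinfun.diff_left)
    have "adj (P x a o\<^sub>L R x) = R x o\<^sub>L (P x a o\<^sub>L R x)"
      by (subst e) (simp add: adj_compose clinear_compose R pr x a blinfun_compose_assoc)
    also have "\<dots> = P x a o\<^sub>L R x" by (rule e[symmetric])
    finally have "adj (P x a o\<^sub>L R x) = P x a o\<^sub>L R x" .
    thus ?thesis by (simp add: adj_compose R pr x a)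
  qed
  have \<Theta>R: "\<Theta> o\<^sub>L R x = R x" if x: "x \<in> X" for x
  proof -
    have "(\<Theta> - id_blinfun) o\<^sub>L R x = 0"
      by (rule R(5)) (use \<Theta>V x \<Theta> in \<open>auto simp: blinfun.diff_left clinear_diff\<close>)
    thus ?thesis by (simp add: blinfun_eq_iff blinfun.diff_left)
  qed
  have R\<Theta>: "R x o\<^sub>L \<Theta> = R x" if x: "x \<in> X" for x
    using arg_cong[OF \<Theta>R[OF x], of adj] by (simp add: adj_compose R \<Theta>)
  have idR: "id_on J o\<^sub>L R x = R x" if x: "x \<in> X" for x
  proof -
    have "(id_on J - id_blinfun) o\<^sub>L R x = 0"
    proof (rule R(5))
      fix v assume "v \<in> V x"
      then obtain a i where "v = P x a (ket i)" "a \<in> A" by (auto simp: V_def)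
      hence "restrict_ell2 J v = v" using pr(1)[OF x] by (simp add: bounded_ops_def restrict_ell2_eq_iff)
      thus "(id_on J - id_blinfun) v = 0" by (simp add: blinfun.diff_left)
    qed (simp add: clinear_diff)
    thus ?thesis by (simp add: blinfun_eq_iff blinfun.diff_left)
  qed
  have Rket: "R x (ket i) = ket i" if x: "x \<in> X" and i: "i \<in> F" for x i
  proof -
    have "restrict_ell2 J (ket i) = ket i"
      unfolding restrict_ell2_eq_iff using i F by (auto simp: ell2_on_def coord_ket)
    hence k: "(\<Sum>a\<in>A. P x a (ket i)) = ket i"
      using pvm_sum[OF P x] by (simp add: blinfun_sum_left[symmetric])
    have "R x (\<Sum>a\<in>A. P x a (ket i)) = (\<Sum>a\<in>A. P x a (ket i))"
      unfolding blinfun.sum_right by (intro sum.cong refl R(4)) (use i in \<open>auto simp: V_def\<close>)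
    thus ?thesis by (simp add: k)
  qed
  have S: "clinear_op (S x a)" "S x a o\<^sub>L S x a = S x a" "adj (S x a) = S x a" "\<Theta> o\<^sub>L S x a = S x a"
    if x: "x \<in> X" and a: "a \<in> A" for x a
  proof -
    have "\<Theta> (R x (P x a u)) = R x (P x a u)" for u using \<Theta>R[OF x] by (simp add: blinfun_eq_iff)
    hence c: "R x (P x a u) = P x a (R x u)" "\<Theta> (P x a (R x u)) = P x a (R x u)" "\<Theta> (R x u) = R x u" "R x (\<Theta> u) = R x u" "R x (R x u) = R x u"
      "\<Theta> (\<Theta> u) = \<Theta> u" "P x a (P x a u) = P x a u" for u
      using comm[OF x a] \<Theta>R[OF x] R\<Theta>[OF x] R(2)[of x] \<Theta>(2) pr(5)[OF x a] by (auto simp: blinfun_eq_iff)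
    show "clinear_op (S x a)"
      by (simp add: S_def clinear_add clinear_compose clinear_diff R \<Theta> pr x a)
    show "S x a o\<^sub>L S x a = S x a"
      by (cases "a = a0") (use c in \<open>simp_all add: S_def blinfun_eq_iff blinfun.add_left
          blinfun.add_right blinfun.diff_left blinfun.diff_right\<close>)
    have "adj 0 = (0 :: 'i op)" by (rule adj_unique) (simp add: cinner_zero_left)
    thus "adj (S x a) = S x a"
      by (simp add: S_def adj_add adj_diff clinear_compose clinear_diff R \<Theta> pr x a adj_compose comm)
    show "\<Theta> o\<^sub>L S x a = S x a"
      by (cases "a = a0") (use c in \<open>simp_all add: S_def blinfun_eq_iff blinfun.add_left
          blinfun.add_right blinfun.diff_left blinfun.diff_right\<close>)
  qed
  have Ssum: "(\<Sum>a\<in>A. S x a) = \<Theta>" if x: "x \<in> X" for x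
  proof -
    have "(\<Sum>a\<in>A. P x a o\<^sub>L R x) = id_on J o\<^sub>L R x"
      unfolding pvm_sum[OF P x, symmetric] by (simp add: blinfun_eq_iff blinfun_sum_left)
    thus ?thesis using A a0[OF x] idR[OF x] by (simp add: S_def sum.distrib sum.delta)
  qed
  have Sket: "S x a (ket i) = P x a (ket i)" if x: "x \<in> X" and a: "a \<in> A" and i: "i \<in> F" for x a i
    using Rket[OF x i] \<Theta>V[of "ket i"] i by (simp add: S_def blinfun.add_left blinfun.diff_left)
  have sn: "synthesis n b (restrict_ell2 {..<n} u) = synthesis n b u" for u
    by (simp add: synthesis_apply restrict_ell2.rep_eq)
  have "pvm_family {..<n} X A P'"
    unfolding pvm_family_def
  proof (intro ballI conjI)
    fix x a assume x: "x \<in> X" and a: "a \<in> A"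
    have "clinear_op (P' x a)"
      unfolding P'_def by (intro clinear_compose clinear_synthesis clinear_analysis S x a)
    hence "P' x a \<in> bounded_ops {..<n}"
      by (simp add: bounded_ops_def P'_def analysis_in_ell2_on sn)
    moreover have "S x a (synthesis n b (analysis n b (S x a u))) = S x a u" for u
      using S(2)[OF x a] S(4)[OF x a] by (simp add: \<Theta>_def blinfun_eq_iff)
    hence "P' x a o\<^sub>L P' x a = P' x a" by (simp add: P'_def blinfun_eq_iff)
    moreover have "adj (P' x a) = P' x a"
      by (rule adj_unique)
        (simp add: P'_def cinner_analysis cinner_analysis_right selfadjointD[OF S(1,3)[OF x a]])
    ultimately show "P' x a \<in> projections {..<n}" by (simp add: projections_def)
  next
    fix x assume x: "x \<in> X"
    have "(\<Sum>a\<in>A. P' x a) = analysis n b o\<^sub>L ((\<Sum>a\<in>A. S x a) o\<^sub>L synthesis n b)"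
      by (simp add: P'_def blinfun_eq_iff blinfun_sum_left blinfun.sum_right)
    also have "\<dots> = id_on {..<n}"
      by (simp add: Ssum[OF x] \<Theta>_def blinfun_eq_iff analysis_synthesis[OF b(1)] sn)
    finally show "(\<Sum>a\<in>A. P' x a) = id_on {..<n}" .
  qed
  moreover have "cinner (w i) (w k) = cinner (ket i) (ket k)" if "k \<in> F" for i k
    using b(2)[of "ket k"] that by (simp add: w_def cinner_analysis)
  moreover have "cinner (w i) (P' x a (w k)) = cinner (ket i) (P x a (ket k))"
    if x: "x \<in> X" and a: "a \<in> A" and i: "i \<in> F" and k: "k \<in> F" for x a i k
  proof -
    have "cinner (w i) (P' x a (w k)) = cinner (synthesis n b (analysis n b (ket i))) (S x a (ket k))"
      using b(2)[of "ket k"] k by (simp add: w_def P'_def cinner_analysis_right)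
    thus ?thesis using b(2)[of "ket i"] i by (simp add: Sket x a k)
  qed
  ultimately have "pvm_family {..<n} X A P' \<and> (\<forall>i\<in>F. w i \<in> ell2_on {..<n}) \<and>
    (\<forall>i\<in>F. \<forall>k\<in>F. cinner (w i) (w k) = cinner (ket i) (ket k)) \<and>
    (\<forall>x\<in>X. \<forall>a\<in>A. \<forall>i\<in>F. \<forall>k\<in>F. cinner (w i) (P' x a (w k)) = cinner (ket i) (P x a (ket k)))"
    using analysis_in_ell2_on[of n b] by (simp add: w_def)
  thus ?thesis by (intro exI)
qed

section \<open>Correlations of vectors\<close>

text \<open>The restriction makes the function undefined outside of the given sets of questions and
  answers, as \<open>C_ns\<close> demands.\<close>

definition correlation ::
    "'x set \<Rightarrow> 'y set \<Rightarrow> 'a set \<Rightarrow> 'b set \<Rightarrow> ('x \<Rightarrow> 'a \<Rightarrow> 'i op) \<Rightarrow> ('y \<Rightarrow> 'b \<Rightarrow> 'j op) \<Rightarrow> ('i \<times> 'j) ell2 \<Rightarrow>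
      'x \<times> 'y \<times> 'a \<times> 'b \<Rightarrow> real"
  where "correlation X Y A B P Q \<psi> =
    restrict (\<lambda>(x, y, a, b). Re (cinner \<psi> ((P x a \<otimes>\<^sub>o Q y b) \<psi>))) (X \<times> Y \<times> A \<times> B)"

lemma tensor_projection:
  "S \<in> projections J \<Longrightarrow> T \<in> projections K \<Longrightarrow> S \<otimes>\<^sub>o T \<in> projections (J \<times> K)"
  using projectionsD(2)[of S J] projectionsD(2)[of T K]
  by (simp add: projections_def tensor_op_bounded_ops tensor_op_compose tensor_op_adj)

lemma cinner_projection: "T \<in> projections J \<Longrightarrow> cinner u (T u) = of_real ((norm (T u))\<^sup>2)"
  using projectionsD(5,6)[of T J] by (metis cinner_self)

lemma correlation_eq:
  assumes "pvm_family J X A P" "pvm_family K Y B Q" "x \<in> X" "y \<in> Y" "a \<in> A" "b \<in> B"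
  shows "complex_of_real (correlation X Y A B P Q \<psi> (x, y, a, b)) = cinner \<psi> ((P x a \<otimes>\<^sub>o Q y b) \<psi>)"
  using assms cinner_projection[OF tensor_projection[OF
      pvm_projection[OF assms(1,3,5)] pvm_projection[OF assms(2,4,6)]], of \<psi>]
  by (simp add: correlation_def)

lemma correlation_C_ns:
  assumes P: "pvm_family J X A P" and Q: "pvm_family K Y B Q"
    and \<psi>: "\<psi> \<in> ell2_on (J \<times> K)" "norm \<psi> = 1"
  shows "correlation X Y A B P Q \<psi> \<in> C_ns X Y A B"
proof -
  let ?c = "correlation X Y A B P Q \<psi>"
  have lin: "clinear_op (P x a)" if "x \<in> X" "a \<in> A" for x a
    using projectionsD(2)[OF pvm_projection[OF P that]] .
  have lin': "clinear_op (Q y b)" if "y \<in> Y" "b \<in> B" for y b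
    using projectionsD(2)[OF pvm_projection[OF Q that]] .
  have range: "?c \<in> X \<times> Y \<times> A \<times> B \<rightarrow>\<^sub>E {0..1}"
  proof (rule PiE_I)
    fix t assume "t \<in> X \<times> Y \<times> A \<times> B"
    then obtain x y a b where t: "t = (x, y, a, b)" "x \<in> X" "y \<in> Y" "a \<in> A" "b \<in> B" by auto
    note pr = tensor_projection[OF pvm_projection[OF P t(2,4)] pvm_projection[OF Q t(3,5)]]
    have "?c t = (norm ((P x a \<otimes>\<^sub>o Q y b) \<psi>))\<^sup>2"
      using t by (simp add: correlation_def cinner_projection[OF pr])
    moreover have "norm ((P x a \<otimes>\<^sub>o Q y b) \<psi>) \<le> 1"
      using norm_blinfun[of "P x a \<otimes>\<^sub>o Q y b" \<psi>] norm_projection_le[OF pr] \<psi> by simp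
    ultimately show "?c t \<in> {0..1}" by (simp add: power_le_one)
  qed (simp add: correlation_def)
  have A: "(\<Sum>b\<in>B. ?c (x, y, a, b)) = Re (cinner \<psi> ((P x a \<otimes>\<^sub>o id_on K) \<psi>))"
    if "x \<in> X" "y \<in> Y" "a \<in> A" for x y a
    using that by (simp add: correlation_def pvm_sum[OF Q, symmetric] tensor_op_sum_right lin lin'
        blinfun_sum_left cinner_sum_right)
  have B: "(\<Sum>a\<in>A. ?c (x, y, a, b)) = Re (cinner \<psi> ((id_on J \<otimes>\<^sub>o Q y b) \<psi>))"
    if "x \<in> X" "y \<in> Y" "b \<in> B" for x y b
    using that by (simp add: correlation_def pvm_sum[OF P, symmetric] tensor_op_sum_left lin lin'
        blinfun_sum_left cinner_sum_right)
  have "(\<Sum>(a, b)\<in>A \<times> B. ?c (x, y, a, b)) = 1" if x: "x \<in> X" and y: "y \<in> Y" for x y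
  proof -
    have "(\<Sum>(a, b)\<in>A \<times> B. ?c (x, y, a, b)) = (\<Sum>a\<in>A. \<Sum>b\<in>B. ?c (x, y, a, b))"
      by (rule sum.cartesian_product[symmetric])
    also have "\<dots> = Re (cinner \<psi> ((id_on J \<otimes>\<^sub>o id_on K) \<psi>))"
      using x y by (simp add: A pvm_sum[OF P, symmetric] tensor_op_sum_left lin blinfun_sum_left cinner_sum_right)
    also have "\<dots> = 1"
      using \<psi> by (simp add: tensor_op_id_on restrict_ell2_eq_iff[symmetric] cinner_self)
    finally show ?thesis .
  qed
  thus ?thesis using range by (simp add: C_ns_def A B)
qed

lemma correlation_C_q:
  fixes P :: "'x \<Rightarrow> 'a \<Rightarrow> nat op" and Q :: "'y \<Rightarrow> 'b \<Rightarrow> nat op"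
  assumes "pvm_family J X A P" "pvm_family K Y B Q" "finite J" "finite K"
    and "\<psi> \<in> ell2_on (J \<times> K)" "norm \<psi> = 1"
  shows "correlation X Y A B P Q \<psi> \<in> C_q X Y A B"
  unfolding C_q_def
proof (intro CollectI conjI exI)
  show "\<forall>x\<in>X. \<forall>y\<in>Y. \<forall>a\<in>A. \<forall>b\<in>B.
      complex_of_real (correlation X Y A B P Q \<psi> (x, y, a, b)) = cinner \<psi> ((P x a \<otimes>\<^sub>o Q y b) \<psi>)"
    by (intro ballI correlation_eq[OF assms(1,2)])
qed (use assms in \<open>auto intro: correlation_C_ns\<close>)

text \<open>The vectors \<open>w\<close> and \<open>z\<close> will be basis vectors in different Hilbert spaces, or their images under
  a compression or an embedding into a direct sum.\<close>

lemma cinner_tensor_sums: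
  fixes w w' :: "'k \<Rightarrow> 'i ell2" and z z' :: "'l \<Rightarrow> 'j ell2"
  assumes "clinear_op S" "clinear_op T"
  shows "cinner (\<Sum>p\<in>D. c p *\<^sub>C (w (fst p) \<otimes>\<^sub>v z (snd p)))
      ((S \<otimes>\<^sub>o T) (\<Sum>p\<in>D'. c' p *\<^sub>C (w' (fst p) \<otimes>\<^sub>v z' (snd p)))) =
    (\<Sum>p\<in>D. \<Sum>q\<in>D'. cnj (c p) * c' q *
      (cinner (w (fst p)) (S (w' (fst q))) * cinner (z (snd p)) (T (z' (snd q)))))"
  unfolding blinfun.sum_right cinner_sum_left unfolding cinner_sum_right
  by (intro sum.cong refl)
    (simp add: cinner_scaleC_left cinner_scaleC_right clinear_opD[OF tensor_op_clinear] assms(1,2)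
      tensor_op_apply cinner_tensor)

lemma finite_support_expansion:
  assumes "finite F" "finite G" "\<psi> \<in> ell2_on (F \<times> G)"
  shows "\<psi> = (\<Sum>p\<in>F \<times> G. coord \<psi> p *\<^sub>C (ket (fst p) \<otimes>\<^sub>v ket (snd p)))"
proof (rule ell2_eqI)
  fix q
  have "coord (\<Sum>p\<in>F \<times> G. coord \<psi> p *\<^sub>C (ket (fst p) \<otimes>\<^sub>v ket (snd p))) q =
      (\<Sum>p\<in>F \<times> G. if q = p then coord \<psi> p else 0)"
    by (simp add: ket_tensor coord_ket if_distrib[of "\<lambda>x. _ * x"] cong: if_cong)
  also have "\<dots> = (if q \<in> F \<times> G then coord \<psi> q else 0)"
    using assms(1,2) by (simp only: finite_cartesian_product sum.delta')
  also have "\<dots> = coord \<psi> q" using assms(3) by (cases q) (auto simp: ell2_on_def)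
  finally show "coord \<psi> q = coord (\<Sum>p\<in>F \<times> G. coord \<psi> p *\<^sub>C (ket (fst p) \<otimes>\<^sub>v ket (snd p))) q" ..
qed

text \<open>The value of a correlation on a finitely supported vector only depends on matrix
  coefficients, hence survives any change of operators and vectors that preserves these.\<close>

lemma transfer_matrix_coefficients:
  assumes fin: "finite F" "finite G" and \<psi>: "\<psi> \<in> ell2_on (F \<times> G)"
    and lin: "clinear_op S" "clinear_op T" "clinear_op S'" "clinear_op T'"
    and S: "\<And>i k. i \<in> F \<Longrightarrow> k \<in> F \<Longrightarrow> cinner (w i) (S' (w k)) = cinner (ket i) (S (ket k))"
    and T: "\<And>i k. i \<in> G \<Longrightarrow> k \<in> G \<Longrightarrow> cinner (z i) (T' (z k)) = cinner (ket i) (T (ket k))"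
    and \<psi>': "\<psi>' = (\<Sum>p\<in>F \<times> G. coord \<psi> p *\<^sub>C (w (fst p) \<otimes>\<^sub>v z (snd p)))"
  shows "cinner \<psi>' ((S' \<otimes>\<^sub>o T') \<psi>') = cinner \<psi> ((S \<otimes>\<^sub>o T) \<psi>)"
proof -
  have "cinner \<psi> ((S \<otimes>\<^sub>o T) \<psi>) = (\<Sum>p\<in>F \<times> G. \<Sum>q\<in>F \<times> G. cnj (coord \<psi> p) * coord \<psi> q *
      (cinner (ket (fst p)) (S (ket (fst q))) * cinner (ket (snd p)) (T (ket (snd q)))))"
    using cinner_tensor_sums[OF lin(1,2), where c = "coord \<psi>" and w = ket and z = ket and D = "F \<times> G"
      and c' = "coord \<psi>" and w' = ket and z' = ket and D' = "F \<times> G"]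
    by (simp flip: finite_support_expansion[OF fin \<psi>])
  also have "\<dots> = cinner \<psi>' ((S' \<otimes>\<^sub>o T') \<psi>')"
    unfolding \<psi>' cinner_tensor_sums[OF lin(3,4)] by (intro sum.cong refl) (auto simp: S T)
  finally show ?thesis ..
qed

lemma transfer_norm:
  assumes fin: "finite F" "finite G" and \<psi>: "\<psi> \<in> ell2_on (F \<times> G)"
    and "\<And>i k. i \<in> F \<Longrightarrow> k \<in> F \<Longrightarrow> cinner (w i) (w k) = cinner (ket i) (ket k)"
    and "\<And>i k. i \<in> G \<Longrightarrow> k \<in> G \<Longrightarrow> cinner (z i) (z k) = cinner (ket i) (ket k)"
    and \<psi>': "\<psi>' = (\<Sum>p\<in>F \<times> G. coord \<psi> p *\<^sub>C (w (fst p) \<otimes>\<^sub>v z (snd p)))"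
  shows "norm \<psi>' = norm \<psi>"
proof -
  have id: "id_blinfun \<otimes>\<^sub>o id_blinfun = id_blinfun" by (rule tensor_op_unique) simp
  have "cinner \<psi>' ((id_blinfun \<otimes>\<^sub>o id_blinfun) \<psi>') = cinner \<psi> ((id_blinfun \<otimes>\<^sub>o id_blinfun) \<psi>)"
    by (rule transfer_matrix_coefficients[OF fin \<psi> _ _ _ _ _ _ \<psi>']) (simp_all add: assms)
  hence "complex_of_real ((norm \<psi>')\<^sup>2) = of_real ((norm \<psi>)\<^sup>2)" by (simp only: id cinner_self) (simp add: cinner_self)
  hence "(norm \<psi>')\<^sup>2 = (norm \<psi>)\<^sup>2" unfolding of_real_eq_iff .
  thus ?thesis by (simp add: power2_eq_iff_nonneg)
qed

lemma tensor_in_ell2_on: "u \<in> ell2_on J \<Longrightarrow> v \<in> ell2_on K \<Longrightarrow> u \<otimes>\<^sub>v v \<in> ell2_on (J \<times> K)"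
  by (auto simp: ell2_on_def tensor_vec.rep_eq)

lemma sum_in_ell2_on: "(\<And>i. i \<in> F \<Longrightarrow> f i \<in> ell2_on J) \<Longrightarrow> sum f F \<in> ell2_on J"
  by (induction F rule: infinite_finite_induct) (simp_all add: ell2_on_add)

text \<open>Here the representations may be infinite-dimensional; only the vector has finite support.\<close>

lemma finite_support_correlation_C_q:
  fixes P :: "'x \<Rightarrow> 'a \<Rightarrow> 'i op" and Q :: "'y \<Rightarrow> 'b \<Rightarrow> 'j op"
  assumes P: "pvm_family J X A P" and Q: "pvm_family K Y B Q"
    and fin: "finite X" "finite Y" "finite A" "finite B"
    and F: "finite F" "F \<subseteq> J" and G: "finite G" "G \<subseteq> K"
    and \<psi>: "\<psi> \<in> ell2_on (F \<times> G)" "norm \<psi> = 1"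
  shows "correlation X Y A B P Q \<psi> \<in> C_q X Y A B"
proof -
  have "F \<times> G \<noteq> {}"
  proof
    assume "F \<times> G = {}"
    hence "\<psi> = 0" using \<psi>(1) by (intro ell2_eqI) (auto simp: ell2_on_def)
    thus False using \<psi>(2) by simp
  qed
  hence ne: "F \<noteq> {}" "G \<noteq> {}" by auto
  obtain n and P' :: "'x \<Rightarrow> 'a \<Rightarrow> nat op" and w where w: "pvm_family {..<n} X A P'"
    "\<And>i. i \<in> F \<Longrightarrow> w i \<in> ell2_on {..<n}"
    "\<And>i k. i \<in> F \<Longrightarrow> k \<in> F \<Longrightarrow> cinner (w i) (w k) = cinner (ket i) (ket k)"
    "\<And>x a i k. x \<in> X \<Longrightarrow> a \<in> A \<Longrightarrow> i \<in> F \<Longrightarrow> k \<in> F \<Longrightarrow>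
      cinner (w i) (P' x a (w k)) = cinner (ket i) (P x a (ket k))"
    using compress_pvm[OF P fin(1,3) F ne(1)] by blast
  obtain m and Q' :: "'y \<Rightarrow> 'b \<Rightarrow> nat op" and z where z: "pvm_family {..<m} Y B Q'"
    "\<And>i. i \<in> G \<Longrightarrow> z i \<in> ell2_on {..<m}"
    "\<And>i k. i \<in> G \<Longrightarrow> k \<in> G \<Longrightarrow> cinner (z i) (z k) = cinner (ket i) (ket k)"
    "\<And>y b i k. y \<in> Y \<Longrightarrow> b \<in> B \<Longrightarrow> i \<in> G \<Longrightarrow> k \<in> G \<Longrightarrow>
      cinner (z i) (Q' y b (z k)) = cinner (ket i) (Q y b (ket k))"
    using compress_pvm[OF Q fin(2,4) G ne(2)] by blast
  define \<psi>' where "\<psi>' = (\<Sum>p\<in>F \<times> G. coord \<psi> p *\<^sub>C (w (fst p) \<otimes>\<^sub>v z (snd p)))"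
  have lin: "clinear_op (P x a)" "clinear_op (P' x a)" if "x \<in> X" "a \<in> A" for x a
    using projectionsD(2)[OF pvm_projection[OF P that]] projectionsD(2)[OF pvm_projection[OF w(1) that]] .
  have lin': "clinear_op (Q y b)" "clinear_op (Q' y b)" if "y \<in> Y" "b \<in> B" for y b
    using projectionsD(2)[OF pvm_projection[OF Q that]] projectionsD(2)[OF pvm_projection[OF z(1) that]] .
  have "cinner \<psi>' ((P' x a \<otimes>\<^sub>o Q' y b) \<psi>') = cinner \<psi> ((P x a \<otimes>\<^sub>o Q y b) \<psi>)"
    if "x \<in> X" "y \<in> Y" "a \<in> A" "b \<in> B" for x y a b
    by (rule transfer_matrix_coefficients[OF F(1) G(1) \<psi>(1) _ _ _ _ _ _ \<psi>'_def])
      (use that in \<open>simp_all add: lin lin' w z\<close>)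
  hence "correlation X Y A B P Q \<psi> = correlation X Y A B P' Q' \<psi>'"
    unfolding correlation_def by (intro restrict_ext) auto
  also have "\<dots> \<in> C_q X Y A B"
  proof (rule correlation_C_q[OF w(1) z(1)])
    show "\<psi>' \<in> ell2_on ({..<n} \<times> {..<m})"
      unfolding \<psi>'_def by (intro sum_in_ell2_on ell2_on_scaleC tensor_in_ell2_on) (auto simp: w z)
    show "norm \<psi>' = 1"
      unfolding \<psi>(2)[symmetric] by (rule transfer_norm[OF F(1) G(1) \<psi>(1) _ _ \<psi>'_def]) (simp_all add: w z)
  qed simp_all
  finally show ?thesis .
qed

section \<open>Quantum correlations are convex\<close>

lemma C_q_obtain:
  assumes "q \<in> C_q X Y A B"
  obtains J K :: "nat set" and P Q \<psi> where "finite J" "finite K" "pvm_family J X A P" "pvm_family K Y B Q"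
    "\<psi> \<in> ell2_on (J \<times> K)" "norm \<psi> = 1"
    "\<And>x y a b. x \<in> X \<Longrightarrow> y \<in> Y \<Longrightarrow> a \<in> A \<Longrightarrow> b \<in> B \<Longrightarrow>
      complex_of_real (q (x, y, a, b)) = cinner \<psi> ((P x a \<otimes>\<^sub>o Q y b) \<psi>)"
proof -
  have "\<exists>(J :: nat set) (K :: nat set) P Q \<psi>. finite J \<and> finite K \<and> pvm_family J X A P \<and>
      pvm_family K Y B Q \<and> \<psi> \<in> ell2_on (J \<times> K) \<and> norm \<psi> = 1 \<and>
      (\<forall>x\<in>X. \<forall>y\<in>Y. \<forall>a\<in>A. \<forall>b\<in>B. complex_of_real (q (x, y, a, b)) = cinner \<psi> ((P x a \<otimes>\<^sub>o Q y b) \<psi>))"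
    using assms by (simp add: C_q_def)
  thus thesis by (elim exE conjE, rule_tac that) (assumption+, simp)
qed

text \<open>On a direct sum of two pairs of representations, the superposition of the two state vectors
  with amplitudes \<open>\<surd>(1 - t)\<close> and \<open>\<surd>t\<close> has no cross terms.\<close>

lemma C_q_convex:
  assumes q: "q0 \<in> C_q X Y A B" "q1 \<in> C_q X Y A B" and t: "0 \<le> t" "t \<le> 1"
    and fin: "finite X" "finite Y" "finite A" "finite B"
  shows "\<exists>q\<in>C_q X Y A B. \<forall>s\<in>X \<times> Y \<times> A \<times> B. q s = (1 - t) * q0 s + t * q1 s"
proof -
  obtain J0 K0 :: "nat set" and P0 Q0 \<psi>0 where 0: "finite J0" "finite K0" "pvm_family J0 X A P0" "pvm_family K0 Y B Q0"
    "\<psi>0 \<in> ell2_on (J0 \<times> K0)" "norm \<psi>0 = 1"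
    "\<And>x y a b. x \<in> X \<Longrightarrow> y \<in> Y \<Longrightarrow> a \<in> A \<Longrightarrow> b \<in> B \<Longrightarrow>
      complex_of_real (q0 (x, y, a, b)) = cinner \<psi>0 ((P0 x a \<otimes>\<^sub>o Q0 y b) \<psi>0)"
    by (rule C_q_obtain[OF q(1)], rule that)
  obtain J1 K1 :: "nat set" and P1 Q1 \<psi>1 where 1: "finite J1" "finite K1" "pvm_family J1 X A P1" "pvm_family K1 Y B Q1"
    "\<psi>1 \<in> ell2_on (J1 \<times> K1)" "norm \<psi>1 = 1"
    "\<And>x y a b. x \<in> X \<Longrightarrow> y \<in> Y \<Longrightarrow> a \<in> A \<Longrightarrow> b \<in> B \<Longrightarrow>
      complex_of_real (q1 (x, y, a, b)) = cinner \<psi>1 ((P1 x a \<otimes>\<^sub>o Q1 y b) \<psi>1)"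
    by (rule C_q_obtain[OF q(2)], rule that)
  define J K where "J r = (if r then J1 else J0)" and "K r = (if r then K1 else K0)" for r
  define P Q \<psi> where "P r = (if r then P1 else P0)" and "Q r = (if r then Q1 else Q0)"
    and "\<psi> r = (if r then \<psi>1 else \<psi>0)" for r
  have fJK: "finite (J r)" "finite (K r)" for r using 0 1 by (auto simp: J_def K_def)
  have P: "pvm_family (J r) X A (P r)" and Q: "pvm_family (K r) Y B (Q r)" for r
    using 0 1 by (auto simp: J_def K_def P_def Q_def)
  have \<psi>: "\<psi> r \<in> ell2_on (J r \<times> K r)" "norm (\<psi> r) = 1" for r using 0 1 by (auto simp: J_def K_def \<psi>_def)
  have sum_exists: "\<exists>D. \<forall>u r. slice r (blinfun_apply D u) = T r (slice r u)" for T :: "bool \<Rightarrow> nat op"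
    by (rule direct_sum_exists[of T "max (norm (T True)) (norm (T False))"]) (metis (full_types) max.cobounded1 max.cobounded2)
  have "\<forall>x a. \<exists>D. \<forall>u r. slice r (blinfun_apply D u) = P r x a (slice r u)"
    by (intro allI sum_exists)
  then obtain D where D: "\<And>x a u r. slice r (blinfun_apply (D x a) u) = P r x a (slice r u)" by metis
  have "\<forall>y b. \<exists>E. \<forall>u r. slice r (blinfun_apply E u) = Q r y b (slice r u)"
    by (intro allI sum_exists)
  then obtain E where E: "\<And>y b u r. slice r (blinfun_apply (E y b) u) = Q r y b (slice r u)" by metis
  have Dp: "pvm_family (Sigma UNIV J) X A D" by (rule block_diagonal_pvm[OF P D])
  have Ep: "pvm_family (Sigma UNIV K) Y B E" by (rule block_diagonal_pvm[OF Q E])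
  define \<Psi> where "\<Psi> r = (\<Sum>p\<in>J r \<times> K r. coord (\<psi> r) p *\<^sub>C (ket (r, fst p) \<otimes>\<^sub>v ket (r, snd p)))" for r

  have mat: "cinner (ket (r, i)) (D x a (ket (s, k))) = (if r = s then cinner (ket i) (P r x a (ket k)) else 0)"
    "cinner (ket (r, i)) (E y b (ket (s, k))) = (if r = s then cinner (ket i) (Q r y b (ket k)) else 0)"
    for r s x a y b i k
    by (simp_all add: cinner_ket_left coord_via_slice D E slice_ket)
  have lin: "clinear_op (D x a)" "clinear_op (P r x a)" if "x \<in> X" "a \<in> A" for x a r
    using projectionsD(2)[OF pvm_projection[OF Dp that]] projectionsD(2)[OF pvm_projection[OF P that]] .
  have lin': "clinear_op (E y b)" "clinear_op (Q r y b)" if "y \<in> Y" "b \<in> B" for y b r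
    using projectionsD(2)[OF pvm_projection[OF Ep that]] projectionsD(2)[OF pvm_projection[OF Q that]] .
  have diag: "cinner (\<Psi> r) ((D x a \<otimes>\<^sub>o E y b) (\<Psi> r)) = cinner (\<psi> r) ((P r x a \<otimes>\<^sub>o Q r y b) (\<psi> r))"
    if "x \<in> X" "y \<in> Y" "a \<in> A" "b \<in> B" for x y a b r
    by (rule transfer_matrix_coefficients[OF fJK \<psi>(1) _ _ _ _ _ _ \<Psi>_def])
      (use that in \<open>simp_all add: lin lin' mat\<close>)
  \<comment> \<open>the two vectors lie in different blocks, which the operators preserve\<close>
  have off: "cinner (\<Psi> r) ((D x a \<otimes>\<^sub>o E y b) (\<Psi> s)) = 0"
    if "x \<in> X" "y \<in> Y" "a \<in> A" "b \<in> B" "r \<noteq> s" for x y a b r s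
    unfolding \<Psi>_def
    by (subst cinner_tensor_sums[where w = "\<lambda>i. ket (r, i)" and z = "\<lambda>i. ket (r, i)"
          and w' = "\<lambda>i. ket (s, i)" and z' = "\<lambda>i. ket (s, i)"]) (use that in \<open>simp_all add: lin lin' mat\<close>)

  have id: "id_blinfun \<otimes>\<^sub>o id_blinfun = (id_blinfun :: ((bool \<times> nat) \<times> (bool \<times> nat)) op)"
    by (rule tensor_op_unique) simp
  have norm1: "norm (\<Psi> r) = 1" for r
    unfolding \<psi>(2)[of r, symmetric]
    by (rule transfer_norm[OF fJK \<psi>(1) _ _ \<Psi>_def]) (simp_all add: cinner_ket)
  have orth: "cinner (\<Psi> r) (\<Psi> s) = 0" if "r \<noteq> s" for r s
  proof -
    have "cinner (\<Psi> r) ((id_blinfun \<otimes>\<^sub>o id_blinfun) (\<Psi> s)) = 0"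
      unfolding \<Psi>_def
      by (subst cinner_tensor_sums[where w = "\<lambda>i. ket (r, i)" and z = "\<lambda>i. ket (r, i)"
          and w' = "\<lambda>i. ket (s, i)" and z' = "\<lambda>i. ket (s, i)"]) (use that in \<open>simp_all add: cinner_ket\<close>)
    thus ?thesis by (simp add: id)
  qed
  have self1: "cinner (\<Psi> r) (\<Psi> r) = 1" for r by (simp add: cinner_self norm1)
  define \<Phi> where "\<Phi> = sqrt (1 - t) *\<^sub>R \<Psi> False + sqrt t *\<^sub>R \<Psi> True"
  have sq: "complex_of_real (sqrt t) * (of_real (sqrt t) * c) = of_real t * c"
    "complex_of_real (sqrt (1 - t)) * (of_real (sqrt (1 - t)) * c) = of_real (1 - t) * c" for c
    using t by (simp_all add: mult.assoc[symmetric] del: of_real_diff flip: of_real_mult)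
  have "complex_of_real ((norm \<Phi>)\<^sup>2) = 1"
    unfolding cinner_self[symmetric] \<Phi>_def
    using t by (simp add: cinner_add_left cinner_add_right cinner_scaleR_left cinner_scaleR_right orth self1
        del: of_real_diff flip: of_real_mult of_real_add)
  hence "(norm \<Phi>)\<^sup>2 = 1\<^sup>2" by (simp flip: of_real_power)
  hence "norm \<Phi> = 1" by (subst (asm) power2_eq_iff_nonneg) auto
  moreover have "\<Psi> r \<in> ell2_on (Sigma UNIV J \<times> Sigma UNIV K)" for r
    unfolding \<Psi>_def
    by (intro sum_in_ell2_on ell2_on_scaleC tensor_in_ell2_on) (auto simp: ell2_on_def coord_ket)
  hence "\<Phi> \<in> ell2_on (Sigma UNIV J \<times> Sigma UNIV K)"
    unfolding \<Phi>_def scaleR_scaleC by (intro ell2_on_add ell2_on_scaleC)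
  moreover have "finite (Sigma UNIV J)" "finite (Sigma UNIV K)" using fJK by auto
  ultimately have "correlation X Y A B D E \<Phi> \<in> C_q X Y A B"
    by (intro finite_support_correlation_C_q[OF Dp Ep fin]) auto
  moreover have "correlation X Y A B D E \<Phi> (x, y, a, b) = (1 - t) * q0 (x, y, a, b) + t * q1 (x, y, a, b)"
    if "x \<in> X" "y \<in> Y" "a \<in> A" "b \<in> B" for x y a b
  proof -
    have "complex_of_real (correlation X Y A B D E \<Phi> (x, y, a, b)) = cinner \<Phi> ((D x a \<otimes>\<^sub>o E y b) \<Phi>)"
      by (rule correlation_eq[OF Dp Ep that])
    also have "\<dots> = of_real (1 - t) * cinner (\<Psi> False) ((D x a \<otimes>\<^sub>o E y b) (\<Psi> False)) +
        of_real t * cinner (\<Psi> True) ((D x a \<otimes>\<^sub>o E y b) (\<Psi> True))"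
      unfolding \<Phi>_def
      by (simp add: cinner_add_left cinner_add_right cinner_scaleR_left cinner_scaleR_right blinfun.add_right
          blinfun.scaleR_right off that sq del: of_real_diff)
    also have "\<dots> = of_real ((1 - t) * q0 (x, y, a, b) + t * q1 (x, y, a, b))"
      using that by (simp add: diag P_def Q_def \<psi>_def 0 1)
    finally show ?thesis unfolding of_real_eq_iff .
  qed
  ultimately show ?thesis by (intro bexI) auto
qed

section \<open>States of the minimal tensor product are limits of quantum correlations\<close>

lemma finite_support_dense:
  fixes u :: "('i \<times> 'j) ell2"
  assumes "u \<in> ell2_on (I \<times> K)"
  shows "\<exists>f. (f \<longlongrightarrow> u) (finite_subsets_at_top (UNIV :: ('i \<times> 'j) set)) \<and>
    (\<forall>E. finite E \<longrightarrow> (\<exists>F G. finite F \<and> F \<subseteq> I \<and> finite G \<and> G \<subseteq> K \<and> f E \<in> ell2_on (F \<times> G)))"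
proof -
  define f where "f E = (\<Sum>i\<in>E. coord u i *\<^sub>C ket i)" for E
  have lim: "(f \<longlongrightarrow> u) (finite_subsets_at_top UNIV)"
    using ket_expansion[of u] by (simp add: has_sum_def f_def[abs_def])
  have mem: "f E \<in> ell2_on ((fst ` E \<inter> I) \<times> (snd ` E \<inter> K))" for E
    unfolding f_def
  proof (rule sum_in_ell2_on)
    fix p assume "p \<in> E"
    thus "coord u p *\<^sub>C ket p \<in> ell2_on ((fst ` E \<inter> I) \<times> (snd ` E \<inter> K))"
      using assms by (cases p) (force simp: ell2_on_def coord_ket image_iff)
  qed
  show ?thesis
  proof (intro exI[of _ f] conjI allI impI lim)
    fix E :: "('i \<times> 'j) set" assume "finite E"
    thus "\<exists>F G. finite F \<and> F \<subseteq> I \<and> finite G \<and> G \<subseteq> K \<and> f E \<in> ell2_on (F \<times> G)"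
      by (intro exI[of _ "fst ` E \<inter> I"] exI[of _ "snd ` E \<inter> K"]) (simp add: mem)
  qed
qed

text \<open>A linear inequality for quantum correlations is an inequality \<open>\<langle>v, T v\<rangle> \<ge> s \<parallel>v\<parallel>\<^sup>2\<close> for
  finitely supported \<open>v\<close>. It extends to all \<open>v\<close> by density and then, by positivity of states,
  to the correlation of a state.\<close>

lemma state_satisfies_C_q_inequalities:
  fixes X :: "'x set" and Y :: "'y set" and A :: "'a set" and B :: "'b set"
  defines "I \<equiv> univ_index X A" and "K \<equiv> univ_index Y B"
  assumes fin: "finite X" "finite Y" "finite A" "finite B"
    and state: "state_on (I \<times> K) (spatial_tensor (univ_alg X A) (univ_alg Y B)) \<tau>"
    and p\<tau>: "\<And>x y a b. x \<in> X \<Longrightarrow> y \<in> Y \<Longrightarrow> a \<in> A \<Longrightarrow> b \<in> B \<Longrightarrow>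
        complex_of_real (p (x, y, a, b)) = \<tau> (univ_gen X A x a \<otimes>\<^sub>o univ_gen Y B y b)"
    and ineq: "\<And>q. q \<in> C_q X Y A B \<Longrightarrow> s \<le> (\<Sum>t\<in>X \<times> Y \<times> A \<times> B. c t * q t)"
  shows "s \<le> (\<Sum>t\<in>X \<times> Y \<times> A \<times> B. c t * p t)"
proof -
  let ?M = "spatial_tensor (univ_alg X A) (univ_alg Y B)" and ?D = "X \<times> Y \<times> A \<times> B"
  interpret cstar_state "I \<times> K" ?M \<tau>
    unfolding I_def K_def
    by unfold_locales
      (intro cstar_subalgebra_spatial_tensor cstar_subalgebra_univ_alg state[unfolded I_def K_def])+
  note P = univ_gen_pvm[of X A, folded I_def] and Q = univ_gen_pvm[of Y B, folded K_def]
  define G where "G = (\<lambda>(x, y, a, b). univ_gen X A x a \<otimes>\<^sub>o univ_gen Y B y b)"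
  have Gpr: "G t \<in> projections (I \<times> K)" if "t \<in> ?D" for t
    using that by (auto simp: G_def intro!: tensor_projection pvm_projection[OF P] pvm_projection[OF Q])
  have GM: "G t \<in> ?M" if "t \<in> ?D" for t
    using that by (auto simp: G_def intro!: tensor_mem_spatial univ_gen_mem)
  have G\<tau>: "\<tau> (G t) = of_real (p t)" if "t \<in> ?D" for t using that by (auto simp: G_def p\<tau>)
  define T where "T = (\<Sum>t\<in>?D. c t *\<^sub>R G t)"
  have TM: "T \<in> ?M" unfolding T_def by (intro sum_mem scaleR_mem GM)
  have Gc: "cinner v (G t v) = of_real ((norm (G t v))\<^sup>2)" if "t \<in> ?D" for t v
    by (rule cinner_projection[OF Gpr[OF that]])
  have vTv: "cinner v (T v) = of_real (\<Sum>t\<in>?D. c t * Re (cinner v (G t v)))" for v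
    by (simp add: T_def blinfun_sum_left cinner_sum_right blinfun.scaleR_left cinner_scaleR_right Gc)
  have Tadj: "adj T = T"
  proof (rule adj_unique)
    show "cinner (T u) v = cinner u (T v)" for u v
      by (simp add: T_def blinfun_sum_left cinner_sum_right cinner_sum_left blinfun.scaleR_left
          cinner_scaleR_right cinner_scaleR_left projectionsD(6)[OF Gpr])
  qed
  have unit: "s \<le> Re (cinner v (T v))"
    if v: "v \<in> ell2_on (F \<times> H)" "norm v = 1" and F: "finite F" "F \<subseteq> I" "finite H" "H \<subseteq> K" for v F H
  proof -
    let ?q = "correlation X Y A B (univ_gen X A) (univ_gen Y B) v"
    have "?q \<in> C_q X Y A B" by (rule finite_support_correlation_C_q[OF P Q fin F v])
    hence "s \<le> (\<Sum>t\<in>?D. c t * ?q t)" by (rule ineq)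
    also have "\<dots> = Re (cinner v (T v))"
      unfolding vTv Re_complex_of_real by (intro sum.cong refl) (auto simp: correlation_def G_def)
    finally show ?thesis .
  qed
  have fins: "s * (norm v)\<^sup>2 \<le> Re (cinner v (T v))"
    if v: "v \<in> ell2_on (F \<times> H)" and F: "finite F" "F \<subseteq> I" "finite H" "H \<subseteq> K" for v F H
  proof (cases "v = 0")
    case False
    define w where "w = (1 / norm v) *\<^sub>R v"
    have "norm w = 1" using False by (simp add: w_def)
    moreover have "w \<in> ell2_on (F \<times> H)" unfolding w_def scaleR_scaleC by (rule ell2_on_scaleC[OF v])
    ultimately have "s \<le> Re (cinner w (T w))" by (intro unit[OF _ _ F])
    also have "\<dots> = Re (cinner v (T v)) / (norm v)\<^sup>2"
      by (simp add: w_def blinfun.scaleR_right cinner_scaleR_left cinner_scaleR_right power2_eq_square Re_divide_of_real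
          flip: of_real_mult)
    finally show ?thesis using False by (simp add: field_simps)
  qed simp
  have all: "0 \<le> Re (cinner u ((T - s *\<^sub>R id_on (I \<times> K)) u))" if u: "u \<in> ell2_on (I \<times> K)" for u
  proof -
    obtain f :: "((('x, 'a) rep \<times> nat) \<times> (('y, 'b) rep \<times> nat)) set \<Rightarrow> _"
      where f: "(f \<longlongrightarrow> u) (finite_subsets_at_top UNIV)"
      "\<And>E. finite E \<Longrightarrow> \<exists>F G. finite F \<and> F \<subseteq> I \<and> finite G \<and> G \<subseteq> K \<and> f E \<in> ell2_on (F \<times> G)"
      using finite_support_dense[OF u] by blast
    have "s * (norm u)\<^sup>2 \<le> inner u (T u)"
    proof (rule tendsto_le)
      show "((\<lambda>E. inner (f E) (T (f E))) \<longlongrightarrow> inner u (T u)) (finite_subsets_at_top UNIV)"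
        by (intro tendsto_intros f)
      show "((\<lambda>E. s * (norm (f E))\<^sup>2) \<longlongrightarrow> s * (norm u)\<^sup>2) (finite_subsets_at_top UNIV)"
        by (intro tendsto_intros f)
      show "\<forall>\<^sub>F E in finite_subsets_at_top UNIV. s * (norm (f E))\<^sup>2 \<le> inner (f E) (T (f E))"
      proof (rule eventually_finite_subsets_at_top_weakI)
        fix E :: "((('x, 'a) rep \<times> nat) \<times> (('y, 'b) rep \<times> nat)) set" assume "finite E"
        then obtain F H where "finite F" "F \<subseteq> I" "finite H" "H \<subseteq> K" "f E \<in> ell2_on (F \<times> H)"
          using f(2) by metis
        thus "s * (norm (f E))\<^sup>2 \<le> inner (f E) (T (f E))" unfolding inner_ell2_def by (intro fins)
      qed
    qed simp
    thus ?thesis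
      using u by (simp add: blinfun.diff_left blinfun.scaleR_left cinner_diff_right cinner_scaleR_right
          restrict_ell2_eq_iff[symmetric] cinner_self inner_ell2_def)
  qed
  have "\<tau> (T - s *\<^sub>R id_on (I \<times> K)) \<in> \<real>\<^sub>\<ge>\<^sub>0"
  proof (rule state_positive[OF _ _ all])
    show "adj (T - s *\<^sub>R id_on (I \<times> K)) = T - s *\<^sub>R id_on (I \<times> K)"
      by (simp add: adj_diff clinear TM Tadj scaleR_eq_scaleC_op clinear_scaleC_op adj_scaleC)
  qed (simp_all add: TM diff_mem scaleR_mem unit_mem)
  moreover have "\<tau> (T - s *\<^sub>R id_on (I \<times> K)) = of_real ((\<Sum>t\<in>?D. c t * p t) - s)"
    by (simp add: state_diff TM scaleR_mem unit_mem state_scaleR state_unit)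
      (simp add: T_def state_sum scaleR_mem GM state_scaleR G\<tau>)
  ultimately show ?thesis by (simp del: of_real_diff)
qed

text \<open>A correlation \<open>q0\<close> that nearly minimises the distance to \<open>p\<close> nearly satisfies the
  variational inequality of a closest point, \<open>\<langle>q0 - p, q\<rangle> \<ge> \<langle>q0 - p, q0\<rangle>\<close> for all \<open>q\<close>. If this
  inequality passes to \<open>q = p\<close>, then \<open>q0\<close> is close to \<open>p\<close>. In this way a quantitative argument takes
  the place of a separating hyperplane.\<close>

lemma approximation_by_linear_inequalities:
  fixes p :: "'t \<Rightarrow> real"
  assumes fin: "finite D" and ne: "C \<noteq> {}"
    and bounded: "\<And>q t. q \<in> C \<Longrightarrow> t \<in> D \<Longrightarrow> q t \<in> {0..1}"
    and convex: "\<And>q0 q1 r. q0 \<in> C \<Longrightarrow> q1 \<in> C \<Longrightarrow> 0 \<le> r \<Longrightarrow> r \<le> 1 \<Longrightarrow>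
      \<exists>q\<in>C. \<forall>t\<in>D. q t = (1 - r) * q0 t + r * q1 t"
    and ineq: "\<And>c s. (\<And>q. q \<in> C \<Longrightarrow> s \<le> (\<Sum>t\<in>D. c t * q t)) \<Longrightarrow> s \<le> (\<Sum>t\<in>D. c t * p t)"
    and \<epsilon>: "\<epsilon> > 0"
  shows "\<exists>q\<in>C. \<forall>t\<in>D. \<bar>q t - p t\<bar> < \<epsilon>"
proof -
  define d where "d q = (\<Sum>t\<in>D. (q t - p t)\<^sup>2)" for q
  define \<delta> where "\<delta> = Inf (d ` C)"
  define N where "N = real (card D)"
  \<comment> \<open>\<open>\<eta>\<close> is the step length towards \<open>q\<close>, and \<open>\<eta>\<^sup>2\<close> the tolerance for the minimum; the error is then linear in \<open>\<eta>\<close>\<close>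
  define \<eta> where "\<eta> = min 1 (\<epsilon>\<^sup>2 / (1 + N))"
  have N: "N \<ge> 0" by (simp add: N_def)
  have \<eta>: "0 < \<eta>" "\<eta> \<le> 1" "\<eta> * (1 + N) \<le> \<epsilon>\<^sup>2"
  proof -
    show "0 < \<eta>" "\<eta> \<le> 1" using \<epsilon> N by (simp_all add: \<eta>_def)
    have "\<eta> * (1 + N) \<le> (\<epsilon>\<^sup>2 / (1 + N)) * (1 + N)" using N by (intro mult_right_mono) (auto simp: \<eta>_def)
    thus "\<eta> * (1 + N) \<le> \<epsilon>\<^sup>2" using N by simp
  qed
  have bdd: "bdd_below (d ` C)" by (rule bdd_belowI[of _ 0]) (auto simp: d_def intro: sum_nonneg)
  have "\<delta> < \<delta> + \<eta>\<^sup>2" using \<eta> by simp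
  then obtain q0 where q0: "q0 \<in> C" "d q0 < \<delta> + \<eta>\<^sup>2"
    using cInf_less_iff[OF _ bdd, of "\<delta> + \<eta>\<^sup>2"] ne by (auto simp: \<delta>_def)
  define s where "s = (\<Sum>t\<in>D. (q0 t - p t) * q0 t) - \<eta> * (1 + N) / 2"
  have "s \<le> (\<Sum>t\<in>D. (q0 t - p t) * p t)"
  proof (rule ineq)
    fix q assume q: "q \<in> C"
    define b where "b = (\<Sum>t\<in>D. (q0 t - p t) * (q t - q0 t))"
    obtain q' where q': "q' \<in> C" "\<And>t. t \<in> D \<Longrightarrow> q' t = (1 - \<eta>) * q0 t + \<eta> * q t"
      using convex[OF q0(1) q, of \<eta>] \<eta> by auto
    have "\<delta> \<le> d q'" unfolding \<delta>_def using q'(1) bdd by (intro cInf_lower) auto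
    also have "d q' = (\<Sum>t\<in>D. (q0 t - p t)\<^sup>2 + (2 * \<eta>) * ((q0 t - p t) * (q t - q0 t)) + \<eta>\<^sup>2 * (q t - q0 t)\<^sup>2)"
      unfolding d_def by (intro sum.cong refl) (simp add: q' power2_eq_square algebra_simps)
    also have "\<dots> = d q0 + 2 * \<eta> * b + \<eta>\<^sup>2 * (\<Sum>t\<in>D. (q t - q0 t)\<^sup>2)"
      by (simp add: sum.distrib d_def b_def sum_distrib_left)
    also have "(\<Sum>t\<in>D. (q t - q0 t)\<^sup>2) \<le> N"
    proof -
      have "(q t - q0 t)\<^sup>2 \<le> 1" if "t \<in> D" for t
        using bounded[OF q that] bounded[OF q0(1) that] by (auto simp: abs_square_le_1)
      hence "(\<Sum>t\<in>D. (q t - q0 t)\<^sup>2) \<le> (\<Sum>t\<in>D. 1)" by (intro sum_mono)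
      thus ?thesis by (simp add: N_def)
    qed
    finally have "\<delta> \<le> d q0 + 2 * \<eta> * b + \<eta>\<^sup>2 * N" using \<eta> by (simp add: mult_left_mono)
    hence "0 \<le> \<eta> * (\<eta> * (1 + N) + 2 * b)" using q0(2) by (simp add: algebra_simps power2_eq_square)
    hence "0 \<le> \<eta> * (1 + N) + 2 * b" using \<eta> by (simp add: zero_le_mult_iff)
    moreover have "(\<Sum>t\<in>D. (q0 t - p t) * q t) = (\<Sum>t\<in>D. (q0 t - p t) * q0 t) + b"
      by (simp add: b_def sum.distrib[symmetric] algebra_simps)
    ultimately show "s \<le> (\<Sum>t\<in>D. (q0 t - p t) * q t)" by (simp add: s_def)
  qed
  moreover have "d q0 = (\<Sum>t\<in>D. (q0 t - p t) * q0 t) - (\<Sum>t\<in>D. (q0 t - p t) * p t)"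
    by (simp add: d_def sum_subtractf[symmetric] power2_eq_square algebra_simps)
  ultimately have "d q0 \<le> \<eta> * (1 + N) / 2" by (simp add: s_def)
  moreover have "\<eta> * (1 + N) / 2 \<le> \<epsilon>\<^sup>2 / 2" using \<eta>(3) by (rule divide_right_mono) simp
  moreover have "0 < \<epsilon>\<^sup>2" using \<epsilon> by simp
  ultimately have d: "d q0 < \<epsilon>\<^sup>2" by linarith
  have "\<bar>q0 t - p t\<bar> < \<epsilon>" if "t \<in> D" for t
  proof -
    have "\<bar>q0 t - p t\<bar>\<^sup>2 \<le> d q0" unfolding d_def using member_le_sum[OF that, of "\<lambda>t. (q0 t - p t)\<^sup>2"] fin by simp
    hence "\<bar>q0 t - p t\<bar>\<^sup>2 < \<epsilon>\<^sup>2" using d by simp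
    thus ?thesis by (rule power2_less_imp_less) (use \<epsilon> in simp)
  qed
  thus ?thesis using q0(1) by blast
qed

text \<open>All functions concerned agree outside of \<open>D\<close>, so uniform approximation on \<open>D\<close> gives pointwise
  convergence everywhere.\<close>

lemma closure_of_finitely_determined:
  fixes p :: "'t \<Rightarrow> real"
  assumes approx: "\<And>\<epsilon>. \<epsilon> > 0 \<Longrightarrow> \<exists>q\<in>C. \<forall>t\<in>D. \<bar>q t - p t\<bar> < \<epsilon>"
    and ext: "p \<in> extensional D" "\<And>q. q \<in> C \<Longrightarrow> q \<in> extensional D"
  shows "p \<in> closure C"
proof -
  have "\<exists>q\<in>C. \<forall>t\<in>D. \<bar>q t - p t\<bar> < 1 / Suc n" for n by (rule approx) simp
  then obtain q where q: "\<And>n. q n \<in> C" "\<And>n t. t \<in> D \<Longrightarrow> \<bar>q n t - p t\<bar> < 1 / Suc n" by metis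
  have "(\<lambda>n. q n t) \<longlonglongrightarrow> p t" for t
  proof (cases "t \<in> D")
    case True
    show ?thesis
    proof (rule Lim_null_comparison[THEN LIM_zero_cancel])
      show "\<forall>\<^sub>F n in sequentially. norm (q n t - p t) \<le> 1 / Suc n"
        using q(2)[OF True] by (auto intro!: always_eventually less_imp_le)
      show "(\<lambda>n. 1 / real (Suc n)) \<longlonglongrightarrow> 0" by (rule LIMSEQ_Suc[OF lim_1_over_n])
    qed
  next
    case False
    hence "q n t = p t" for n using ext(1) ext(2)[OF q(1)[of n]] by (simp add: extensional_def)
    thus ?thesis by simp
  qed
  hence "limitin (product_topology (\<lambda>_. euclidean) UNIV) q p sequentially"
    by (simp add: limitin_componentwise)
  hence "q \<longlonglongrightarrow> p" by (simp add: euclidean_product_topology)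
  thus ?thesis
    by (rule Lim_in_closed_set[rotated -1]) (use q(1) closure_subset in \<open>auto intro!: always_eventually\<close>)
qed

text \<open>A state exists only if the universal representations are nonzero, and then a basis vector
  gives a quantum correlation to start from.\<close>

theorem state_imp_C_qa:
  fixes X :: "'x set" and Y :: "'y set" and A :: "'a set" and B :: "'b set"
  assumes fin: "finite X" "finite Y" "finite A" "finite B"
    and state: "state_on (univ_index X A \<times> univ_index Y B) (spatial_tensor (univ_alg X A) (univ_alg Y B)) \<tau>"
    and p: "p \<in> C_ns X Y A B"
    and p\<tau>: "\<And>x y a b. x \<in> X \<Longrightarrow> y \<in> Y \<Longrightarrow> a \<in> A \<Longrightarrow> b \<in> B \<Longrightarrow>
        complex_of_real (p (x, y, a, b)) = \<tau> (univ_gen X A x a \<otimes>\<^sub>o univ_gen Y B y b)"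
  shows "p \<in> C_qa X Y A B"
proof -
  let ?I = "univ_index X A" and ?K = "univ_index Y B"
  interpret cstar_state "?I \<times> ?K" "spatial_tensor (univ_alg X A) (univ_alg Y B)" \<tau>
    by unfold_locales (intro cstar_subalgebra_spatial_tensor cstar_subalgebra_univ_alg state)+
  have "?I \<times> ?K \<noteq> {}"
  proof
    assume "?I \<times> ?K = {}"
    hence "id_on (?I \<times> ?K) = 0"
      by (simp only:) (intro blinfun_eqI ell2_eqI, simp add: restrict_ell2.rep_eq)
    thus False using state_unit state_zero by simp
  qed
  then obtain i k where ik: "i \<in> ?I" "k \<in> ?K" by auto
  have "norm (ket (i, k)) = 1" by (rule norm_ket)
  hence "correlation X Y A B (univ_gen X A) (univ_gen Y B) (ket (i, k)) \<in> C_q X Y A B"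
    by (intro finite_support_correlation_C_q[OF univ_gen_pvm univ_gen_pvm fin, of "{i}" "{k}"])
      (use ik in \<open>auto simp: ell2_on_def coord_ket\<close>)
  hence ne: "C_q X Y A B \<noteq> {}" by blast
  have sub: "C_q X Y A B \<subseteq> X \<times> Y \<times> A \<times> B \<rightarrow>\<^sub>E {0..1}" by (auto simp: C_q_def C_ns_def)
  have "\<exists>q\<in>C_q X Y A B. \<forall>t\<in>X \<times> Y \<times> A \<times> B. \<bar>q t - p t\<bar> < \<epsilon>" if "\<epsilon> > 0" for \<epsilon>
  proof (rule approximation_by_linear_inequalities[OF _ ne _ _ _ that])
    show "q t \<in> {0..1}" if "q \<in> C_q X Y A B" "t \<in> X \<times> Y \<times> A \<times> B" for q t
      using sub that by blast
    show "s \<le> (\<Sum>t\<in>X \<times> Y \<times> A \<times> B. c t * p t)"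
      if "\<And>q. q \<in> C_q X Y A B \<Longrightarrow> s \<le> (\<Sum>t\<in>X \<times> Y \<times> A \<times> B. c t * q t)" for c s
      by (rule state_satisfies_C_q_inequalities[OF fin state p\<tau> that])
  qed (use fin C_q_convex in blast)+
  moreover have "p \<in> extensional (X \<times> Y \<times> A \<times> B)" using p by (auto simp: C_ns_def PiE_def)
  moreover have "q \<in> extensional (X \<times> Y \<times> A \<times> B)" if "q \<in> C_q X Y A B" for q
    using sub that by (auto simp: PiE_def)
  ultimately show ?thesis unfolding C_qa_def by (rule closure_of_finitely_determined)
qed

section \<open>Limits of quantum correlations are states of the minimal tensor product\<close>

text \<open>A pair of representations is a block of the pair of universal representations, so its
  vectors are vectors there.\<close>

lemma C_q_vector_state:
  assumes "q \<in> C_q X Y A B"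
  shows "\<exists>\<Psi> \<in> ell2_on (univ_index X A \<times> univ_index Y B). norm \<Psi> = 1 \<and>
    (\<forall>x\<in>X. \<forall>y\<in>Y. \<forall>a\<in>A. \<forall>b\<in>B.
      complex_of_real (q (x, y, a, b)) = cinner \<Psi> ((univ_gen X A x a \<otimes>\<^sub>o univ_gen Y B y b) \<Psi>))"
proof -
  obtain J K :: "nat set" and P Q \<psi> where q: "finite J" "finite K" "pvm_family J X A P" "pvm_family K Y B Q"
    "\<psi> \<in> ell2_on (J \<times> K)" "norm \<psi> = 1"
    "\<And>x y a b. x \<in> X \<Longrightarrow> y \<in> Y \<Longrightarrow> a \<in> A \<Longrightarrow> b \<in> B \<Longrightarrow>
      complex_of_real (q (x, y, a, b)) = cinner \<psi> ((P x a \<otimes>\<^sub>o Q y b) \<psi>)"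
    by (rule C_q_obtain[OF assms], rule that)
  define r s where "r = (J, P)" and "s = (K, Q)"
  have r: "r \<in> univ_reps X A" "snd r = P" and s: "s \<in> univ_reps Y B" "snd s = Q"
    using q by (auto simp: r_def s_def univ_reps_def)
  define \<Psi> where "\<Psi> = (\<Sum>p\<in>J \<times> K. coord \<psi> p *\<^sub>C (ket (r, fst p) \<otimes>\<^sub>v ket (s, snd p)))"

  have "\<Psi> \<in> ell2_on (univ_index X A \<times> univ_index Y B)"
    unfolding \<Psi>_def using r s
    by (intro sum_in_ell2_on ell2_on_scaleC tensor_in_ell2_on)
      (auto simp: ell2_on_def coord_ket univ_index_def r_def s_def)
  moreover have "norm \<Psi> = 1"
    unfolding q(6)[symmetric] by (rule transfer_norm[OF q(1,2,5) _ _ \<Psi>_def]) (simp_all add: cinner_ket)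
  moreover have "complex_of_real (q (x, y, a, b)) = cinner \<Psi> ((univ_gen X A x a \<otimes>\<^sub>o univ_gen Y B y b) \<Psi>)"
    if xyab: "x \<in> X" "y \<in> Y" "a \<in> A" "b \<in> B" for x y a b
    unfolding q(7)[OF xyab]
  proof (rule transfer_matrix_coefficients[OF q(1,2,5) _ _ _ _ _ _ \<Psi>_def, symmetric])
    show "clinear_op (P x a)" "clinear_op (Q y b)"
      using projectionsD(2)[OF pvm_projection[OF q(3) xyab(1,3)]]
        projectionsD(2)[OF pvm_projection[OF q(4) xyab(2,4)]] .
    show "clinear_op (univ_gen X A x a)" "clinear_op (univ_gen Y B y b)"
      using xyab by (auto intro: bounded_ops_clinear univ_gen_bounded_ops)
  qed (simp_all add: cinner_ket_left coord_via_slice slice_univ_gen xyab slice_ket r s)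
  ultimately show ?thesis by blast
qed

text \<open>The functionals \<open>R \<mapsto> \<langle>\<psi>\<^sub>n, R \<psi>\<^sub>n\<rangle>\<close> lie in a product of discs, which is compact by
  Tychonoff's theorem. Instead of passing to a subnet, the convergence is along a filter \<open>G\<close>.\<close>

lemma vector_states_cluster:
  fixes \<psi> :: "nat \<Rightarrow> 'i ell2"
  assumes unit: "\<And>n. norm (\<psi> n) = 1"
  shows "\<exists>G (\<tau> :: 'i op \<Rightarrow> complex). G \<noteq> bot \<and> G \<le> sequentially \<and>
    (\<forall>R. ((\<lambda>n. cinner (\<psi> n) (blinfun_apply R (\<psi> n))) \<longlongrightarrow> \<tau> R) G)"
proof -
  define f where "f n R = cinner (\<psi> n) (blinfun_apply R (\<psi> n))" for n and R :: "'i op"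
  define U where "U = PiE UNIV (\<lambda>R :: 'i op. cball (0 :: complex) (norm R))"
  have "compactin (product_topology (\<lambda>_. euclidean) UNIV) U"
    unfolding U_def compactin_PiE by simp
  hence U: "compact U" by (simp add: euclidean_product_topology)
  have "f n \<in> U" for n
  proof -
    have "cmod (f n R) \<le> norm R" for R
      using cmod_cinner_le[of "\<psi> n" "R (\<psi> n)"] norm_blinfun[of R "\<psi> n"] by (simp add: f_def unit)
    thus ?thesis by (simp add: U_def PiE_iff)
  qed
  hence "eventually (\<lambda>g. g \<in> U) (filtermap f sequentially)" by (simp add: eventually_filtermap)
  moreover have "filtermap f sequentially \<noteq> bot" by (simp add: filtermap_bot_iff)
  ultimately obtain \<tau> where \<tau>: "inf (nhds \<tau>) (filtermap f sequentially) \<noteq> bot"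
    using U unfolding compact_filter by blast
  define G where "G = inf (filtercomap f (nhds \<tau>)) sequentially"
  have "G \<noteq> bot"
  proof
    assume "G = bot"
    hence "eventually (\<lambda>_. False) G" by simp
    then obtain P Q where PQ: "eventually P (filtercomap f (nhds \<tau>))" "eventually Q sequentially"
      "\<And>n. \<not> (P n \<and> Q n)" unfolding G_def eventually_inf by blast
    then obtain P' where P': "eventually P' (nhds \<tau>)" "\<And>n. P' (f n) \<Longrightarrow> P n"
      unfolding eventually_filtercomap by blast
    have "eventually (\<lambda>n. \<not> P' (f n)) sequentially"
      using PQ(2) by eventually_elim (use PQ(3) P'(2) in blast)
    hence "eventually (\<lambda>g. \<not> P' g) (filtermap f sequentially)" by (simp add: eventually_filtermap)
    hence "eventually (\<lambda>_. False) (inf (nhds \<tau>) (filtermap f sequentially))"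
      using P'(1) unfolding eventually_inf by blast
    thus False using \<tau> by (simp add: eventually_False)
  qed
  moreover have "G \<le> sequentially" by (simp add: G_def)
  moreover have "((\<lambda>n. f n R) \<longlongrightarrow> \<tau> R) G" for R
  proof -
    have "filterlim f (nhds \<tau>) G"
      by (rule filterlim_mono[OF filterlim_filtercomap order_refl]) (simp add: G_def)
    hence "limitin (product_topology (\<lambda>_. euclidean) UNIV) f \<tau> G" by (simp add: euclidean_product_topology)
    thus ?thesis by (simp add: limitin_componentwise)
  qed
  ultimately show ?thesis unfolding f_def by blast
qed

text \<open>The axioms of a state are closed conditions that each vector state satisfies.\<close>

theorem C_qa_imp_state:
  fixes X :: "'x set" and Y :: "'y set" and A :: "'a set" and B :: "'b set"
  assumes fin: "finite X" "finite Y" "finite A" "finite B" and p: "p \<in> C_qa X Y A B"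
  shows "\<exists>\<tau>. state_on (univ_index X A \<times> univ_index Y B) (spatial_tensor (univ_alg X A) (univ_alg Y B)) \<tau> \<and>
    (\<forall>x\<in>X. \<forall>y\<in>Y. \<forall>a\<in>A. \<forall>b\<in>B.
      complex_of_real (p (x, y, a, b)) = \<tau> (univ_gen X A x a \<otimes>\<^sub>o univ_gen Y B y b))"
proof -
  let ?D = "X \<times> Y \<times> A \<times> B" and ?I = "univ_index X A" and ?K = "univ_index Y B"
  let ?M = "spatial_tensor (univ_alg X A) (univ_alg Y B)"
  interpret cstar_algebra "?I \<times> ?K" ?M
    by unfold_locales (intro cstar_subalgebra_spatial_tensor cstar_subalgebra_univ_alg)
  have "\<exists>q\<in>C_q X Y A B. \<forall>t\<in>?D. \<bar>q t - p t\<bar> < \<epsilon>" if \<epsilon>: "\<epsilon> > 0" for \<epsilon>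
  proof -
    define V where "V = (\<Inter>t\<in>?D. {q. \<bar>q t - p t\<bar> < \<epsilon>})"
    have "open V"
      unfolding V_def using fin
      by (intro open_INT ballI open_Collect_less continuous_intros continuous_on_product_coordinates) auto
    moreover have "p \<in> V \<inter> closure (C_q X Y A B)" using p \<epsilon> by (auto simp: V_def C_qa_def)
    ultimately have "V \<inter> C_q X Y A B \<noteq> {}" using open_Int_closure_eq_empty[of V] by blast
    thus ?thesis by (auto simp: V_def)
  qed
  hence "\<exists>q\<in>C_q X Y A B. \<forall>t\<in>?D. \<bar>q t - p t\<bar> < 1 / Suc n" for n by simp
  then obtain q where q: "\<And>n. q n \<in> C_q X Y A B" "\<And>n t. t \<in> ?D \<Longrightarrow> \<bar>q n t - p t\<bar> < 1 / Suc n" by metis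
  have qlim: "(\<lambda>n. q n t) \<longlonglongrightarrow> p t" if "t \<in> ?D" for t
  proof (rule Lim_null_comparison[THEN LIM_zero_cancel])
    show "\<forall>\<^sub>F n in sequentially. norm (q n t - p t) \<le> 1 / Suc n"
      using q(2)[OF that] by (auto intro!: always_eventually less_imp_le)
    show "(\<lambda>n. 1 / real (Suc n)) \<longlonglongrightarrow> 0" by (rule LIMSEQ_Suc[OF lim_1_over_n])
  qed
  define good where "good n \<Psi> \<longleftrightarrow> \<Psi> \<in> ell2_on (?I \<times> ?K) \<and> norm \<Psi> = 1 \<and>
    (\<forall>x\<in>X. \<forall>y\<in>Y. \<forall>a\<in>A. \<forall>b\<in>B.
      complex_of_real (q n (x, y, a, b)) = cinner \<Psi> ((univ_gen X A x a \<otimes>\<^sub>o univ_gen Y B y b) \<Psi>))" for n \<Psi>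
  have "\<forall>n. \<exists>\<Psi>. good n \<Psi>" using C_q_vector_state[OF q(1)] unfolding good_def by blast
  then obtain \<psi> where \<psi>: "\<And>n. good n (\<psi> n)" by metis
  have unit: "norm (\<psi> n) = 1" and supp: "\<psi> n \<in> ell2_on (?I \<times> ?K)" for n
    using \<psi>[of n] by (simp_all add: good_def)
  obtain G \<tau> where G: "G \<noteq> bot" "G \<le> sequentially"
    and \<tau>: "\<And>R. ((\<lambda>n. cinner (\<psi> n) (blinfun_apply R (\<psi> n))) \<longlongrightarrow> \<tau> R) G"
    using vector_states_cluster[of \<psi>, OF unit] by blast
  have "state_on (?I \<times> ?K) ?M \<tau>"
    unfolding state_on_def
  proof (intro conjI ballI allI)
    fix S T :: "((('x, 'a) rep \<times> nat) \<times> (('y, 'b) rep \<times> nat)) op"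
    have "((\<lambda>n. cinner (\<psi> n) ((S + T) (\<psi> n))) \<longlongrightarrow> \<tau> S + \<tau> T) G"
      using tendsto_add[OF \<tau>[of S] \<tau>[of T]] by (simp add: blinfun.add_left cinner_add_right)
    with \<tau>[of "S + T"] show "\<tau> (S + T) = \<tau> S + \<tau> T" by (rule tendsto_unique[OF G(1)])
  next
    fix c and T :: "((('x, 'a) rep \<times> nat) \<times> (('y, 'b) rep \<times> nat)) op"
    have "((\<lambda>n. cinner (\<psi> n) (scaleC_op c T (\<psi> n))) \<longlongrightarrow> c * \<tau> T) G"
      using tendsto_mult_left[OF \<tau>[of T], of c] by (simp add: cinner_scaleC_right)
    with \<tau>[of "scaleC_op c T"] show "\<tau> (scaleC_op c T) = c * \<tau> T" by (rule tendsto_unique[OF G(1)])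
  next
    fix T assume T: "T \<in> ?M"
    have "cinner (\<psi> n) ((adj T o\<^sub>L T) (\<psi> n)) = of_real ((norm (T (\<psi> n)))\<^sup>2)" for n
      by (simp add: cinner_adj_right clinear T cinner_self)
    hence "cinner (\<psi> n) ((adj T o\<^sub>L T) (\<psi> n)) \<in> \<real>\<^sub>\<ge>\<^sub>0" for n
      by (simp del: of_real_power)
    thus "\<tau> (adj T o\<^sub>L T) \<in> \<real>\<^sub>\<ge>\<^sub>0"
      by (intro Lim_in_closed_set[OF closed_nonneg_Reals_complex _ G(1) \<tau>]) (auto intro!: always_eventually)
  next
    have "cinner (\<psi> n) (id_on (?I \<times> ?K) (\<psi> n)) = 1" for n
      using supp[of n] by (simp add: restrict_ell2_eq_iff[symmetric] cinner_self unit)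
    hence "((\<lambda>n. cinner (\<psi> n) (id_on (?I \<times> ?K) (\<psi> n))) \<longlongrightarrow> 1) G" by simp
    with \<tau> show "\<tau> (id_on (?I \<times> ?K)) = 1" by (rule tendsto_unique[OF G(1)])
  qed
  moreover have "complex_of_real (p (x, y, a, b)) = \<tau> (univ_gen X A x a \<otimes>\<^sub>o univ_gen Y B y b)"
    if "x \<in> X" "y \<in> Y" "a \<in> A" "b \<in> B" for x y a b
  proof (rule tendsto_unique[OF G(1) _ \<tau>])
    have "(\<lambda>n. complex_of_real (q n (x, y, a, b))) \<longlonglongrightarrow> of_real (p (x, y, a, b))"
      using that by (intro tendsto_of_real qlim) auto
    hence "((\<lambda>n. complex_of_real (q n (x, y, a, b))) \<longlongrightarrow> of_real (p (x, y, a, b))) G"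
      by (rule tendsto_mono[OF G(2)])
    moreover have "complex_of_real (q n (x, y, a, b)) =
        cinner (\<psi> n) ((univ_gen X A x a \<otimes>\<^sub>o univ_gen Y B y b) (\<psi> n))" for n
      using \<psi>[of n] that by (simp add: good_def)
    ultimately show "((\<lambda>n. cinner (\<psi> n) ((univ_gen X A x a \<otimes>\<^sub>o univ_gen Y B y b) (\<psi> n))) \<longlongrightarrow>
        of_real (p (x, y, a, b))) G" by simp
  qed
  ultimately show ?thesis by (intro exI[of _ \<tau>]) blast
qed

section \<open>Quantum approximable perfect correlations and tracial marginals\<close>

theorem theorem2p1:
  fixes X :: "'x set" and Y :: "'y set" and A :: "'a set" and B :: "'b set"
    and lam :: "'x \<times> 'y \<times> 'a \<times> 'b \<Rightarrow> nat"
    and p :: "'x \<times> 'y \<times> 'a \<times> 'b \<Rightarrow> real"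
  assumes "imitation_game X Y A B lam"
    and "p \<in> C_ns_game X Y A B lam"
  shows "p \<in> C_qa_game X Y A B lam \<longleftrightarrow>
    (\<exists>\<tau>. state_on (univ_index X A \<times> univ_index Y B) (spatial_tensor (univ_alg X A) (univ_alg Y B)) \<tau> \<and>
      (\<forall>x\<in>X. \<forall>y\<in>Y. \<forall>a\<in>A. \<forall>b\<in>B.
        complex_of_real (p (x, y, a, b)) = \<tau> (univ_gen X A x a \<otimes>\<^sub>o univ_gen Y B y b)) \<and>
      tracial_on {S \<otimes>\<^sub>o id_on (univ_index Y B) | S. S \<in> univ_alg X A} \<tau> \<and>
      tracial_on {id_on (univ_index X A) \<otimes>\<^sub>o T | T. T \<in> univ_alg Y B} \<tau>)"
proof -
  have fin: "finite X" "finite Y" "finite A" "finite B"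
    using assms(1) by (auto simp: imitation_game_def nonlocal_game_def)
  have p: "p \<in> C_ns X Y A B" using assms(2) by (simp add: C_ns_game_def)
  show ?thesis
  proof
    assume "p \<in> C_qa_game X Y A B lam"
    hence "p \<in> C_qa X Y A B" by (simp add: C_qa_game_def)
    from C_qa_imp_state[OF fin this] obtain \<tau> where
      \<tau>: "state_on (univ_index X A \<times> univ_index Y B) (spatial_tensor (univ_alg X A) (univ_alg Y B)) \<tau>"
      and p\<tau>: "\<forall>x\<in>X. \<forall>y\<in>Y. \<forall>a\<in>A. \<forall>b\<in>B.
        complex_of_real (p (x, y, a, b)) = \<tau> (univ_gen X A x a \<otimes>\<^sub>o univ_gen Y B y b)" by blast
    show "\<exists>\<tau>. state_on (univ_index X A \<times> univ_index Y B) (spatial_tensor (univ_alg X A) (univ_alg Y B)) \<tau> \<and>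
      (\<forall>x\<in>X. \<forall>y\<in>Y. \<forall>a\<in>A. \<forall>b\<in>B.
        complex_of_real (p (x, y, a, b)) = \<tau> (univ_gen X A x a \<otimes>\<^sub>o univ_gen Y B y b)) \<and>
      tracial_on {S \<otimes>\<^sub>o id_on (univ_index Y B) | S. S \<in> univ_alg X A} \<tau> \<and>
      tracial_on {id_on (univ_index X A) \<otimes>\<^sub>o T | T. T \<in> univ_alg Y B} \<tau>"
      using \<tau> p\<tau> perfect_state_tracial[OF assms \<tau>] by blast
  next
    assume "\<exists>\<tau>. state_on (univ_index X A \<times> univ_index Y B) (spatial_tensor (univ_alg X A) (univ_alg Y B)) \<tau> \<and>
      (\<forall>x\<in>X. \<forall>y\<in>Y. \<forall>a\<in>A. \<forall>b\<in>B.
        complex_of_real (p (x, y, a, b)) = \<tau> (univ_gen X A x a \<otimes>\<^sub>o univ_gen Y B y b)) \<and>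
      tracial_on {S \<otimes>\<^sub>o id_on (univ_index Y B) | S. S \<in> univ_alg X A} \<tau> \<and>
      tracial_on {id_on (univ_index X A) \<otimes>\<^sub>o T | T. T \<in> univ_alg Y B} \<tau>"
    then obtain \<tau> where
      \<tau>: "state_on (univ_index X A \<times> univ_index Y B) (spatial_tensor (univ_alg X A) (univ_alg Y B)) \<tau>"
      and p\<tau>: "\<forall>x\<in>X. \<forall>y\<in>Y. \<forall>a\<in>A. \<forall>b\<in>B.
        complex_of_real (p (x, y, a, b)) = \<tau> (univ_gen X A x a \<otimes>\<^sub>o univ_gen Y B y b)" by blast
    have "p \<in> C_qa X Y A B" by (rule state_imp_C_qa[OF fin \<tau> p]) (use p\<tau> in auto)
    thus "p \<in> C_qa_game X Y A B lam" using assms(2) by (simp add: C_qa_game_def)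
  qed
qed

end
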